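(* Suppose $\Phi$ is adapted to the natural filtration of $L$ with $\mathbb E[\sup_{s\in[-r,0]}|\Phi_s|^2]<\infty$ and $\mathbb E[L_1^4]<\infty$, let $X$ be the unique strong solution of the CDGARCH variance equation with initial condition $\Phi$, let $m(t):=\mathbb E[X_t]$ for $t\in[-r,\infty)$, and let $\phi(u)=\mathbb E[\Phi_u]$ on $[-r,0]$, assumed positive. Write $c_0:=c_\mu-\kappa_2c_\nu$ and $f:=f_\mu+\kappa_2f_\nu$. Then: (a) $m$ is finite-valued, continuously differentiable on $(0,\infty)$ and satisfies $\frac{d}{dt}m(t)=\eta-c_0m(t)+\int_{-r}^0m(t+u)f(u)\,du$ for $t>0$, with $m(u)=\phi(u)$ for $u\in[-r,0]$; (b) $m$ satisfies the renewal equation $m(t)=\int_0^t\zeta(t-u)m(u)\,du+h(t)$, $t>0$, with $m(0)=\phi(0)$, where $\zeta(t)=-c_0\mathbf 1_{(0,\infty)}(t)+\int_0^{t\wedge r}f(-u)\,du$ for $t\in[0,\infty)$ and $$h(t)=m(0)+\frac{\eta}{\zeta(r)}\int_0^t\zeta(u)\,du+\int_0^r(\zeta(t+u)-\zeta(u))\Big(m(-u)+\frac{\eta}{\zeta(r)}\Big)du.$$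
   Context: Let $p,q\ge0$, $r:=p\vee q>0$, $(\Omega,\mathcal F,\mathbb F=(\mathcal F_t)_{t\ge-r},\mathbb P)$ a filtered probability space with the usual conditions, and $(L_t)_{t\ge-r}$ a càdlàg adapted centered square-integrable Lévy process with $L_{-r}=0$, increments independent of the past and stationary, Lévy measure $\Pi_L$ and no Brownian component; $S=[L,L]$, $S_t=\sum_{-r<s\le t}(\Delta L_s)^2$, $\kappa_2=\int z^2\Pi_L(dz)$. Parameters: $\eta>0$, $c_\mu,c_\nu>0$, $f_\mu,f_\nu$ nonnegative continuous supported on $[-p,0]$, $[-q,0]$; $\mu(E)=\int_{E\cap[-p,0]}f_\mu-c_\mu\delta_0(E)$, $\nu(E)=\int_{E\cap[-q,0]}f_\nu+c_\nu\delta_0(E)$. Extend $\Phi_t=\Phi_0$ for $t>0$, $\theta_t=\Phi_t+\eta t\mathbf 1_{[0,\infty)}(t)$. CDGARCH variance equation: $X_t=\theta_t+\int_{-p}^0\int_u^{t+u}X_s\,ds\,\mu(du)+\int_{-q}^0\int_{u+}^{t+u}X_{s-}\,dS_s\,\nu(du)$, $t\ge0$, $X=\Phi$ on $[-r,0]$; its strong solution is the unique adapted càdlàg $X$ with $\mathbb E[\sup_{s\in[-r,t]}|X_s|^2]<\infty$ for all $t$ satisfying it. In (b), $m(-u)$ for $u\in[0,r]$ equals $\phi(-u)$.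
   Formalization: Part (b) is stated under the extra condition ζ(r) ≠ 0, since h(t) divides by ζ(r), which the stated parameters allow to vanish (when c_0 equals the integral of f over [-r,0]); part (a) is unrestricted. *)

theory Defs
  imports "HOL-Probability.Probability"
begin

definition cadlag_from :: "real \<Rightarrow> (real \<Rightarrow> real) \<Rightarrow> bool" where
  "cadlag_from a g \<longleftrightarrow>
     (\<forall>t\<ge>a. (g \<longlongrightarrow> g t) (at_right t)) \<and>
     (\<forall>t>a. \<exists>l. (g \<longlongrightarrow> l) (at_left t))"

definition left_lim :: "(real \<Rightarrow> real) \<Rightarrow> real \<Rightarrow> real" where
  "left_lim g s = Lim (at_left s) g"

definition jump :: "(real \<Rightarrow> real) \<Rightarrow> real \<Rightarrow> real" where
  "jump g s = g s - left_lim g s"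

text \<open>Pathwise Lebesgue--Stieltjes integral over (a,b] of X_{s-} with respect to
 S = [L,L], S_t = sum of squared jumps, i.e. sum over s in (a,b] of X_{s-} (\<Delta>L_s)^2.\<close>
definition dS_integral :: "(real \<Rightarrow> real) \<Rightarrow> (real \<Rightarrow> real) \<Rightarrow> real \<Rightarrow> real \<Rightarrow> real" where
  "dS_integral x l a b = (\<Sum>\<^sub>\<infinity>s\<in>{a<..b}. left_lim x s * (jump l s)^2)"

definition filtration_usual :: "'a measure \<Rightarrow> real \<Rightarrow> (real \<Rightarrow> 'a set set) \<Rightarrow> bool" where
  "filtration_usual M a F \<longleftrightarrow>
     (\<forall>t\<ge>a. sigma_algebra (space M) (F t) \<and> F t \<subseteq> sets M) \<and>
     (\<forall>s t. a \<le> s \<longrightarrow> s \<le> t \<longrightarrow> F s \<subseteq> F t) \<and>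
     (\<forall>t\<ge>a. F t = (\<Inter>u\<in>{t<..}. F u)) \<and>
     (\<forall>A. A \<subseteq> space M \<longrightarrow> (\<exists>N\<in>null_sets M. A \<subseteq> N) \<longrightarrow> A \<in> F a)"

definition adapted_on :: "'a measure \<Rightarrow> real set \<Rightarrow> (real \<Rightarrow> 'a set set) \<Rightarrow> (real \<Rightarrow> 'a \<Rightarrow> real) \<Rightarrow> bool" where
  "adapted_on M I F X \<longleftrightarrow>
     (\<forall>t\<in>I. \<forall>B\<in>sets borel. {\<omega>\<in>space M. X t \<omega> \<in> B} \<in> F t)"

definition natural_filtration :: "'a measure \<Rightarrow> real \<Rightarrow> (real \<Rightarrow> 'a \<Rightarrow> real) \<Rightarrow> real \<Rightarrow> 'a set set" where
  "natural_filtration M a L t =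
     sigma_sets (space M) (\<Union>u\<in>{a..t}. {{\<omega>\<in>space M. L u \<omega> \<in> B} | B. B \<in> sets borel})"

definition levy_measure :: "'a measure \<Rightarrow> real \<Rightarrow> (real \<Rightarrow> 'a \<Rightarrow> real) \<Rightarrow> real measure" where
  "levy_measure M a L = measure_of UNIV (sets borel)
     (\<lambda>B. \<integral>\<^sup>+\<omega>. (\<integral>\<^sup>+s. indicator (B - {0}) (jump (\<lambda>v. L v \<omega>) s) \<partial>count_space {a<..a+1}) \<partial>M)"

text \<open>No Brownian component: the Levy--Khintchine triplet of L_{a+1} (unit time increment)
 has Gaussian coefficient 0.\<close>
definition no_brownian_component :: "'a measure \<Rightarrow> real \<Rightarrow> (real \<Rightarrow> 'a \<Rightarrow> real) \<Rightarrow> bool" where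
  "no_brownian_component M a L \<longleftrightarrow>
     (\<exists>\<gamma>::real. \<forall>\<theta>::real. char (distr M borel (L (a + 1))) \<theta> =
        exp (\<i> * complex_of_real (\<gamma> * \<theta>) +
             (\<integral>z. (exp (\<i> * complex_of_real (\<theta> * z)) - 1
                     - \<i> * complex_of_real (\<theta> * z * indicator {-1..1} z)) \<partial>levy_measure M a L)))"

definition levy_process :: "'a measure \<Rightarrow> real \<Rightarrow> (real \<Rightarrow> 'a set set) \<Rightarrow> (real \<Rightarrow> 'a \<Rightarrow> real) \<Rightarrow> bool" where
  "levy_process M a F L \<longleftrightarrow>
     (\<forall>\<omega>\<in>space M. L a \<omega> = 0) \<and>
     (\<forall>\<omega>\<in>space M. cadlag_from a (\<lambda>t. L t \<omega>)) \<and>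
     adapted_on M {a..} F L \<and>
     (\<forall>s t. a \<le> s \<longrightarrow> s \<le> t \<longrightarrow> (\<forall>A\<in>F s. \<forall>B\<in>sets borel.
         measure M (A \<inter> {\<omega>\<in>space M. L t \<omega> - L s \<omega> \<in> B})
           = measure M A * measure M {\<omega>\<in>space M. L t \<omega> - L s \<omega> \<in> B})) \<and>
     (\<forall>s t. a \<le> s \<longrightarrow> s \<le> t \<longrightarrow>
         distr M borel (\<lambda>\<omega>. L t \<omega> - L s \<omega>) = distr M borel (L (a + (t - s)))) \<and>
     (\<forall>t\<ge>a. integrable M (\<lambda>\<omega>. (L t \<omega>)^2) \<and> integrable M (L t) \<and> (\<integral>\<omega>. L t \<omega> \<partial>M) = 0) \<and>
     no_brownian_component M a L"

definition ext_init :: "(real \<Rightarrow> 'a \<Rightarrow> real) \<Rightarrow> real \<Rightarrow> 'a \<Rightarrow> real" where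
  "ext_init \<Phi> t \<omega> = (if t > 0 then \<Phi> 0 \<omega> else \<Phi> t \<omega>)"

definition theta :: "real \<Rightarrow> (real \<Rightarrow> 'a \<Rightarrow> real) \<Rightarrow> real \<Rightarrow> 'a \<Rightarrow> real" where
  "theta \<eta> \<Phi> t \<omega> = ext_init \<Phi> t \<omega> + \<eta> * t * indicator {0..} t"

text \<open>Right-hand side of the variance equation at time t \<ge> 0, path \<omega>, with
 \<mu>(du) = f_\<mu>(u) 1_{[-p,0]}(u) du - c_\<mu> \<delta>_0(du), \<nu>(du) = f_\<nu>(u) 1_{[-q,0]}(u) du + c_\<nu> \<delta>_0(du).\<close>
definition cdgarch_rhs ::
  "real \<Rightarrow> real \<Rightarrow> real \<Rightarrow> real \<Rightarrow> real \<Rightarrow> (real \<Rightarrow> real) \<Rightarrow> (real \<Rightarrow> real)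
   \<Rightarrow> (real \<Rightarrow> 'a \<Rightarrow> real) \<Rightarrow> (real \<Rightarrow> 'a \<Rightarrow> real) \<Rightarrow> (real \<Rightarrow> 'a \<Rightarrow> real) \<Rightarrow> real \<Rightarrow> 'a \<Rightarrow> real" where
  "cdgarch_rhs p q \<eta> c\<mu> c\<nu> f\<mu> f\<nu> L \<Phi> X t \<omega> =
     theta \<eta> \<Phi> t \<omega>
     + (integral {-p..0} (\<lambda>u. integral {u..t+u} (\<lambda>s. X s \<omega>) * f\<mu> u)
        - c\<mu> * integral {0..t} (\<lambda>s. X s \<omega>))
     + (integral {-q..0} (\<lambda>u. dS_integral (\<lambda>s. X s \<omega>) (\<lambda>s. L s \<omega>) u (t+u) * f\<nu> u)
        + c\<nu> * dS_integral (\<lambda>s. X s \<omega>) (\<lambda>s. L s \<omega>) 0 t)"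

definition cdgarch_strong_solution ::
  "'a measure \<Rightarrow> (real \<Rightarrow> 'a set set) \<Rightarrow> real \<Rightarrow> real \<Rightarrow> real \<Rightarrow> real \<Rightarrow> real
   \<Rightarrow> (real \<Rightarrow> real) \<Rightarrow> (real \<Rightarrow> real) \<Rightarrow> (real \<Rightarrow> 'a \<Rightarrow> real) \<Rightarrow> (real \<Rightarrow> 'a \<Rightarrow> real)
   \<Rightarrow> (real \<Rightarrow> 'a \<Rightarrow> real) \<Rightarrow> bool" where
  "cdgarch_strong_solution M F p q \<eta> c\<mu> c\<nu> f\<mu> f\<nu> L \<Phi> X \<longleftrightarrow>
     adapted_on M {- max p q..} F X \<and>
     (\<forall>\<omega>\<in>space M. cadlag_from (- max p q) (\<lambda>t. X t \<omega>)) \<and>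
     (\<forall>t\<ge>0. (\<integral>\<^sup>+\<omega>. (SUP s\<in>{- max p q..t}. ennreal ((X s \<omega>)^2)) \<partial>M) < \<infinity>) \<and>
     (AE \<omega> in M. \<forall>u\<in>{- max p q..0}. X u \<omega> = \<Phi> u \<omega>) \<and>
     (\<forall>t\<ge>0. AE \<omega> in M. X t \<omega> = cdgarch_rhs p q \<eta> c\<mu> c\<nu> f\<mu> f\<nu> L \<Phi> X t \<omega>)"

definition zeta :: "real \<Rightarrow> (real \<Rightarrow> real) \<Rightarrow> real \<Rightarrow> real \<Rightarrow> real" where
  "zeta c0 f r t = - c0 * indicator {0<..} t + integral {0..min t r} (\<lambda>u. f (- u))"

definition renewal_h :: "real \<Rightarrow> real \<Rightarrow> (real \<Rightarrow> real) \<Rightarrow> real \<Rightarrow> (real \<Rightarrow> real) \<Rightarrow> real \<Rightarrow> real" where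
  "renewal_h \<eta> c0 f r m t =
     m 0 + \<eta> / zeta c0 f r r * integral {0..t} (zeta c0 f r)
     + integral {0..r} (\<lambda>u. (zeta c0 f r (t + u) - zeta c0 f r u) * (m (- u) + \<eta> / zeta c0 f r r))"

end

theory Submission
  imports Defs
begin

text \<open>
  Taking expectations in the variance equation requires the expectation of the integrals \<open>dS\<^sub>s\<close>, that is
  the compensation formula for the jumps of \<open>L\<close>. A test function \<open>g\<close> vanishing near \<open>0\<close> turns the sum of
  \<open>g (\<Delta>L\<^sub>s)\<close> over an interval into a limit of sums of \<open>g\<close> over the increments of \<open>L\<close> along a grid. The
  Laplace transforms of the latter are powers, since the increments are independent and stationary, so
  the number of jumps in \<open>(u, v]\<close> of size in an open set \<open>U\<close> with \<open>0 \<notin> U\<close> has conditional mean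
  \<open>(v - u) \<Pi>\<^sub>L(U)\<close> given the past of \<open>u\<close>. As the sets \<open>(u, v] \<times> A \<times> U\<close> with \<open>A\<close> in the past of \<open>u\<close> generate
  the predictable sets, the jump measure has intensity \<open>ds \<otimes> P \<otimes> \<Pi>\<^sub>L\<close> there.

  Exchanging the order of integration, the delayed integrals in the variance equation become integrals
  over the times \<open>s\<close>, each weighted by the mass of the delays that reach \<open>s\<close>. Their expectations combine
  \<open>f\<^sub>\<mu>\<close> and \<open>f\<^sub>\<nu>\<close> to \<open>f = f\<^sub>\<mu> + \<kappa>\<^sub>2 f\<^sub>\<nu>\<close>, and the resulting equation for the mean is the delay differential
  equation in integrated form. The weight of \<open>s\<close> at time \<open>t\<close> is the difference of the tail integrals of
  \<open>f\<close> at \<open>t - s\<close> and at \<open>- s\<close>, where the second vanishes for \<open>s > 0\<close>. Together with the term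
  \<open>- c\<^sub>0 \<integral> m\<close>, the times \<open>s > 0\<close> therefore contribute the convolution with \<open>\<zeta>\<close>; everything else is \<open>h\<close>.
\<close>

section \<open>Cadlag paths\<close>

lemma cadlag_from_at_right:
  assumes "cadlag_from a x" "a \<le> t"
  shows "(x \<longlongrightarrow> x t) (at_right t)"
  using assms by (simp add: cadlag_from_def)

lemma left_lim_eqI:
  fixes x :: "real \<Rightarrow> real"
  assumes "(x \<longlongrightarrow> l) (at_left s)"
  shows "left_lim x s = l"
  unfolding left_lim_def using assms by (intro tendsto_Lim) auto

lemma cadlag_from_at_left:
  assumes "cadlag_from a x" "a < s"
  shows "(x \<longlongrightarrow> left_lim x s) (at_left s)"
  using assms left_lim_eqI unfolding cadlag_from_def by metis

lemma cadlag_from_mono: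
  assumes "cadlag_from a x" "a \<le> b"
  shows "cadlag_from b x"
  using assms by (simp add: cadlag_from_def)

definition fragmentation :: "(real \<Rightarrow> real) \<Rightarrow> real \<Rightarrow> real \<Rightarrow> real \<Rightarrow> real set \<Rightarrow> bool" where
  "fragmentation x e a b D \<longleftrightarrow> finite D \<and> D \<subseteq> {a<..b} \<and>
     (\<forall>s t. a \<le> s \<longrightarrow> s \<le> t \<longrightarrow> t \<le> b \<longrightarrow> {s<..t} \<inter> D = {} \<longrightarrow> \<bar>x t - x s\<bar> < e)"

lemma fragmentation_finite: "fragmentation x e a b D \<Longrightarrow> finite D"
  and fragmentation_subset: "fragmentation x e a b D \<Longrightarrow> D \<subseteq> {a<..b}"
  and fragmentation_less:
    "fragmentation x e a b D \<Longrightarrow> a \<le> s \<Longrightarrow> s \<le> t \<Longrightarrow> t \<le> b \<Longrightarrow> {s<..t} \<inter> D = {} \<Longrightarrow> \<bar>x t - x s\<bar> < e"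
  by (auto simp: fragmentation_def)

lemma fragmentationI:
  assumes "finite D"
    and "\<And>s t. a \<le> s \<Longrightarrow> s \<le> t \<Longrightarrow> t \<le> b \<Longrightarrow> {s<..t} \<inter> D = {} \<Longrightarrow> \<bar>x t - x s\<bar> < e"
  shows "fragmentation x e a b (D \<inter> {a<..b})"
proof -
  have "{s<..t} \<inter> (D \<inter> {a<..b}) = {s<..t} \<inter> D" if "a \<le> s" "t \<le> b" for s t
    using that by auto
  with assms show ?thesis unfolding fragmentation_def by simp
qed

lemma fragmentation_join:
  assumes D: "fragmentation x e a b D" and D': "fragmentation x e b c D'"
  shows "fragmentation x e a c (insert b (D \<union> D') \<inter> {a<..c})"
proof (rule fragmentationI)
  show "finite (insert b (D \<union> D'))"
    using fragmentation_finite[OF D] fragmentation_finite[OF D'] by simp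
  fix s t
  assume st: "a \<le> s" "s \<le> t" "t \<le> c" "{s<..t} \<inter> insert b (D \<union> D') = {}"
  then have "b \<le> s \<or> t < b" by auto
  with st show "\<bar>x t - x s\<bar> < e"
    using fragmentation_less[OF D, of s t] fragmentation_less[OF D', of s t]
    by (auto simp: Int_Un_distrib)
qed

lemma cadlag_small_oscillation_right:
  assumes x: "cadlag_from a x" and e: "0 < e" and c: "a \<le> c"
  obtains d where "0 < d" "\<And>s t. c \<le> s \<Longrightarrow> s < c + d \<Longrightarrow> c \<le> t \<Longrightarrow> t < c + d \<Longrightarrow> \<bar>x t - x s\<bar> < e"
proof -
  have "\<forall>\<^sub>F y in at_right c. dist (x y) (x c) < e / 2"
    by (rule tendstoD[OF cadlag_from_at_right[OF x c]]) (use e in simp)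
  then obtain b where b: "c < b" "\<And>y. c < y \<Longrightarrow> y < b \<Longrightarrow> \<bar>x y - x c\<bar> < e / 2"
    unfolding eventually_at_right_field dist_real_def by blast
  have near: "\<bar>x y - x c\<bar> < e / 2" if "c \<le> y" "y < b" for y
    using b(2)[of y] that e by (cases "y = c") auto
  show thesis
  proof (rule that[of "b - c"])
    fix s t assume "c \<le> s" "s < c + (b - c)" "c \<le> t" "t < c + (b - c)"
    then show "\<bar>x t - x s\<bar> < e" using near[of s] near[of t] by linarith
  qed (use b in simp)
qed

lemma cadlag_small_oscillation_left:
  assumes x: "cadlag_from a x" and e: "0 < e"
  obtains d where "0 < d"
    "\<And>s t. a \<le> s \<Longrightarrow> c - d < s \<Longrightarrow> s < c \<Longrightarrow> a \<le> t \<Longrightarrow> c - d < t \<Longrightarrow> t < c \<Longrightarrow> \<bar>x t - x s\<bar> < e"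
proof (cases "a < c")
  case True
  have "\<forall>\<^sub>F y in at_left c. dist (x y) (left_lim x c) < e / 2"
    by (rule tendstoD[OF cadlag_from_at_left[OF x True]]) (use e in simp)
  then obtain b where b: "b < c" "\<And>y. b < y \<Longrightarrow> y < c \<Longrightarrow> \<bar>x y - left_lim x c\<bar> < e / 2"
    unfolding eventually_at_left_field dist_real_def by blast
  show thesis
  proof (rule that[of "c - b"])
    fix s t assume "c - (c - b) < s" "s < c" "c - (c - b) < t" "t < c"
    then show "\<bar>x t - x s\<bar> < e" using b(2)[of s] b(2)[of t] by linarith
  qed (use b in simp)
qed (use that[of 1] in auto)

lemma cadlag_fragmentation:
  assumes x: "cadlag_from a x" and e: "0 < e" and ab: "a \<le> b"
  obtains D where "fragmentation x e a b D"
proof -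
  define P where "P u v \<longleftrightarrow> (\<exists>D. fragmentation x e (max a u) v D)" for u v
  have "P a b" using ab
  proof (induct rule: Bolzano)
    case (trans u v w)
    then obtain D D' where D: "fragmentation x e (max a u) v D"
      and D': "fragmentation x e (max a v) w D'"
      unfolding P_def by blast
    show ?case unfolding P_def
    proof (cases "a \<le> v")
      case True
      with D' have "fragmentation x e v w D'" by (simp add: max_def)
      from fragmentation_join[OF D this] show "\<exists>D. fragmentation x e (max a u) w D" by blast
    next
      case False
      with D' trans(3) have "fragmentation x e (max a u) w D'" by (simp add: max_def)
      then show "\<exists>D. fragmentation x e (max a u) w D" by blast
    qed
  next
    case (local c)
    obtain d where d: "0 < d"
      "\<And>s t. c \<le> s \<Longrightarrow> s < c + d \<Longrightarrow> c \<le> t \<Longrightarrow> t < c + d \<Longrightarrow> \<bar>x t - x s\<bar> < e"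
      using cadlag_small_oscillation_right[OF x e local(1)] by blast
    obtain d' where d': "0 < d'"
      "\<And>s t. a \<le> s \<Longrightarrow> c - d' < s \<Longrightarrow> s < c \<Longrightarrow> a \<le> t \<Longrightarrow> c - d' < t \<Longrightarrow> t < c \<Longrightarrow> \<bar>x t - x s\<bar> < e"
      using cadlag_small_oscillation_left[OF x e] by blast
    have "fragmentation x e (max a u) v ({c} \<inter> {max a u<..v})"
      if uv: "u \<le> c" "c \<le> v" "v - u < min d d'" for u v
    proof (rule fragmentationI)
      fix s t assume st: "max a u \<le> s" "s \<le> t" "t \<le> v" "{s<..t} \<inter> {c} = {}"
      then have "c \<le> s \<or> t < c" by auto
      with st uv show "\<bar>x t - x s\<bar> < e" using d(2)[of s t] d'(2)[of s t] by auto
    qed simp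
    then show ?case using d(1) d'(1) unfolding P_def by (intro exI[of _ "min d d'"]) auto
  qed
  then show thesis using that by (auto simp: P_def)
qed

lemma abs_jump_le_if_fragmentation:
  assumes x: "cadlag_from a x" and D: "fragmentation x e a b D"
    and s: "a < s" "s \<le> b" "s \<notin> D"
  shows "\<bar>jump x s\<bar> \<le> e"
proof -
  have "((\<lambda>y. \<bar>x s - x y\<bar>) \<longlongrightarrow> \<bar>x s - left_lim x s\<bar>) (at_left s)"
    by (intro tendsto_intros cadlag_from_at_left[OF x s(1)])
  moreover have "\<forall>\<^sub>F y in at_left s. \<bar>x s - x y\<bar> \<le> e"
  proof -
    have "\<forall>\<^sub>F y in at_left s. \<forall>z\<in>D. z < s \<longrightarrow> z < y"
      by (intro eventually_ball_finite fragmentation_finite[OF D] ballI)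
        (auto intro: eventually_at_leftI eventually_mono[OF eventually_at_left_real])
    moreover have "\<forall>\<^sub>F y in at_left s. a < y \<and> y < s"
      using eventually_at_left_real[OF s(1)] by (auto elim: eventually_mono)
    ultimately show ?thesis
    proof eventually_elim
      case (elim y)
      then have "{y<..s} \<inter> D = {}" using s(3) by force
      with elim s show ?case using fragmentation_less[OF D, of y s] by simp
    qed
  qed
  ultimately show ?thesis unfolding jump_def
    by (intro tendsto_upperbound) auto
qed

definition jump_times :: "(real \<Rightarrow> real) \<Rightarrow> real set \<Rightarrow> real set" where
  "jump_times x I = {s \<in> I. jump x s \<noteq> 0}"

lemma countable_jump_times:
  assumes x: "cadlag_from a x"
  shows "countable (jump_times x {a<..})"
proof -
  have "\<exists>D. fragmentation x (1 / real (Suc n)) a (a + real n) D" for n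
    by (rule cadlag_fragmentation[OF x, of "1 / real (Suc n)" "a + real n"]) auto
  then obtain D where D: "\<And>n. fragmentation x (1 / real (Suc n)) a (a + real n) (D n)"
    by metis
  have "s \<in> (\<Union>n. D n)" if s: "a < s" "jump x s \<noteq> 0" for s
  proof -
    obtain k where k: "s - a \<le> real k" using real_arch_simple by blast
    obtain l where l: "1 / real (Suc l) < \<bar>jump x s\<bar>"
      using s(2) nat_approx_posE[of "\<bar>jump x s\<bar>"] by auto
    let ?n = "max k l"
    have "1 / real (Suc ?n) \<le> 1 / real (Suc l)" by (simp add: frac_le)
    with l have "\<not> \<bar>jump x s\<bar> \<le> 1 / real (Suc ?n)" by linarith
    moreover have "s \<le> a + real ?n" using k by simp
    ultimately have "s \<in> D ?n" using abs_jump_le_if_fragmentation[OF x D s(1)] by blast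
    then show ?thesis by blast
  qed
  then have "jump_times x {a<..} \<subseteq> (\<Union>n. D n)" by (auto simp: jump_times_def)
  then show ?thesis
    by (rule countable_subset) (auto intro: countable_finite fragmentation_finite[OF D])
qed

lemma AE_left_lim_eq:
  assumes x: "cadlag_from a x"
  shows "AE s in lborel. a < s \<longrightarrow> left_lim x s = x s"
proof -
  have "AE s in lborel. s \<notin> jump_times x {a<..}"
    by (rule AE_not_in[OF countable_imp_null_set_lborel[OF countable_jump_times[OF x]]])
  then show ?thesis by eventually_elim (simp add: jump_times_def jump_def)
qed

definition jump_sum :: "(real \<Rightarrow> ennreal) \<Rightarrow> (real \<Rightarrow> real) \<Rightarrow> real set \<Rightarrow> ennreal" where
  "jump_sum g x I = (\<integral>\<^sup>+s. g (jump x s) \<partial>count_space (jump_times x I))"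

lemma jump_sum_empty [simp]: "jump_sum g x {} = 0"
  by (simp add: jump_sum_def jump_times_def nn_integral_empty)

lemma jump_sum_cong:
  assumes "\<And>z. z \<noteq> 0 \<Longrightarrow> g z = g' z"
  shows "jump_sum g x I = jump_sum g' x I"
  unfolding jump_sum_def by (intro nn_integral_cong) (simp add: assms jump_times_def)

lemma jump_sum_cmult: "jump_sum (\<lambda>z. k * g z) x I = k * jump_sum g x I"
  unfolding jump_sum_def by (rule nn_integral_cmult) simp

lemma jump_sum_SUP:
  assumes "incseq U"
  shows "jump_sum (\<lambda>z. SUP i. U i z) x I = (SUP i. jump_sum (U i) x I)"
  unfolding jump_sum_def
  by (rule nn_integral_monotone_convergence_SUP) (use assms in \<open>auto simp: incseq_def le_fun_def\<close>)

lemma incseq_jump_sum: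
  assumes "incseq U"
  shows "incseq (\<lambda>i. jump_sum (U i) x I)"
  using assms unfolding jump_sum_def by (auto simp: incseq_def le_fun_def intro!: nn_integral_mono)

lemma jump_sum_split:
  assumes "c \<le> d" "d \<le> e"
  shows "jump_sum g x {c<..e} = jump_sum g x {c<..d} + jump_sum g x {d<..e}"
proof -
  have "jump_times x {c<..e} = jump_times x {c<..d} \<union> jump_times x {d<..e}"
    "jump_times x {c<..d} \<inter> jump_times x {d<..e} = {}"
    using assms by (auto simp: jump_times_def)
  then show ?thesis unfolding jump_sum_def
    by (simp add: nn_integral_count_space_indicator indicator_add[symmetric] distrib_left
        nn_integral_add[symmetric])
qed

section \<open>Jump sums as limits of grid sums\<close>

text \<open>The index \<open>k\<close> of the cell \<open>{a + h * k<..a + h * (k + 1)}\<close> containing \<open>s > a\<close>.\<close>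
definition cell :: "real \<Rightarrow> real \<Rightarrow> real \<Rightarrow> nat" where
  "cell a h s = nat (\<lceil>(s - a) / h\<rceil> - 1)"

definition cell_left :: "real \<Rightarrow> real \<Rightarrow> real \<Rightarrow> real" where
  "cell_left a h s = a + h * real (cell a h s)"

definition cell_right :: "real \<Rightarrow> real \<Rightarrow> real \<Rightarrow> real" where
  "cell_right a h s = a + h * (real (cell a h s) + 1)"

lemma cell_right_eq: "cell_right a h s = cell_left a h s + h"
  by (simp add: cell_left_def cell_right_def algebra_simps)

lemma cell_bounds:
  assumes "0 < h" "a < s"
  shows "cell_left a h s < s" and "s \<le> cell_right a h s"
proof -
  have "0 < (s - a) / h" using assms by simp
  then have "1 \<le> \<lceil>(s - a) / h\<rceil>" by linarith
  then have k: "real (cell a h s) = of_int \<lceil>(s - a) / h\<rceil> - 1" by (simp add: cell_def)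
  have "of_int \<lceil>(s - a) / h\<rceil> - 1 < (s - a) / h" "(s - a) / h \<le> of_int \<lceil>(s - a) / h\<rceil>" by linarith+
  then have "h * (of_int \<lceil>(s - a) / h\<rceil> - 1) < s - a" "s - a \<le> h * of_int \<lceil>(s - a) / h\<rceil>"
    using assms by (simp_all only: pos_less_divide_eq pos_divide_le_eq mult.commute[of h])
  then show "cell_left a h s < s" "s \<le> cell_right a h s"
    unfolding cell_left_def cell_right_def k by simp_all
qed

lemma cell_eqI:
  assumes "0 < h" "a + h * real k < s" "s \<le> a + h * (real k + 1)"
  shows "cell a h s = k"
proof -
  have "real k < (s - a) / h" "(s - a) / h \<le> real k + 1" using assms by (auto simp: field_simps)
  then have "\<lceil>(s - a) / h\<rceil> = int k + 1" by (intro ceiling_unique) auto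
  then show ?thesis by (simp add: cell_def)
qed

lemma cell_less:
  assumes "0 < h" "a < s" "s \<le> a + h * real n"
  shows "cell a h s < n"
proof -
  have "h * real (cell a h s) < h * real n"
    using cell_bounds(1)[OF assms(1,2)] assms(3) by (simp add: cell_left_def)
  then show ?thesis using assms(1) by simp
qed

lemma cell_measurable [measurable]: "cell a h \<in> borel \<rightarrow>\<^sub>M count_space UNIV"
  unfolding cell_def[abs_def] by measurable

lemma mesh_tendsto_0: "(\<lambda>n. w / real (Suc n)) \<longlonglongrightarrow> 0"
  using tendsto_mult[OF tendsto_const[of w] LIMSEQ_inverse_real_of_nat]
  by (simp add: divide_inverse)

context
  fixes h :: "nat \<Rightarrow> real" and a s :: real
  assumes mesh_pos: "\<And>n. 0 < h n" and mesh_0: "h \<longlonglongrightarrow> 0" and start_less: "a < s"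
begin

lemma filterlim_cell_left: "filterlim (\<lambda>n. cell_left a (h n) s) (at_left s) sequentially"
proof -
  have "(\<lambda>n. cell_left a (h n) s) \<longlonglongrightarrow> s"
  proof (rule tendsto_sandwich[OF always_eventually always_eventually])
    show "\<forall>n. s - h n \<le> cell_left a (h n) s" "\<forall>n. cell_left a (h n) s \<le> s"
      using cell_bounds[OF mesh_pos start_less]
      by (auto simp: cell_right_eq less_imp_le algebra_simps)
    show "(\<lambda>n. s - h n) \<longlonglongrightarrow> s" using tendsto_diff[OF tendsto_const mesh_0] by simp
  qed simp
  then show ?thesis unfolding filterlim_at
    using cell_bounds(1)[OF mesh_pos start_less]
    by (auto intro!: always_eventually simp: less_imp_neq)
qed

lemma cell_right_tendsto: "(\<lambda>n. cell_right a (h n) s) \<longlonglongrightarrow> s"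
proof -
  have "(\<lambda>n. cell_left a (h n) s) \<longlonglongrightarrow> s"
    using filterlim_cell_left by (simp add: filterlim_at)
  from tendsto_add[OF this mesh_0] show ?thesis by (simp add: cell_right_eq)
qed

lemma cadlag_cell_left_tendsto:
  assumes "cadlag_from a x"
  shows "(\<lambda>n. x (cell_left a (h n) s)) \<longlonglongrightarrow> left_lim x s"
  by (rule filterlim_compose[OF cadlag_from_at_left[OF assms start_less] filterlim_cell_left])

lemma cadlag_cell_right_tendsto:
  assumes "cadlag_from a x"
  shows "(\<lambda>n. x (cell_right a (h n) s)) \<longlonglongrightarrow> x s"
proof -
  have "continuous (at s within {s..}) x"
    using cadlag_from_at_right[OF assms, of s] start_less
    by (simp add: continuous_within at_within_Ici_at_right)
  then show ?thesis
    using cell_right_tendsto cell_bounds(2)[OF mesh_pos start_less]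
    by (auto simp: continuous_within_sequentially comp_def)
qed

end

definition grid_increment :: "(real \<Rightarrow> real) \<Rightarrow> real \<Rightarrow> real \<Rightarrow> nat \<Rightarrow> real" where
  "grid_increment x c h k = x (c + h * (real k + 1)) - x (c + h * real k)"

definition grid_sum :: "(real \<Rightarrow> real) \<Rightarrow> (real \<Rightarrow> real) \<Rightarrow> real \<Rightarrow> real \<Rightarrow> nat \<Rightarrow> real" where
  "grid_sum g x c d n = (\<Sum>k<Suc n. g (grid_increment x c ((d - c) / real (Suc n)) k))"

definition jump_test :: "(real \<Rightarrow> real) \<Rightarrow> bool" where
  "jump_test g \<longleftrightarrow> continuous_on UNIV g \<and> (\<forall>z. 0 \<le> g z) \<and> (\<exists>e>0. \<forall>z. \<bar>z\<bar> \<le> e \<longrightarrow> g z = 0)"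

lemma jump_test_nonneg: "jump_test g \<Longrightarrow> 0 \<le> g z"
  and jump_test_isCont: "jump_test g \<Longrightarrow> isCont g z"
  and jump_test_measurable: "jump_test g \<Longrightarrow> g \<in> borel_measurable borel"
  by (auto simp: jump_test_def continuous_on_eq_continuous_at
      intro: borel_measurable_continuous_onI)

lemma jump_test_mult:
  assumes "jump_test g" "continuous_on UNIV f" "\<And>z. 0 \<le> f z"
  shows "jump_test (\<lambda>z. f z * g z)"
  using assms unfolding jump_test_def by (auto intro!: continuous_intros)

lemma grid_sum_nonneg: "jump_test g \<Longrightarrow> 0 \<le> grid_sum g x c d n"
  unfolding grid_sum_def by (intro sum_nonneg jump_test_nonneg)

lemma inj_on_cell_if_separated:
  assumes h: "0 < h" and D: "D \<subseteq> {c<..}"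
    and sep: "\<And>s s'. s \<in> D \<Longrightarrow> s' \<in> D \<Longrightarrow> s \<noteq> s' \<Longrightarrow> h < \<bar>s - s'\<bar>"
  shows "inj_on (cell c h) D"
proof (rule inj_onI, rule ccontr)
  fix s s' assume s: "s \<in> D" "s' \<in> D" "cell c h s = cell c h s'" "s \<noteq> s'"
  then have "c < s" "c < s'" using D by auto
  from cell_bounds[OF h this(1)] cell_bounds[OF h this(2)] have "\<bar>s - s'\<bar> \<le> h"
    unfolding cell_right_eq cell_left_def s(3) by linarith
  then show False using sep[OF s(1,2,4)] by simp
qed

lemma grid_sum_eq_sum_fragmentation:
  assumes D: "fragmentation x e c d D" and g: "\<And>z. \<bar>z\<bar> \<le> e \<Longrightarrow> g z = 0" and cd: "c < d"
    and sep: "\<And>s s'. s \<in> D \<Longrightarrow> s' \<in> D \<Longrightarrow> s \<noteq> s' \<Longrightarrow> (d - c) / real (Suc n) < \<bar>s - s'\<bar>"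
  defines "h \<equiv> (d - c) / real (Suc n)"
  shows "grid_sum g x c d n = (\<Sum>s\<in>D. g (grid_increment x c h (cell c h s)))"
proof -
  have h: "0 < h" and hd: "c + h * real (Suc n) = d" using cd by (simp_all add: h_def)
  have inj: "inj_on (cell c h) D"
    using fragmentation_subset[OF D] sep
    by (intro inj_on_cell_if_separated[OF h]) (auto simp: h_def)
  have sub: "cell c h ` D \<subseteq> {..<Suc n}"
    using fragmentation_subset[OF D] cell_less[OF h, of c _ "Suc n"] hd by auto
  have zero: "g (grid_increment x c h k) = 0" if k: "k \<in> {..<Suc n} - cell c h ` D" for k
  proof -
    have "{c + h * real k<..c + h * (real k + 1)} \<inter> D = {}"
      using k cell_eqI[OF h, of c k] by (auto simp: image_iff)
    moreover have "h * (real k + 1) \<le> h * real (Suc n)" using k h by auto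
    ultimately have "\<bar>grid_increment x c h k\<bar> < e"
      unfolding grid_increment_def using h hd by (intro fragmentation_less[OF D]) auto
    then show ?thesis by (simp add: g)
  qed
  have "grid_sum g x c d n = (\<Sum>k\<in>cell c h ` D. g (grid_increment x c h k))"
    unfolding grid_sum_def h_def[symmetric]
    by (rule sum.mono_neutral_right[OF _ sub]) (use zero in auto)
  then show ?thesis by (simp add: sum.reindex[OF inj])
qed

lemma grid_sum_tendsto_sum_fragmentation:
  assumes x: "cadlag_from c x" and cd: "c < d" and D: "fragmentation x e c d D"
    and g: "\<And>z. isCont g z" "\<And>z. \<bar>z\<bar> \<le> e \<Longrightarrow> g z = 0"
  shows "grid_sum g x c d \<longlonglongrightarrow> (\<Sum>s\<in>D. g (jump x s))"
proof -
  define h where "h n = (d - c) / real (Suc n)" for n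
  have h: "\<And>n. 0 < h n" "h \<longlonglongrightarrow> 0" using cd mesh_tendsto_0 by (auto simp: h_def[abs_def])
  have "(\<lambda>n. \<Sum>s\<in>D. g (grid_increment x c (h n) (cell c (h n) s))) \<longlonglongrightarrow> (\<Sum>s\<in>D. g (jump x s))"
  proof (intro tendsto_sum isCont_tendsto_compose[OF g(1)])
    fix s assume "s \<in> D"
    then have "c < s" using fragmentation_subset[OF D] by auto
    then show "(\<lambda>n. grid_increment x c (h n) (cell c (h n) s)) \<longlonglongrightarrow> jump x s"
      unfolding grid_increment_def jump_def cell_left_def[symmetric] cell_right_def[symmetric]
      by (intro tendsto_diff cadlag_cell_left_tendsto cadlag_cell_right_tendsto h x)
  qed
  moreover have "\<forall>\<^sub>F n in sequentially. \<forall>s\<in>D. \<forall>s'\<in>D. s \<noteq> s' \<longrightarrow> h n < \<bar>s - s'\<bar>"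
  proof (intro eventually_ball_finite fragmentation_finite[OF D] ballI)
    fix s s'
    show "\<forall>\<^sub>F n in sequentially. s \<noteq> s' \<longrightarrow> h n < \<bar>s - s'\<bar>"
      using order_tendstoD(2)[OF h(2), of "\<bar>s - s'\<bar>"] by (cases "s = s'") auto
  qed
  then have "\<forall>\<^sub>F n in sequentially.
      (\<Sum>s\<in>D. g (grid_increment x c (h n) (cell c (h n) s))) = grid_sum g x c d n"
    unfolding h_def
    by eventually_elim (rule grid_sum_eq_sum_fragmentation[OF D g(2) cd, symmetric], auto)
  ultimately show ?thesis by (rule Lim_transform_eventually)
qed

lemma jump_sum_eq_sum_fragmentation:
  assumes x: "cadlag_from c x" and D: "fragmentation x e c d D"
    and g: "\<And>z. 0 \<le> g z" "0 < e" "\<And>z. \<bar>z\<bar> \<le> e \<Longrightarrow> g z = 0"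
  shows "jump_sum (\<lambda>z. ennreal (g z)) x {c<..d} = ennreal (\<Sum>s\<in>D. g (jump x s))"
proof -
  have fin: "finite D" and sub: "D \<subseteq> {c<..d}"
    by (rule fragmentation_finite[OF D], rule fragmentation_subset[OF D])
  have g0: "g 0 = 0" using g(2,3) by simp
  have "jump_sum (\<lambda>z. ennreal (g z)) x {c<..d}
      = (\<Sum>s\<in>D \<inter> jump_times x {c<..d}. ennreal (g (jump x s)))"
    unfolding jump_sum_def
  proof (rule nn_integral_count_space')
    fix s assume "s \<in> jump_times x {c<..d}" "s \<notin> D \<inter> jump_times x {c<..d}"
    then have "\<bar>jump x s\<bar> \<le> e"
      by (intro abs_jump_le_if_fragmentation[OF x D]) (auto simp: jump_times_def)
    then show "ennreal (g (jump x s)) = 0" by (simp add: g)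
  qed (use fin in auto)
  also have "\<dots> = (\<Sum>s\<in>D. ennreal (g (jump x s)))"
    using sub by (intro sum.mono_neutral_left fin) (auto simp: jump_times_def g0)
  also have "\<dots> = ennreal (\<Sum>s\<in>D. g (jump x s))"
    by (rule sum_ennreal) (simp add: g)
  finally show ?thesis .
qed

lemma
  assumes x: "cadlag_from c x" and cd: "c < d" and g: "jump_test g"
  shows jump_sum_finite: "jump_sum (\<lambda>z. ennreal (g z)) x {c<..d} < \<infinity>"
    and grid_sum_tendsto_jump_sum:
      "grid_sum g x c d \<longlonglongrightarrow> enn2real (jump_sum (\<lambda>z. ennreal (g z)) x {c<..d})"
proof -
  obtain e where e: "0 < e" "\<And>z. \<bar>z\<bar> \<le> e \<Longrightarrow> g z = 0" using g by (auto simp: jump_test_def)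
  obtain D where D: "fragmentation x e c d D"
    by (rule cadlag_fragmentation[OF x e(1) less_imp_le[OF cd]])
  have J: "jump_sum (\<lambda>z. ennreal (g z)) x {c<..d} = ennreal (\<Sum>s\<in>D. g (jump x s))"
    using g e by (intro jump_sum_eq_sum_fragmentation[OF x D]) (auto intro: jump_test_nonneg)
  then show "jump_sum (\<lambda>z. ennreal (g z)) x {c<..d} < \<infinity>" by simp
  have "0 \<le> (\<Sum>s\<in>D. g (jump x s))" by (intro sum_nonneg jump_test_nonneg[OF g])
  with J show "grid_sum g x c d \<longlonglongrightarrow> enn2real (jump_sum (\<lambda>z. ennreal (g z)) x {c<..d})"
    using grid_sum_tendsto_sum_fragmentation[OF x cd D jump_test_isCont[OF g] e(2)] by simp
qed

definition bump :: "real set \<Rightarrow> nat \<Rightarrow> real \<Rightarrow> real" where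
  "bump U n z = min 1 (max 0 (real n * infdist z (- U) - 1))"

lemma bump_nonneg: "0 \<le> bump U n z"
  and bump_le_1: "bump U n z \<le> 1"
  by (auto simp: bump_def)

lemma bump_mono: "n \<le> n' \<Longrightarrow> bump U n z \<le> bump U n' z"
  unfolding bump_def
  by (intro min.mono max.mono diff_right_mono mult_right_mono) (auto simp: infdist_nonneg)

lemma incseq_bump: "incseq (\<lambda>n z. ennreal (bump U n z))"
  by (intro monoI le_funI ennreal_leI bump_mono)

lemma jump_test_bump:
  assumes U: "0 \<notin> U"
  shows "jump_test (bump U n)"
proof -
  have "bump U n z = 0" if z: "\<bar>z\<bar> \<le> 1 / real (Suc n)" for z
  proof -
    have "infdist z (- U) \<le> \<bar>z\<bar>" using infdist_le[of 0 "- U" z] U by simp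
    also note z
    finally have "real n * infdist z (- U) \<le> real n * (1 / real (Suc n))"
      by (intro mult_left_mono) auto
    also have "\<dots> \<le> 1" by simp
    finally show ?thesis by (simp add: bump_def)
  qed
  then have "\<exists>e>0. \<forall>z. \<bar>z\<bar> \<le> e \<longrightarrow> bump U n z = 0" by (intro exI[of _ "1 / real (Suc n)"]) simp
  moreover have "continuous_on UNIV (bump U n)" unfolding bump_def[abs_def]
    by (intro continuous_intros)
  ultimately show ?thesis by (simp add: jump_test_def bump_nonneg)
qed

lemma SUP_bump:
  assumes U: "open U" "0 \<notin> U"
  shows "(SUP n. ennreal (bump U n z)) = indicator U z"
proof (rule antisym)
  have "bump U n z = 0" if "z \<notin> U" for n using that by (simp add: bump_def)
  then show "(SUP n. ennreal (bump U n z)) \<le> indicator U z"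
    by (auto intro!: SUP_least simp: indicator_def bump_le_1)
  show "indicator U z \<le> (SUP n. ennreal (bump U n z))"
  proof (cases "z \<in> U")
    case True
    then have "0 < infdist z (- U)" using U by (intro infdist_pos_not_in_closed) auto
    then obtain n where "2 < real n * infdist z (- U)" using reals_Archimedean3 by blast
    then have "bump U n z = 1" by (simp add: bump_def)
    then show ?thesis using True by (auto intro!: SUP_upper2[of n])
  qed simp
qed

lemma jump_sum_indicator_SUP:
  assumes "open U" "0 \<notin> U"
  shows "jump_sum (indicator U) x I = (SUP n. jump_sum (\<lambda>z. ennreal (bump U n z)) x I)"
  unfolding SUP_bump[OF assms, symmetric, abs_def] by (rule jump_sum_SUP[OF incseq_bump])

section \<open>Laplace transforms and additive functions\<close>

lemma one_minus_exp_quotient_tendsto: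
  fixes w :: real
  shows "(\<lambda>n. real (Suc n) * (1 - exp (- (1 / real (Suc n) * w)))) \<longlonglongrightarrow> w"
proof -
  have "((\<lambda>x. exp (- (x * w))) has_real_derivative - w) (at 0)"
    by (auto intro!: derivative_eq_intros)
  then have "((\<lambda>x. (exp (- (x * w)) - 1) / x) \<longlongrightarrow> - w) (at 0)"
    by (simp add: has_field_derivative_iff)
  moreover have "filterlim (\<lambda>n. 1 / real (Suc n)) (at 0) sequentially"
    using mesh_tendsto_0[of 1] by (auto simp: filterlim_at intro!: always_eventually)
  ultimately have "(\<lambda>n. (exp (- (1 / real (Suc n) * w)) - 1) / (1 / real (Suc n))) \<longlonglongrightarrow> - w"
    by (rule filterlim_compose)
  from tendsto_minus[OF this] show ?thesis by (simp add: algebra_simps)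
qed

lemma one_minus_exp_quotient_le:
  fixes w :: real
  shows "real (Suc n) * (1 - exp (- (1 / real (Suc n) * w))) \<le> w"
proof -
  have "1 - exp (- (1 / real (Suc n) * w)) \<le> 1 / real (Suc n) * w"
    using exp_ge_add_one_self[of "- (1 / real (Suc n) * w)"] by linarith
  then have "real (Suc n) * (1 - exp (- (1 / real (Suc n) * w)))
      \<le> real (Suc n) * (1 / real (Suc n) * w)"
    by (rule mult_left_mono) simp
  then show ?thesis by simp
qed

lemma (in finite_measure) nn_integral_one_minus_exp:
  assumes [measurable]: "W \<in> borel_measurable M" and W: "\<And>\<omega>. 0 \<le> W \<omega>"
    and l: "0 \<le> l" and c: "0 \<le> c"
  shows "(\<integral>\<^sup>+\<omega>. ennreal (c * (1 - exp (- (l * W \<omega>)))) \<partial>M)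
    = ennreal c * (emeasure M (space M) - (\<integral>\<^sup>+\<omega>. ennreal (exp (- (l * W \<omega>))) \<partial>M))"
proof -
  have le: "ennreal (exp (- (l * W \<omega>))) \<le> 1" for \<omega> using W l by (simp add: ennreal_le_1)
  have "(\<integral>\<^sup>+\<omega>. ennreal (exp (- (l * W \<omega>))) \<partial>M) \<le> (\<integral>\<^sup>+\<omega>. 1 \<partial>M)"
    by (intro nn_integral_mono le)
  then have fin: "(\<integral>\<^sup>+\<omega>. ennreal (exp (- (l * W \<omega>))) \<partial>M) \<noteq> \<infinity>"
    by (auto simp: top_unique)
  have "(\<integral>\<^sup>+\<omega>. ennreal (c * (1 - exp (- (l * W \<omega>)))) \<partial>M)
      = (\<integral>\<^sup>+\<omega>. ennreal c * (1 - ennreal (exp (- (l * W \<omega>)))) \<partial>M)"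
    using c by (simp add: ennreal_minus[symmetric] ennreal_mult')
  also have "\<dots> = ennreal c * (\<integral>\<^sup>+\<omega>. 1 - ennreal (exp (- (l * W \<omega>))) \<partial>M)"
    by (rule nn_integral_cmult) measurable
  also have "(\<integral>\<^sup>+\<omega>. 1 - ennreal (exp (- (l * W \<omega>))) \<partial>M)
      = (\<integral>\<^sup>+\<omega>. 1 \<partial>M) - (\<integral>\<^sup>+\<omega>. ennreal (exp (- (l * W \<omega>))) \<partial>M)"
    using fin le by (intro nn_integral_diff) auto
  finally show ?thesis by simp
qed

lemma nn_integral_le_if_laplace_eq:
  assumes M: "finite_measure M" and N: "finite_measure N"
    and W [measurable]: "W \<in> borel_measurable M" and W' [measurable]: "W' \<in> borel_measurable N"
    and nonneg: "\<And>\<omega>. 0 \<le> W \<omega>" "\<And>\<omega>. 0 \<le> W' \<omega>"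
    and laplace: "\<And>l. 0 \<le> l \<Longrightarrow>
      (\<integral>\<^sup>+\<omega>. ennreal (exp (- (l * W \<omega>))) \<partial>M) = (\<integral>\<^sup>+\<omega>. ennreal (exp (- (l * W' \<omega>))) \<partial>N)"
  shows "(\<integral>\<^sup>+\<omega>. ennreal (W \<omega>) \<partial>M) \<le> (\<integral>\<^sup>+\<omega>. ennreal (W' \<omega>) \<partial>N)"
proof -
  let ?q = "\<lambda>n w. ennreal (real (Suc n) * (1 - exp (- (1 / real (Suc n) * w))))"
  have mass: "emeasure M (space M) = emeasure N (space N)" using laplace[of 0] by simp
  have eq: "(\<integral>\<^sup>+\<omega>. ?q n (W \<omega>) \<partial>M) = (\<integral>\<^sup>+\<omega>. ?q n (W' \<omega>) \<partial>N)" for n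
  proof -
    have n: "0 \<le> 1 / real (Suc n)" "0 \<le> real (Suc n)" by simp_all
    show ?thesis
      by (simp only: finite_measure.nn_integral_one_minus_exp[OF M W nonneg(1) n]
          finite_measure.nn_integral_one_minus_exp[OF N W' nonneg(2) n] laplace[OF n(1)] mass)
  qed
  have "(\<integral>\<^sup>+\<omega>. ennreal (W \<omega>) \<partial>M) = (\<integral>\<^sup>+\<omega>. liminf (\<lambda>n. ?q n (W \<omega>)) \<partial>M)"
    by (intro nn_integral_cong lim_imp_Liminf[symmetric] tendsto_ennrealI
        one_minus_exp_quotient_tendsto sequentially_bot)
  also have "\<dots> \<le> liminf (\<lambda>n. \<integral>\<^sup>+\<omega>. ?q n (W \<omega>) \<partial>M)"
    by (rule nn_integral_liminf) measurable
  also have "\<dots> = liminf (\<lambda>n. \<integral>\<^sup>+\<omega>. ?q n (W' \<omega>) \<partial>N)"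
    by (simp only: eq)
  also have "\<dots> \<le> (\<integral>\<^sup>+\<omega>. ennreal (W' \<omega>) \<partial>N)"
    by (intro Liminf_le always_eventually allI nn_integral_mono ennreal_leI
        one_minus_exp_quotient_le) simp
  finally show ?thesis .
qed

lemma nn_integral_eq_if_laplace_eq:
  assumes "finite_measure M" "finite_measure N" "W \<in> borel_measurable M" "W' \<in> borel_measurable N"
    and "\<And>\<omega>. 0 \<le> W \<omega>" "\<And>\<omega>. 0 \<le> W' \<omega>"
    and "\<And>l. 0 \<le> l \<Longrightarrow>
      (\<integral>\<^sup>+\<omega>. ennreal (exp (- (l * W \<omega>))) \<partial>M) = (\<integral>\<^sup>+\<omega>. ennreal (exp (- (l * W' \<omega>))) \<partial>N)"
  shows "(\<integral>\<^sup>+\<omega>. ennreal (W \<omega>) \<partial>M) = (\<integral>\<^sup>+\<omega>. ennreal (W' \<omega>) \<partial>N)"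
  by (rule antisym[OF nn_integral_le_if_laplace_eq[OF assms]
        nn_integral_le_if_laplace_eq[OF assms(2,1,4,3,6,5) assms(7)[symmetric]]])

lemma floor_mult_quotient_tendsto:
  fixes t :: real
  shows "(\<lambda>n. of_int \<lfloor>real (Suc n) * t\<rfloor> / real (Suc n)) \<longlonglongrightarrow> t"
proof (rule tendsto_sandwich[OF always_eventually always_eventually])
  have "t - 1 / real (Suc n) \<le> of_int \<lfloor>real (Suc n) * t\<rfloor> / real (Suc n)
      \<and> of_int \<lfloor>real (Suc n) * t\<rfloor> / real (Suc n) \<le> t" for n
  proof -
    have "real (Suc n) * t - 1 \<le> of_int \<lfloor>real (Suc n) * t\<rfloor>"
      "of_int \<lfloor>real (Suc n) * t\<rfloor> \<le> real (Suc n) * t"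
      by linarith+
    then have "(real (Suc n) * t - 1) / real (Suc n) \<le> of_int \<lfloor>real (Suc n) * t\<rfloor> / real (Suc n)"
      "of_int \<lfloor>real (Suc n) * t\<rfloor> / real (Suc n) \<le> real (Suc n) * t / real (Suc n)"
      by (simp_all only: divide_right_mono of_nat_0_le_iff)
    then show ?thesis by (simp add: diff_divide_distrib del: of_nat_Suc)
  qed
  then show "\<forall>n. t - 1 / real (Suc n) \<le> of_int \<lfloor>real (Suc n) * t\<rfloor> / real (Suc n)"
    and "\<forall>n. of_int \<lfloor>real (Suc n) * t\<rfloor> / real (Suc n) \<le> t" by blast+
  show "(\<lambda>n. t - 1 / real (Suc n)) \<longlonglongrightarrow> t"
    using tendsto_diff[OF tendsto_const[of t] mesh_tendsto_0[of 1]] by simp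
qed simp

context
  fixes w :: "real \<Rightarrow> ennreal"
  assumes additive: "\<And>s t. 0 \<le> s \<Longrightarrow> 0 \<le> t \<Longrightarrow> w (s + t) = w s + w t"
begin

lemma additive_of_nat_mult:
  assumes "0 \<le> s"
  shows "w (real (Suc n) * s) = of_nat (Suc n) * w s"
proof (induct n)
  case (Suc n)
  have "w (real (Suc n) * s + s) = w (real (Suc n) * s) + w s"
    using assms by (intro additive) auto
  with Suc show ?case by (simp add: algebra_simps)
qed simp

lemma additive_mono: "0 \<le> x \<Longrightarrow> x \<le> y \<Longrightarrow> w x \<le> w y"
  using additive[of x "y - x"] by simp

lemma additive_quotient_le:
  assumes t: "0 < t"
  shows "real k \<le> real (Suc n) * t \<Longrightarrow> ennreal (real k / real (Suc n)) * w 1 \<le> w t"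
    and "real (Suc n) * t \<le> real (Suc k) \<Longrightarrow> w t \<le> ennreal (real (Suc k) / real (Suc n)) * w 1"
proof -
  have scale: "ennreal (real l / real (Suc n)) * w 1
      = ennreal (1 / real (Suc n)) * (of_nat l * w 1)"
    and unscale: "w t = ennreal (1 / real (Suc n)) * (of_nat (Suc n) * w t)" for l
    by (simp_all add: ennreal_of_nat_eq_real_of_nat mult.assoc[symmetric] ennreal_mult[symmetric]
        del: of_nat_Suc)
  have mult: "of_nat (Suc n) * w t = w (real (Suc n) * t)"
    using t by (intro additive_of_nat_mult[symmetric]) simp
  show "ennreal (real k / real (Suc n)) * w 1 \<le> w t" if k: "real k \<le> real (Suc n) * t"
  proof -
    have "of_nat k * w 1 \<le> w (real (Suc n) * t)"
    proof (cases k)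
      case (Suc l)
      then show ?thesis
        using k additive_of_nat_mult[of 1 l] additive_mono[of "real (Suc l)" "real (Suc n) * t"]
        by simp
    qed simp
    then show ?thesis
      unfolding scale mult[symmetric] by (subst unscale) (rule mult_left_mono, simp_all)
  qed
  show "w t \<le> ennreal (real (Suc k) / real (Suc n)) * w 1" if k: "real (Suc n) * t \<le> real (Suc k)"
  proof -
    have "w (real (Suc n) * t) \<le> w (real (Suc k) * 1)" using t k by (intro additive_mono) simp_all
    also have "\<dots> = of_nat (Suc k) * w 1" by (rule additive_of_nat_mult) simp
    finally show ?thesis
      unfolding scale mult[symmetric] by (subst unscale) (rule mult_left_mono, simp_all)
  qed
qed

lemma additive_linear:
  assumes t: "0 < t"
  shows "w t = ennreal t * w 1"
proof -
  define k where "k n = nat \<lfloor>real (Suc n) * t\<rfloor>" for n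
  have k: "real (k n) = of_int \<lfloor>real (Suc n) * t\<rfloor>" for n
    using t by (simp add: k_def)
  have lower: "ennreal (real (k n) / real (Suc n)) * w 1 \<le> w t"
    and upper: "w t \<le> ennreal (real (Suc (k n)) / real (Suc n)) * w 1" for n
    using k[of n] by (intro additive_quotient_le[OF t]; linarith)+
  have lim: "(\<lambda>n. ennreal (q n) * w 1) \<longlonglongrightarrow> ennreal t * w 1" if "q \<longlonglongrightarrow> t" for q
    using t that by (intro tendsto_mult_ennreal tendsto_ennrealI tendsto_const) auto
  have quotient: "(\<lambda>n. real (k n) / real (Suc n)) \<longlonglongrightarrow> t"
    unfolding k by (rule floor_mult_quotient_tendsto)
  have "(\<lambda>n. real (Suc (k n)) / real (Suc n)) \<longlonglongrightarrow> t"
    using tendsto_add[OF quotient mesh_tendsto_0[of 1]]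
    by (simp add: add_divide_distrib add.commute)
  from LIMSEQ_le_const[OF lim[OF this]] LIMSEQ_le_const2[OF lim[OF quotient]] lower upper
  show ?thesis by (intro antisym) auto
qed

end

section \<open>Mixtures of measures\<close>

lemma
  assumes [measurable]: "S \<in> borel_measurable M" and S: "(\<integral>\<^sup>+\<omega>. S \<omega> \<partial>M) \<noteq> \<infinity>"
  shows integrable_enn2real: "integrable M (\<lambda>\<omega>. enn2real (S \<omega>))"
    and integral_enn2real: "(\<integral>\<omega>. enn2real (S \<omega>) \<partial>M) = enn2real (\<integral>\<^sup>+\<omega>. S \<omega> \<partial>M)"
proof -
  have "AE \<omega> in M. ennreal (enn2real (S \<omega>)) = S \<omega>"
    using nn_integral_PInf_AE[OF _ S] by (auto simp: less_top elim!: eventually_mono)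
  then have "(\<integral>\<^sup>+\<omega>. ennreal (enn2real (S \<omega>)) \<partial>M) = (\<integral>\<^sup>+\<omega>. S \<omega> \<partial>M)" by (rule nn_integral_cong_AE)
  with S show "integrable M (\<lambda>\<omega>. enn2real (S \<omega>))"
    and "(\<integral>\<omega>. enn2real (S \<omega>) \<partial>M) = enn2real (\<integral>\<^sup>+\<omega>. S \<omega> \<partial>M)"
    by (auto simp: integral_eq_nn_integral less_top intro!: integrableI_nonneg)
qed

locale measure_kernel =
  fixes M :: "'a measure" and Q :: "'b measure" and N :: "'a \<Rightarrow> 'b measure"
  assumes sets_kernel: "\<omega> \<in> space M \<Longrightarrow> sets (N \<omega>) = sets Q"
    and emeasure_kernel_measurable: "B \<in> sets Q \<Longrightarrow> (\<lambda>\<omega>. emeasure (N \<omega>) B) \<in> borel_measurable M"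
begin

definition mixture :: "'b measure" where
  "mixture = measure_of (space Q) (sets Q) (\<lambda>B. \<integral>\<^sup>+\<omega>. emeasure (N \<omega>) B \<partial>M)"

lemma sets_mixture [simp, measurable_cong]: "sets mixture = sets Q"
  by (simp add: mixture_def)

lemma space_mixture [simp]: "space mixture = space Q"
  by (simp add: mixture_def space_measure_of_conv)

lemma emeasure_mixture:
  assumes "B \<in> sets Q"
  shows "emeasure mixture B = (\<integral>\<^sup>+\<omega>. emeasure (N \<omega>) B \<partial>M)"
proof (rule emeasure_measure_of[OF mixture_def])
  show "countably_additive (sets mixture) (\<lambda>B. \<integral>\<^sup>+\<omega>. emeasure (N \<omega>) B \<partial>M)"
  proof (rule countably_additiveI)
    fix A :: "nat \<Rightarrow> 'b set" assume A: "range A \<subseteq> sets mixture" "disjoint_family A"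
    have "(\<Sum>i. \<integral>\<^sup>+\<omega>. emeasure (N \<omega>) (A i) \<partial>M) = (\<integral>\<^sup>+\<omega>. (\<Sum>i. emeasure (N \<omega>) (A i)) \<partial>M)"
      using A(1) by (intro nn_integral_suminf[symmetric] emeasure_kernel_measurable) auto
    also have "\<dots> = (\<integral>\<^sup>+\<omega>. emeasure (N \<omega>) (\<Union>i. A i) \<partial>M)"
      using A by (intro nn_integral_cong suminf_emeasure) (auto simp: sets_kernel)
    finally show "(\<Sum>i. \<integral>\<^sup>+\<omega>. emeasure (N \<omega>) (A i) \<partial>M) = (\<integral>\<^sup>+\<omega>. emeasure (N \<omega>) (\<Union>i. A i) \<partial>M)" .
  qed
qed (use assms sets.space_closed in \<open>auto simp: positive_def\<close>)

lemma measurable_kernel: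
  assumes "f \<in> borel_measurable Q" "\<omega> \<in> space M"
  shows "f \<in> borel_measurable (N \<omega>)"
  using assms by (simp add: measurable_cong_sets[OF sets_kernel refl])

lemma nn_integral_kernel_SUP:
  fixes U :: "nat \<Rightarrow> 'b \<Rightarrow> ennreal"
  assumes U: "\<And>i. U i \<in> borel_measurable Q" "incseq U"
    and [measurable]: "\<And>i. (\<lambda>\<omega>. \<integral>\<^sup>+x. U i x \<partial>N \<omega>) \<in> borel_measurable M"
    and mixture: "\<And>i. (\<integral>\<^sup>+x. U i x \<partial>mixture) = (\<integral>\<^sup>+\<omega>. \<integral>\<^sup>+x. U i x \<partial>N \<omega> \<partial>M)"
  shows "(\<lambda>\<omega>. \<integral>\<^sup>+x. (SUP i. U i x) \<partial>N \<omega>) \<in> borel_measurable M"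
    and "(\<integral>\<^sup>+x. (SUP i. U i x) \<partial>mixture) = (\<integral>\<^sup>+\<omega>. \<integral>\<^sup>+x. (SUP i. U i x) \<partial>N \<omega> \<partial>M)"
proof -
  have kernel: "(\<integral>\<^sup>+x. (SUP i. U i x) \<partial>N \<omega>) = (SUP i. \<integral>\<^sup>+x. U i x \<partial>N \<omega>)" if "\<omega> \<in> space M" for \<omega>
    using U that by (intro nn_integral_monotone_convergence_SUP measurable_kernel)
  then show "(\<lambda>\<omega>. \<integral>\<^sup>+x. (SUP i. U i x) \<partial>N \<omega>) \<in> borel_measurable M"
    by (simp cong: measurable_cong)
  have "incseq (\<lambda>i \<omega>. \<integral>\<^sup>+x. U i x \<partial>N \<omega>)"
    using U(2) by (auto simp: incseq_def le_fun_def intro!: nn_integral_mono)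
  then have "(\<integral>\<^sup>+\<omega>. (SUP i. \<integral>\<^sup>+x. U i x \<partial>N \<omega>) \<partial>M) = (SUP i. \<integral>\<^sup>+x. U i x \<partial>mixture)"
    by (simp add: nn_integral_monotone_convergence_SUP mixture)
  also have "\<dots> = (\<integral>\<^sup>+x. (SUP i. U i x) \<partial>mixture)"
    using U by (intro nn_integral_monotone_convergence_SUP[symmetric]) simp_all
  finally show "(\<integral>\<^sup>+x. (SUP i. U i x) \<partial>mixture) = (\<integral>\<^sup>+\<omega>. \<integral>\<^sup>+x. (SUP i. U i x) \<partial>N \<omega> \<partial>M)"
    by (simp add: kernel cong: nn_integral_cong)
qed

lemma
  assumes f: "f \<in> borel_measurable Q"
  shows nn_integral_kernel_measurable: "(\<lambda>\<omega>. \<integral>\<^sup>+x. f x \<partial>N \<omega>) \<in> borel_measurable M"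
    and nn_integral_mixture: "(\<integral>\<^sup>+x. f x \<partial>mixture) = (\<integral>\<^sup>+\<omega>. \<integral>\<^sup>+x. f x \<partial>N \<omega> \<partial>M)"
proof -
  have "(\<lambda>\<omega>. \<integral>\<^sup>+x. f x \<partial>N \<omega>) \<in> borel_measurable M \<and>
    (\<integral>\<^sup>+x. f x \<partial>mixture) = (\<integral>\<^sup>+\<omega>. \<integral>\<^sup>+x. f x \<partial>N \<omega> \<partial>M)"
    using f
  proof induct
    case (cong f g)
    have "space (N \<omega>) = space Q" if "\<omega> \<in> space M" for \<omega>
      using sets_kernel[OF that] by (rule sets_eq_imp_space_eq)
    then have "(\<integral>\<^sup>+x. f x \<partial>N \<omega>) = (\<integral>\<^sup>+x. g x \<partial>N \<omega>)" if "\<omega> \<in> space M" for \<omega>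
      using cong(3) that by (intro nn_integral_cong) simp
    moreover have "(\<integral>\<^sup>+x. f x \<partial>mixture) = (\<integral>\<^sup>+x. g x \<partial>mixture)"
      using cong(3) by (intro nn_integral_cong) simp
    ultimately show ?case using cong(4) by (simp cong: measurable_cong nn_integral_cong)
  next
    case (set B)
    then have "(\<integral>\<^sup>+x. indicator B x \<partial>N \<omega>) = emeasure (N \<omega>) B" if "\<omega> \<in> space M" for \<omega>
      using sets_kernel[OF that] by simp
    with set show ?case
      by (simp add: emeasure_kernel_measurable emeasure_mixture
          cong: measurable_cong nn_integral_cong)
  next
    case (mult u c)
    note [measurable] = mult(4)[THEN conjunct1]
    show ?case using mult
      by (simp add: nn_integral_cmult measurable_kernel cong: measurable_cong nn_integral_cong)
  next
    case (add u v)
    note [measurable] = add(3)[THEN conjunct1] add(7)[THEN conjunct1]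
    show ?case using add
      by (simp add: nn_integral_add measurable_kernel cong: measurable_cong nn_integral_cong)
  next
    case (seq U)
    with nn_integral_kernel_SUP[of U] show ?case by (simp add: image_comp)
  qed
  then show "(\<lambda>\<omega>. \<integral>\<^sup>+x. f x \<partial>N \<omega>) \<in> borel_measurable M"
    and "(\<integral>\<^sup>+x. f x \<partial>mixture) = (\<integral>\<^sup>+\<omega>. \<integral>\<^sup>+x. f x \<partial>N \<omega> \<partial>M)" by auto
qed

lemma
  fixes f :: "'b \<Rightarrow> real"
  assumes f: "integrable mixture f"
  shows AE_integrable_kernel: "AE \<omega> in M. integrable (N \<omega>) f"
    and integrable_integral_kernel: "integrable M (\<lambda>\<omega>. \<integral>x. f x \<partial>N \<omega>)"
    and integral_mixture: "(\<integral>\<omega>. \<integral>x. f x \<partial>N \<omega> \<partial>M) = (\<integral>x. f x \<partial>mixture)"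
proof -
  have Q [measurable]: "f \<in> borel_measurable Q" using f by auto
  define P where "P \<omega> = (\<integral>\<^sup>+x. ennreal (f x) \<partial>N \<omega>)" for \<omega>
  define R where "R \<omega> = (\<integral>\<^sup>+x. ennreal (- f x) \<partial>N \<omega>)" for \<omega>
  have [measurable]: "P \<in> borel_measurable M" "R \<in> borel_measurable M"
    unfolding P_def[abs_def] R_def[abs_def] by (intro nn_integral_kernel_measurable; simp)+
  have PR: "(\<integral>\<^sup>+\<omega>. P \<omega> \<partial>M) = (\<integral>\<^sup>+x. ennreal (f x) \<partial>mixture)"
    "(\<integral>\<^sup>+\<omega>. R \<omega> \<partial>M) = (\<integral>\<^sup>+x. ennreal (- f x) \<partial>mixture)"
    unfolding P_def R_def by (intro nn_integral_mixture[symmetric]; simp)+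
  have fin: "(\<integral>\<^sup>+\<omega>. P \<omega> \<partial>M) \<noteq> \<infinity>" "(\<integral>\<^sup>+\<omega>. R \<omega> \<partial>M) \<noteq> \<infinity>"
    using f unfolding PR real_integrable_def by auto
  have AE: "AE \<omega> in M. P \<omega> \<noteq> \<infinity>" "AE \<omega> in M. R \<omega> \<noteq> \<infinity>"
    using fin by (intro nn_integral_PInf_AE; simp)+
  have integrable_iff: "integrable (N \<omega>) f \<longleftrightarrow> P \<omega> \<noteq> \<infinity> \<and> R \<omega> \<noteq> \<infinity>" if "\<omega> \<in> space M" for \<omega>
    using measurable_kernel[OF Q that] by (simp add: real_integrable_def P_def R_def)
  show "AE \<omega> in M. integrable (N \<omega>) f"
    using AE AE_space by eventually_elim (simp add: integrable_iff)
  have eq: "(\<integral>x. f x \<partial>N \<omega>) = (if P \<omega> \<noteq> \<infinity> \<and> R \<omega> \<noteq> \<infinity> then enn2real (P \<omega>) - enn2real (R \<omega>) else 0)"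
    if "\<omega> \<in> space M" for \<omega>
    using integrable_iff[OF that] real_lebesgue_integral_def[of "N \<omega>" f]
    by (simp add: P_def R_def not_integrable_integral_eq)
  have [measurable]: "(\<lambda>\<omega>. \<integral>x. f x \<partial>N \<omega>) \<in> borel_measurable M"
    by (subst measurable_cong[OF eq]) measurable
  have AE_eq: "AE \<omega> in M. (\<integral>x. f x \<partial>N \<omega>) = enn2real (P \<omega>) - enn2real (R \<omega>)"
    using AE AE_space by eventually_elim (simp add: eq)
  have int: "integrable M (\<lambda>\<omega>. enn2real (P \<omega>) - enn2real (R \<omega>))"
    using fin by (intro Bochner_Integration.integrable_diff integrable_enn2real) auto
  show "integrable M (\<lambda>\<omega>. \<integral>x. f x \<partial>N \<omega>)"
    using int AE_eq by (subst integrable_cong_AE[of _ _ "\<lambda>\<omega>. enn2real (P \<omega>) - enn2real (R \<omega>)"]) auto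
  have "(\<integral>\<omega>. \<integral>x. f x \<partial>N \<omega> \<partial>M) = (\<integral>\<omega>. enn2real (P \<omega>) - enn2real (R \<omega>) \<partial>M)"
    using AE_eq by (intro integral_cong_AE) auto
  also have "\<dots> = (\<integral>x. f x \<partial>mixture)"
    using fin real_lebesgue_integral_def[OF f]
    by (simp add: integrable_enn2real integral_enn2real PR)
  finally show "(\<integral>\<omega>. \<integral>x. f x \<partial>N \<omega> \<partial>M) = (\<integral>x. f x \<partial>mixture)" .
qed

end

lemma emeasure_Int_measurable_if_generator:
  assumes G: "Int_stable G" "G \<subseteq> Pow (space Q)" "sets Q = sigma_sets (space Q) G" and C: "C \<in> G"
    and sets_N: "\<And>\<omega>. \<omega> \<in> space M \<Longrightarrow> sets (N \<omega>) = sets Q"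
    and finite: "\<And>\<omega>. \<omega> \<in> space M \<Longrightarrow> emeasure (N \<omega>) C \<noteq> \<infinity>"
    and generator: "\<And>B. B \<in> G \<Longrightarrow> (\<lambda>\<omega>. emeasure (N \<omega>) B) \<in> borel_measurable M"
    and B: "B \<in> sets Q"
  shows "(\<lambda>\<omega>. emeasure (N \<omega>) (B \<inter> C)) \<in> borel_measurable M"
proof -
  have C_sets: "C \<in> sets Q" using C by (auto simp: G(3))
  show ?thesis
    using G(1,2) B[unfolded G(3)]
  proof (induct rule: sigma_sets_induct_disjoint)
    case (basic A)
    with C show ?case by (intro generator Int_stableD[OF G(1)])
  next
    case (compl A)
    then have A: "A \<inter> C \<in> sets Q" using C_sets by (auto simp: G(3)[symmetric])
    have "emeasure (N \<omega>) ((space Q - A) \<inter> C) = emeasure (N \<omega>) C - emeasure (N \<omega>) (A \<inter> C)"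
      if "\<omega> \<in> space M" for \<omega>
    proof -
      have "(space Q - A) \<inter> C = C - A \<inter> C" using sets.sets_into_space[OF C_sets] by auto
      moreover have "emeasure (N \<omega>) (A \<inter> C) \<le> emeasure (N \<omega>) C"
        using C_sets sets_N[OF that] by (intro emeasure_mono) auto
      then have "emeasure (N \<omega>) (A \<inter> C) \<noteq> \<infinity>" using finite[OF that] by (auto simp: top_unique)
      ultimately show ?thesis using A C_sets sets_N[OF that] by (simp add: emeasure_Diff)
    qed
    then show ?case using compl(2) generator[OF C] by (simp cong: measurable_cong)
  next
    case (union A)
    then have A: "A j \<inter> C \<in> sets Q" for j using C_sets by (auto simp: G(3)[symmetric])
    have "disjoint_family (\<lambda>j. A j \<inter> C)" using union(1) by (auto simp: disjoint_family_on_def)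
    then have "emeasure (N \<omega>) (\<Union> (range A) \<inter> C) = (\<Sum>j. emeasure (N \<omega>) (A j \<inter> C))"
      if "\<omega> \<in> space M" for \<omega>
      using A sets_N[OF that] by (subst suminf_emeasure) (auto simp: Int_UN_distrib2)
    with union(3) show ?case by (simp cong: measurable_cong)
  qed simp
qed

lemma measure_kernelI_generator:
  fixes C :: "nat \<Rightarrow> 'b set"
  assumes G: "Int_stable G" "G \<subseteq> Pow (space Q)" "sets Q = sigma_sets (space Q) G"
    and C: "range C \<subseteq> G" "incseq C" "(\<Union>i. C i) = space Q"
    and sets_N: "\<And>\<omega>. \<omega> \<in> space M \<Longrightarrow> sets (N \<omega>) = sets Q"
    and finite: "\<And>\<omega> i. \<omega> \<in> space M \<Longrightarrow> emeasure (N \<omega>) (C i) \<noteq> \<infinity>"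
    and generator: "\<And>B. B \<in> G \<Longrightarrow> (\<lambda>\<omega>. emeasure (N \<omega>) B) \<in> borel_measurable M"
  shows "measure_kernel M Q N"
proof
  fix B assume B: "B \<in> sets Q"
  have C_in: "C i \<in> G" and C_sets: "C i \<in> sets Q" for i using C(1) by (auto simp: G(3))
  have "emeasure (N \<omega>) B = (SUP i. emeasure (N \<omega>) (B \<inter> C i))" if "\<omega> \<in> space M" for \<omega>
  proof -
    have "incseq (\<lambda>i. B \<inter> C i)" using C(2) by (auto simp: incseq_def)
    then have "(SUP i. emeasure (N \<omega>) (B \<inter> C i)) = emeasure (N \<omega>) (\<Union>i. B \<inter> C i)"
      using B C_sets sets_N[OF that] by (intro SUP_emeasure_incseq) auto
    also have "(\<Union>i. B \<inter> C i) = B"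
      using sets.sets_into_space[OF B] unfolding Int_UN_distrib[symmetric] C(3) by auto
    finally show ?thesis by simp
  qed
  moreover have "(\<lambda>\<omega>. emeasure (N \<omega>) (B \<inter> C i)) \<in> borel_measurable M" for i
    by (rule emeasure_Int_measurable_if_generator[OF G C_in sets_N finite generator B])
  ultimately show "(\<lambda>\<omega>. emeasure (N \<omega>) B) \<in> borel_measurable M" by (simp cong: measurable_cong)
qed (rule sets_N)

section \<open>Independence and stationarity of the jump sums of a Levy process\<close>

locale levy_setting = prob_space M for M :: "'a measure" +
  fixes a :: real and F :: "real \<Rightarrow> 'a set set" and L :: "real \<Rightarrow> 'a \<Rightarrow> real"
  assumes filtration: "filtration_usual M a F" and levy: "levy_process M a F L"
begin

abbreviation path :: "'a \<Rightarrow> real \<Rightarrow> real" where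
  "path \<omega> \<equiv> (\<lambda>t. L t \<omega>)"

definition past :: "real \<Rightarrow> 'a measure" where
  "past t = sigma (space M) (F t)"

lemma F_sigma_algebra: "a \<le> t \<Longrightarrow> sigma_algebra (space M) (F t)"
  and F_subset: "a \<le> t \<Longrightarrow> F t \<subseteq> sets M"
  and F_mono: "a \<le> s \<Longrightarrow> s \<le> t \<Longrightarrow> F s \<subseteq> F t"
  using conjunct1[OF filtration[unfolded filtration_usual_def]]
    conjunct1[OF conjunct2[OF filtration[unfolded filtration_usual_def]]] by simp_all

lemma F_sets: "a \<le> t \<Longrightarrow> A \<in> F t \<Longrightarrow> A \<in> sets M"
  using F_subset by blast

lemma space_past [simp]: "space (past t) = space M"
  by (simp add: past_def space_measure_of_conv)

lemma sets_past: "a \<le> t \<Longrightarrow> sets (past t) = F t"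
  using F_sigma_algebra[of t] by (simp add: past_def sigma_algebra.sets_measure_of_eq)

lemma space_in_F: "a \<le> t \<Longrightarrow> space M \<in> F t"
  using sets.top[of "past t"] by (simp add: sets_past)

lemma subalgebra_past: "a \<le> t \<Longrightarrow> subalgebra M (past t)"
  using F_subset by (auto simp: subalgebra_def sets_past)

lemma subalgebra_past_mono: "a \<le> s \<Longrightarrow> s \<le> t \<Longrightarrow> subalgebra (past t) (past s)"
  using F_mono by (auto simp: subalgebra_def sets_past)

lemma adapted_measurable_past:
  assumes "adapted_on M {a..} F X" "a \<le> s" "s \<le> t"
  shows "X s \<in> borel_measurable (past t)"
proof -
  have "X s \<in> borel_measurable (past s)"
    using assms(1,2)
    by (auto simp: measurable_def sets_past adapted_on_def vimage_def Int_def conj_commute)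
  then show ?thesis by (rule measurable_from_subalg[OF subalgebra_past_mono[OF assms(2,3)]])
qed

lemma adapted_measurable:
  assumes "adapted_on M {a..} F X" "a \<le> t"
  shows "X t \<in> borel_measurable M"
  using measurable_from_subalg[OF subalgebra_past adapted_measurable_past] assms by blast

lemma L_adapted: "adapted_on M {a..} F L"
  and L_cadlag: "\<omega> \<in> space M \<Longrightarrow> cadlag_from a (path \<omega>)"
  and L_square: "a \<le> t \<Longrightarrow> integrable M (\<lambda>\<omega>. (L t \<omega>)\<^sup>2)"
  and L_integrable: "a \<le> t \<Longrightarrow> integrable M (L t)"
  and L_centered: "a \<le> t \<Longrightarrow> expectation (L t) = 0"
  and L_stationary: "a \<le> s \<Longrightarrow> s \<le> t \<Longrightarrow>
      distr M borel (\<lambda>\<omega>. L t \<omega> - L s \<omega>) = distr M borel (L (a + (t - s)))"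
  and L_indep: "a \<le> s \<Longrightarrow> s \<le> t \<Longrightarrow> A \<in> F s \<Longrightarrow> B \<in> sets borel \<Longrightarrow>
      prob (A \<inter> {\<omega>\<in>space M. L t \<omega> - L s \<omega> \<in> B}) = prob A * prob {\<omega>\<in>space M. L t \<omega> - L s \<omega> \<in> B}"
  using levy by (auto simp: levy_process_def)

lemma L_measurable [measurable (raw)]: "a \<le> t \<Longrightarrow> L t \<in> borel_measurable M"
  by (rule adapted_measurable[OF L_adapted])

lemma nn_integral_increment:
  fixes \<psi> :: "real \<Rightarrow> ennreal"
  assumes st: "a \<le> s" "s \<le> t" and [measurable]: "\<psi> \<in> borel_measurable borel"
  shows "(\<integral>\<^sup>+\<omega>. \<psi> (L t \<omega> - L s \<omega>) \<partial>M) = (\<integral>\<^sup>+\<omega>. \<psi> (L (a + (t - s)) \<omega>) \<partial>M)"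
proof -
  have [measurable]: "L t \<in> borel_measurable M" "L s \<in> borel_measurable M"
    "L (a + (t - s)) \<in> borel_measurable M"
    using st by (auto intro!: L_measurable)
  have "(\<integral>\<^sup>+\<omega>. \<psi> (L t \<omega> - L s \<omega>) \<partial>M) = (\<integral>\<^sup>+z. \<psi> z \<partial>distr M borel (\<lambda>\<omega>. L t \<omega> - L s \<omega>))"
    by (simp add: nn_integral_distr)
  also have "\<dots> = (\<integral>\<^sup>+\<omega>. \<psi> (L (a + (t - s)) \<omega>) \<partial>M)"
    unfolding L_stationary[OF st] by (simp add: nn_integral_distr)
  finally show ?thesis .
qed

lemma indep_var_past_increment:
  fixes X :: "'a \<Rightarrow> 'b :: topological_space"
  assumes st: "a \<le> s" "s \<le> t" and X: "X \<in> borel_measurable (past s)"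
    and \<psi>: "\<psi> \<in> borel_measurable borel"
  shows "indep_var borel X borel (\<lambda>\<omega>. \<psi> (L t \<omega> - L s \<omega>))"
  unfolding indep_var_eq
proof (intro conjI)
  let ?I = "\<lambda>\<omega>. \<psi> (L t \<omega> - L s \<omega>)"
  show X_M: "random_variable borel X"
    by (rule measurable_from_subalg[OF subalgebra_past[OF st(1)] X])
  show I_M: "random_variable borel ?I"
    using st by (intro measurable_compose[OF _ \<psi>] borel_measurable_diff L_measurable) auto
  have preimages: "sigma_sets (space M) {Y -` B \<inter> space M |B. B \<in> sets borel}
      = {Y -` B \<inter> space M |B. B \<in> sets borel}"
    for Y :: "'a \<Rightarrow> 'b"
    using sets_vimage_algebra[of "space M" Y borel] sets_vimage_algebra2[of Y "space M" borel]
    by simp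
  show "indep_set (sigma_sets (space M) {X -` B \<inter> space M |B. B \<in> sets borel})
    (sigma_sets (space M) {?I -` B \<inter> space M |B. B \<in> sets borel})"
    unfolding preimages
  proof (safe intro!: indep_setI)
    fix B B' :: "'b set" assume B: "B \<in> sets borel" "B' \<in> sets borel"
    show "X -` B \<inter> space M \<in> events" "?I -` B' \<inter> space M \<in> events"
      using B X_M I_M by (auto intro: measurable_sets)
    have "X -` B \<inter> space M \<in> F s" "\<psi> -` B' \<in> sets borel"
      using measurable_sets[OF X B(1)] measurable_sets[OF \<psi> B(2)] st by (simp_all add: sets_past)
    from L_indep[OF st this]
    show "prob (X -` B \<inter> space M \<inter> (?I -` B' \<inter> space M))
        = prob (X -` B \<inter> space M) * prob (?I -` B' \<inter> space M)"
      by (simp add: vimage_def Int_def conj_commute)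
  qed
qed

lemma nn_integral_past_mult_increment:
  fixes \<psi> :: "real \<Rightarrow> ennreal"
  assumes st: "a \<le> s" "s \<le> t" and \<psi>: "\<psi> \<in> borel_measurable borel"
    and \<xi>: "\<xi> \<in> borel_measurable (past s)"
  shows "(\<integral>\<^sup>+\<omega>. \<xi> \<omega> * \<psi> (L t \<omega> - L s \<omega>) \<partial>M) = (\<integral>\<^sup>+\<omega>. \<xi> \<omega> \<partial>M) * (\<integral>\<^sup>+\<omega>. \<psi> (L (a + (t - s)) \<omega>) \<partial>M)"
proof -
  have "indep_vars (\<lambda>_. borel) (case_bool \<xi> (\<lambda>\<omega>. \<psi> (L t \<omega> - L s \<omega>))) UNIV"
    using indep_var_past_increment[OF st \<xi> \<psi>]
    unfolding indep_var_def by (simp add: case_bool_if cong: if_cong)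
  from indep_vars_nn_integral[OF _ this]
  show ?thesis by (simp add: UNIV_bool nn_integral_increment[OF st \<psi>] mult.commute)
qed

lemma grid_increment_measurable_past:
  assumes "a \<le> c" "0 \<le> h" "k < n"
  shows "(\<lambda>\<omega>. grid_increment (path \<omega>) c h k) \<in> borel_measurable (past (c + h * real n))"
proof -
  have "h * (real k + 1) \<le> h * real n" using assms by (intro mult_left_mono) auto
  moreover have "0 \<le> h * real k" "0 \<le> h * (real k + 1)" using assms by auto
  moreover have "h * real k \<le> h * (real k + 1)" using assms by (intro mult_left_mono) auto
  ultimately show ?thesis
    unfolding grid_increment_def using assms
    by (intro borel_measurable_diff adapted_measurable_past[OF L_adapted])
      (auto intro: add_increasing2)
qed

lemma grid_increment_measurable:
  assumes "a \<le> c" "0 \<le> h"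
  shows "(\<lambda>\<omega>. grid_increment (path \<omega>) c h k) \<in> borel_measurable M"
  using measurable_from_subalg[OF subalgebra_past
      grid_increment_measurable_past[OF assms lessI[of k]]] assms
  by (simp add: add_increasing2)

lemma nn_integral_prod_increments:
  fixes \<psi> :: "real \<Rightarrow> ennreal"
  assumes c: "a \<le> c" "0 \<le> h" and \<psi>: "\<psi> \<in> borel_measurable borel" and A: "A \<in> F c"
  shows "(\<integral>\<^sup>+\<omega>. indicator A \<omega> * (\<Prod>k<n. \<psi> (grid_increment (path \<omega>) c h k)) \<partial>M)
    = emeasure M A * (\<integral>\<^sup>+\<omega>. \<psi> (L (a + h) \<omega>) \<partial>M) ^ n"
proof (induct n)
  case 0
  show ?case using F_sets[OF c(1) A] by simp
next
  case (Suc n)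
  let ?s = "c + h * real n" and ?t = "c + h * (real n + 1)"
  have t: "a \<le> ?s" "c \<le> ?s" "?s \<le> ?t" "a + (?t - ?s) = a + h"
    using c by (auto simp: algebra_simps intro: add_increasing2)
  have "A \<in> sets (past ?s)" using A F_mono[OF c(1) t(2)] by (auto simp: sets_past t)
  then have "(\<lambda>\<omega>. indicator A \<omega> * (\<Prod>k<n. \<psi> (grid_increment (path \<omega>) c h k)))
      \<in> borel_measurable (past ?s)"
    using grid_increment_measurable_past[OF c]
    by (intro borel_measurable_times_ennreal borel_measurable_indicator
        borel_measurable_prod_ennreal
        measurable_compose[OF _ \<psi>]) auto
  from nn_integral_past_mult_increment[OF t(1,3) \<psi> this, unfolded t(4) Suc]
  show ?case by (simp add: grid_increment_def mult_ac)
qed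

lemma grid_sum_measurable:
  assumes "a \<le> c" "c < d" "g \<in> borel_measurable borel"
  shows "(\<lambda>\<omega>. grid_sum g (path \<omega>) c d n) \<in> borel_measurable M"
  unfolding grid_sum_def using assms
  by (intro borel_measurable_sum measurable_compose[OF grid_increment_measurable]) auto

lemma nn_integral_past_exp_grid_sum:
  assumes c: "a \<le> c" "c < d" and g: "g \<in> borel_measurable borel" and A: "A \<in> F c"
  shows "(\<integral>\<^sup>+\<omega>. indicator A \<omega> * ennreal (exp (- grid_sum g (path \<omega>) c d n)) \<partial>M)
    = emeasure M A * (\<integral>\<^sup>+\<omega>. ennreal (exp (- g (L (a + (d - c) / real (Suc n)) \<omega>))) \<partial>M) ^ Suc n"
proof -
  let ?h = "(d - c) / real (Suc n)"
  have h: "0 \<le> ?h" using c by simp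
  have "ennreal (exp (- grid_sum g x c d n))
      = (\<Prod>k<Suc n. ennreal (exp (- g (grid_increment x c ?h k))))" for x
    unfolding grid_sum_def sum_negf[symmetric] exp_sum[OF finite_lessThan]
    by (rule prod_ennreal[symmetric]) simp
  moreover have "(\<lambda>z. ennreal (exp (- g z))) \<in> borel_measurable borel" using g by measurable
  ultimately show ?thesis
    using nn_integral_prod_increments[OF c(1) h _ A, of "\<lambda>z. ennreal (exp (- g z))" "Suc n"] by simp
qed

lemma jump_test_sum_finite:
  assumes "a \<le> c" "c < d" "jump_test g" "\<omega> \<in> space M"
  shows "jump_sum (\<lambda>z. ennreal (g z)) (path \<omega>) {c<..d} < \<infinity>"
  by (rule jump_sum_finite[OF cadlag_from_mono[OF L_cadlag]]) (use assms in auto)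

lemma jump_test_sum_tendsto:
  assumes "a \<le> c" "c < d" "jump_test g" "\<omega> \<in> space M"
  shows "grid_sum g (path \<omega>) c d \<longlonglongrightarrow> enn2real (jump_sum (\<lambda>z. ennreal (g z)) (path \<omega>) {c<..d})"
  by (rule grid_sum_tendsto_jump_sum[OF cadlag_from_mono[OF L_cadlag]]) (use assms in auto)

lemma jump_test_sum_measurable:
  assumes c: "a \<le> c" and g: "jump_test g"
  shows "(\<lambda>\<omega>. jump_sum (\<lambda>z. ennreal (g z)) (path \<omega>) {c<..d}) \<in> borel_measurable M"
proof (cases "c < d")
  case True
  have "(\<lambda>\<omega>. enn2real (jump_sum (\<lambda>z. ennreal (g z)) (path \<omega>) {c<..d})) \<in> borel_measurable M"
    by (rule borel_measurable_LIMSEQ_metric[OF grid_sum_measurable jump_test_sum_tendsto])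
      (use c True g in \<open>auto intro: jump_test_measurable\<close>)
  then have "(\<lambda>\<omega>. ennreal (enn2real (jump_sum (\<lambda>z. ennreal (g z)) (path \<omega>) {c<..d})))
      \<in> borel_measurable M"
    by simp
  then show ?thesis
    by (rule measurable_cong[THEN iffD1, rotated]) (use jump_test_sum_finite[OF c True g] in simp)
qed simp

lemma past_exp_jump_sum_LIMSEQ:
  assumes c: "a \<le> c" "c < d" and g: "jump_test g" and A: "A \<in> F c"
  shows "(\<lambda>n. emeasure M A * (\<integral>\<^sup>+\<omega>. ennreal (exp (- g (L (a + (d - c) / real (Suc n)) \<omega>)))
      \<partial>M) ^ Suc n)
    \<longlonglongrightarrow> (\<integral>\<^sup>+\<omega>. indicator A \<omega> *
      ennreal (exp (- enn2real (jump_sum (\<lambda>z. ennreal (g z)) (path \<omega>) {c<..d}))) \<partial>M)"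
  unfolding nn_integral_past_exp_grid_sum[OF c jump_test_measurable[OF g] A, symmetric]
proof (rule nn_integral_dominated_convergence[where w="\<lambda>_. 1"])
  have [measurable]: "A \<in> sets M" by (rule F_sets[OF c(1) A])
  note [measurable] = grid_sum_measurable[OF c jump_test_measurable[OF g]]
    jump_test_sum_measurable[OF c(1) g, of d]
  show "(\<lambda>\<omega>. indicator A \<omega> * ennreal (exp (- grid_sum g (path \<omega>) c d n)))
      \<in> borel_measurable M" for n
    by measurable
  show "(\<lambda>\<omega>. indicator A \<omega> * ennreal (exp (- enn2real (jump_sum (\<lambda>z. ennreal (g z)) (path \<omega>) {c<..d}))))
    \<in> borel_measurable M" by measurable
  show "AE \<omega> in M. indicator A \<omega> * ennreal (exp (- grid_sum g (path \<omega>) c d n)) \<le> 1" for n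
    using grid_sum_nonneg[OF g] by (intro AE_I2) (auto simp: indicator_def)
  have "(\<lambda>n. indicator A \<omega> * ennreal (exp (- grid_sum g (path \<omega>) c d n)))
      \<longlonglongrightarrow> indicator A \<omega> * ennreal (exp (- enn2real (jump_sum (\<lambda>z. ennreal (g z)) (path \<omega>) {c<..d})))"
    if "\<omega> \<in> space M" for \<omega>
    by (intro ennreal_tendsto_cmult tendsto_ennrealI tendsto_exp tendsto_minus
        jump_test_sum_tendsto[OF c g that]) (simp add: indicator_def)
  then show "AE \<omega> in M. (\<lambda>n. indicator A \<omega> * ennreal (exp (- grid_sum g (path \<omega>) c d n)))
    \<longlonglongrightarrow> indicator A \<omega> * ennreal (exp (- enn2real (jump_sum (\<lambda>z. ennreal (g z)) (path \<omega>) {c<..d})))"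
    by (rule AE_I2)
qed (auto simp: emeasure_space_1)

text \<open>The Laplace transforms are limits of the powers in \<open>past_exp_jump_sum_LIMSEQ\<close>, which depend on
  the interval only through its length.\<close>
lemma nn_integral_past_exp_jump_sum:
  assumes c: "a \<le> c" "c < d" and g: "jump_test g" and A: "A \<in> F c"
  defines "J \<equiv> \<lambda>c d \<omega>. enn2real (jump_sum (\<lambda>z. ennreal (g z)) (path \<omega>) {c<..d})"
  shows "(\<integral>\<^sup>+\<omega>. indicator A \<omega> * ennreal (exp (- J c d \<omega>)) \<partial>M)
    = emeasure M A * (\<integral>\<^sup>+\<omega>. ennreal (exp (- J a (a + (d - c)) \<omega>)) \<partial>M)"
proof -
  let ?\<rho> = "\<lambda>n. \<integral>\<^sup>+\<omega>. ennreal (exp (- g (L (a + (d - c) / real (Suc n)) \<omega>))) \<partial>M"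
  have "(\<lambda>n. ?\<rho> n ^ Suc n)
      \<longlonglongrightarrow> (\<integral>\<^sup>+\<omega>. indicator (space M) \<omega> * ennreal (exp (- J a (a + (d - c)) \<omega>)) \<partial>M)"
    using past_exp_jump_sum_LIMSEQ[OF order_refl _ g space_in_F[OF order_refl], of "a + (d - c)"] c
    by (simp add: J_def emeasure_space_1)
  also have "(\<integral>\<^sup>+\<omega>. indicator (space M) \<omega> * ennreal (exp (- J a (a + (d - c)) \<omega>)) \<partial>M)
      = (\<integral>\<^sup>+\<omega>. ennreal (exp (- J a (a + (d - c)) \<omega>)) \<partial>M)"
    by (intro nn_integral_cong) simp
  finally have "(\<lambda>n. emeasure M A * ?\<rho> n ^ Suc n)
      \<longlonglongrightarrow> emeasure M A * (\<integral>\<^sup>+\<omega>. ennreal (exp (- J a (a + (d - c)) \<omega>)) \<partial>M)"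
    by (intro ennreal_tendsto_cmult) (simp_all add: emeasure_eq_measure)
  with past_exp_jump_sum_LIMSEQ[OF c g A] show ?thesis unfolding J_def by (rule LIMSEQ_unique)
qed

lemma nn_integral_past_jump_test_sum:
  assumes c: "a \<le> c" "c < d" and g: "jump_test g" and A: "A \<in> F c"
  shows "(\<integral>\<^sup>+\<omega>. indicator A \<omega> * jump_sum (\<lambda>z. ennreal (g z)) (path \<omega>) {c<..d} \<partial>M)
    = emeasure M A * (\<integral>\<^sup>+\<omega>. jump_sum (\<lambda>z. ennreal (g z)) (path \<omega>) {a<..a + (d - c)} \<partial>M)"
proof -
  let ?J = "\<lambda>c d \<omega>. jump_sum (\<lambda>z. ennreal (g z)) (path \<omega>) {c<..d}"
  let ?A = "density M (indicator A)" and ?N = "scale_measure (emeasure M A) M"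
  have [measurable]: "A \<in> sets M" by (rule F_sets[OF c(1) A])
  note [measurable] = jump_test_sum_measurable[OF c(1) g] jump_test_sum_measurable[OF order_refl g]
  have ac: "a < a + (d - c)" using c by simp
  have "(\<integral>\<^sup>+\<omega>. ennreal (enn2real (?J c d \<omega>)) \<partial>?A)
      = (\<integral>\<^sup>+\<omega>. ennreal (enn2real (?J a (a + (d - c)) \<omega>)) \<partial>?N)"
  proof (rule nn_integral_eq_if_laplace_eq)
    show "finite_measure ?A" "finite_measure ?N"
      by (auto intro!: finite_measureI simp: emeasure_restricted ennreal_mult_eq_top_iff)
    fix l :: real assume l: "0 \<le> l"
    have scale: "enn2real (jump_sum (\<lambda>z. ennreal (l * g z)) x I)
        = l * enn2real (jump_sum (\<lambda>z. ennreal (g z)) x I)" for x I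
      using l by (simp add: ennreal_mult' jump_sum_cmult enn2real_mult)
    have "jump_test (\<lambda>z. l * g z)" by (rule jump_test_mult[OF g]) (use l in auto)
    from nn_integral_past_exp_jump_sum[OF c this A]
    show "(\<integral>\<^sup>+\<omega>. ennreal (exp (- (l * enn2real (?J c d \<omega>)))) \<partial>?A)
        = (\<integral>\<^sup>+\<omega>. ennreal (exp (- (l * enn2real (?J a (a + (d - c)) \<omega>)))) \<partial>?N)"
      by (simp add: scale nn_integral_density nn_integral_scale_measure)
  qed auto
  then have "(\<integral>\<^sup>+\<omega>. indicator A \<omega> * ennreal (enn2real (?J c d \<omega>)) \<partial>M)
      = emeasure M A * (\<integral>\<^sup>+\<omega>. ennreal (enn2real (?J a (a + (d - c)) \<omega>)) \<partial>M)"
    by (simp add: nn_integral_density nn_integral_scale_measure)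
  then show ?thesis
    using jump_test_sum_finite[OF c g] jump_test_sum_finite[OF order_refl ac g]
    by (simp cong: nn_integral_cong)
qed

lemma jump_count_measurable_open:
  assumes "a \<le> c" "open U" "0 \<notin> U"
  shows "(\<lambda>\<omega>. jump_sum (indicator U) (path \<omega>) {c<..d}) \<in> borel_measurable M"
  unfolding jump_sum_indicator_SUP[OF assms(2,3)]
  using assms by (intro borel_measurable_SUP jump_test_sum_measurable jump_test_bump) auto

lemma nn_integral_past_jump_count_shift:
  assumes c: "a \<le> c" "c < d" and U: "open U" "0 \<notin> U" and A: "A \<in> F c"
  shows "(\<integral>\<^sup>+\<omega>. indicator A \<omega> * jump_sum (indicator U) (path \<omega>) {c<..d} \<partial>M)
    = emeasure M A * (\<integral>\<^sup>+\<omega>. jump_sum (indicator U) (path \<omega>) {a<..a + (d - c)} \<partial>M)"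
proof -
  let ?J = "\<lambda>n c d \<omega>. jump_sum (\<lambda>z. ennreal (bump U n z)) (path \<omega>) {c<..d}"
  have [measurable]: "A \<in> sets M" by (rule F_sets[OF c(1) A])
  note test = jump_test_bump[OF U(2)]
  note [measurable] = jump_test_sum_measurable[OF c(1) test]
    jump_test_sum_measurable[OF order_refl test]
  have inc: "?J n c d \<omega> \<le> ?J n' c d \<omega>" if "n \<le> n'" for n n' c d \<omega>
    using incseq_jump_sum[OF incseq_bump] that by (auto simp: incseq_def)
  have "(\<integral>\<^sup>+\<omega>. (SUP n. indicator A \<omega> * ?J n c d \<omega>) \<partial>M)
      = (SUP n. \<integral>\<^sup>+\<omega>. indicator A \<omega> * ?J n c d \<omega> \<partial>M)"
    by (intro nn_integral_monotone_convergence_SUP)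
      (auto simp: incseq_def le_fun_def intro!: mult_left_mono inc)
  also have "\<dots> = emeasure M A * (SUP n. \<integral>\<^sup>+\<omega>. ?J n a (a + (d - c)) \<omega> \<partial>M)"
    by (simp add: nn_integral_past_jump_test_sum[OF c test A] SUP_mult_left_ennreal)
  also have "(SUP n. \<integral>\<^sup>+\<omega>. ?J n a (a + (d - c)) \<omega> \<partial>M) = (\<integral>\<^sup>+\<omega>. (SUP n. ?J n a (a + (d - c)) \<omega>) \<partial>M)"
    by (intro nn_integral_monotone_convergence_SUP[symmetric])
      (auto simp: incseq_def le_fun_def intro!: inc)
  finally show ?thesis by (simp only: jump_sum_indicator_SUP[OF U] SUP_mult_left_ennreal)
qed

lemma nn_integral_jump_count_add:
  assumes U: "open U" "0 \<notin> U" and st: "0 \<le> s" "0 \<le> t"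
  shows "(\<integral>\<^sup>+\<omega>. jump_sum (indicator U) (path \<omega>) {a<..a + (s + t)} \<partial>M)
    = (\<integral>\<^sup>+\<omega>. jump_sum (indicator U) (path \<omega>) {a<..a + s} \<partial>M)
      + (\<integral>\<^sup>+\<omega>. jump_sum (indicator U) (path \<omega>) {a<..a + t} \<partial>M)"
proof (cases "t = 0")
  case False
  let ?J = "\<lambda>c d \<omega>. jump_sum (indicator U) (path \<omega>) {c<..d}"
  have t: "a \<le> a + s" "a + s < a + (s + t)" using st False by auto
  note [measurable] = jump_count_measurable_open[OF order_refl U]
    jump_count_measurable_open[OF t(1) U]
  have "(\<integral>\<^sup>+\<omega>. ?J a (a + (s + t)) \<omega> \<partial>M) = (\<integral>\<^sup>+\<omega>. ?J a (a + s) \<omega> + ?J (a + s) (a + (s + t)) \<omega> \<partial>M)"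
    using st by (intro nn_integral_cong jump_sum_split) auto
  also have "\<dots> = (\<integral>\<^sup>+\<omega>. ?J a (a + s) \<omega> \<partial>M) + (\<integral>\<^sup>+\<omega>. ?J (a + s) (a + (s + t)) \<omega> \<partial>M)"
    by (rule nn_integral_add) measurable
  also have "(\<integral>\<^sup>+\<omega>. ?J (a + s) (a + (s + t)) \<omega> \<partial>M)
      = (\<integral>\<^sup>+\<omega>. indicator (space M) \<omega> * ?J (a + s) (a + (s + t)) \<omega> \<partial>M)"
    by (intro nn_integral_cong) simp
  also have "\<dots> = (\<integral>\<^sup>+\<omega>. ?J a (a + t) \<omega> \<partial>M)"
    using nn_integral_past_jump_count_shift[OF t U space_in_F[OF t(1)]]
    by (simp add: emeasure_space_1)
  finally show ?thesis .
qed simp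

lemma nn_integral_past_jump_count:
  assumes c: "a \<le> c" and U: "open U" "0 \<notin> U" and A: "A \<in> F c"
  shows "(\<integral>\<^sup>+\<omega>. indicator A \<omega> * jump_sum (indicator U) (path \<omega>) {c<..d} \<partial>M)
    = emeasure M A * (ennreal (d - c) * (\<integral>\<^sup>+\<omega>. jump_sum (indicator U) (path \<omega>) {a<..a + 1} \<partial>M))"
proof (cases "c < d")
  case True
  then have "0 < d - c" by simp
  from additive_linear[of "\<lambda>t. \<integral>\<^sup>+\<omega>. jump_sum (indicator U) (path \<omega>) {a<..a + t} \<partial>M",
      OF nn_integral_jump_count_add[OF U] this]
  show ?thesis by (simp only: nn_integral_past_jump_count_shift[OF c True U A])
qed (simp add: ennreal_neg)

section \<open>Second moments of the jumps\<close>

lemma increment_square: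
  assumes st: "a \<le> s" "s \<le> t"
  shows "integrable M (\<lambda>\<omega>. (L t \<omega> - L s \<omega>)\<^sup>2)"
    and "expectation (\<lambda>\<omega>. (L t \<omega> - L s \<omega>)\<^sup>2) = expectation (\<lambda>\<omega>. (L (a + (t - s)) \<omega>)\<^sup>2)"
proof -
  have t: "a \<le> t" "a \<le> a + (t - s)" using st by auto
  note [measurable] = L_measurable[OF st(1)] L_measurable[OF t(1)] L_measurable[OF t(2)]
  have "integrable (distr M borel (\<lambda>\<omega>. L t \<omega> - L s \<omega>)) (\<lambda>z. z\<^sup>2)"
    unfolding L_stationary[OF st] using L_square[OF t(2)] by (simp add: integrable_distr_eq)
  then show "integrable M (\<lambda>\<omega>. (L t \<omega> - L s \<omega>)\<^sup>2)" by (simp add: integrable_distr_eq)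
  have "expectation (\<lambda>\<omega>. (L t \<omega> - L s \<omega>)\<^sup>2) = (\<integral>z. z\<^sup>2 \<partial>distr M borel (\<lambda>\<omega>. L t \<omega> - L s \<omega>))"
    by (simp add: integral_distr)
  also have "\<dots> = expectation (\<lambda>\<omega>. (L (a + (t - s)) \<omega>)\<^sup>2)"
    unfolding L_stationary[OF st] by (simp add: integral_distr)
  finally show "expectation (\<lambda>\<omega>. (L t \<omega> - L s \<omega>)\<^sup>2) = expectation (\<lambda>\<omega>. (L (a + (t - s)) \<omega>)\<^sup>2)" .
qed

lemma expectation_L_square_add:
  assumes "0 \<le> s" "0 \<le> t"
  shows "expectation (\<lambda>\<omega>. (L (a + (s + t)) \<omega>)\<^sup>2)
    = expectation (\<lambda>\<omega>. (L (a + s) \<omega>)\<^sup>2) + expectation (\<lambda>\<omega>. (L (a + t) \<omega>)\<^sup>2)"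
proof -
  let ?s = "a + s" and ?t = "a + (s + t)"
  let ?I = "\<lambda>\<omega>. L ?t \<omega> - L ?s \<omega>"
  have st: "a \<le> ?s" "?s \<le> ?t" "a \<le> ?t" using assms by auto
  have I: "integrable M ?I" "expectation ?I = 0" using st by (auto simp: L_integrable L_centered)
  have indep: "indep_var borel (L ?s) borel ?I"
    using indep_var_past_increment[OF st(1,2) adapted_measurable_past[OF L_adapted st(1) order_refl],
        of "\<lambda>z. z"]
    by simp
  have cross: "integrable M (\<lambda>\<omega>. L ?s \<omega> * ?I \<omega>)" "expectation (\<lambda>\<omega>. L ?s \<omega> * ?I \<omega>) = 0"
    using indep_var_integrable[OF indep L_integrable[OF st(1)] I(1)]
      indep_var_lebesgue_integral[OF indep L_integrable[OF st(1)] I(1)] I(2) by auto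
  have "expectation (\<lambda>\<omega>. (L ?t \<omega>)\<^sup>2)
      = expectation (\<lambda>\<omega>. (L ?s \<omega>)\<^sup>2 + 2 * (L ?s \<omega> * ?I \<omega>) + (?I \<omega>)\<^sup>2)"
    by (intro Bochner_Integration.integral_cong) (auto simp: power2_eq_square algebra_simps)
  also have "\<dots>
      = expectation (\<lambda>\<omega>. (L ?s \<omega>)\<^sup>2) + 2 * expectation (\<lambda>\<omega>. L ?s \<omega> * ?I \<omega>)
          + expectation (\<lambda>\<omega>. (?I \<omega>)\<^sup>2)"
    using cross(1) L_square[OF st(1)] increment_square(1)[OF st(1,2)] by simp
  finally show ?thesis
    using cross(2) increment_square(2)[OF st(1,2)] by simp
qed

lemma nn_integral_increment_square:
  assumes c: "a \<le> c" "0 < h"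
  shows "(\<integral>\<^sup>+\<omega>. ennreal ((grid_increment (path \<omega>) c h k)\<^sup>2) \<partial>M)
    = ennreal h * ennreal (expectation (\<lambda>\<omega>. (L (a + 1) \<omega>)\<^sup>2))"
proof -
  let ?w = "\<lambda>t. ennreal (expectation (\<lambda>\<omega>. (L (a + t) \<omega>)\<^sup>2))"
  let ?s = "c + h * real k" and ?t = "c + h * (real k + 1)"
  have st: "a \<le> ?s" "?s \<le> ?t" "a + (?t - ?s) = a + h"
    using c by (auto simp: algebra_simps intro: add_increasing2)
  have "(\<integral>\<^sup>+\<omega>. ennreal ((grid_increment (path \<omega>) c h k)\<^sup>2) \<partial>M) = ?w h"
    unfolding grid_increment_def
    using nn_integral_eq_integral[OF increment_square(1)[OF st(1,2)]]
    by (simp only: increment_square(2)[OF st(1,2)] st(3)) simp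
  also have "\<dots> = ennreal h * ?w 1"
    using c by (intro additive_linear) (auto simp: expectation_L_square_add ennreal_plus)
  finally show ?thesis .
qed

text \<open>Fatou's lemma along the grid sums.\<close>
lemma nn_integral_jump_test_sum_le:
  assumes g: "jump_test g" "\<And>z. g z \<le> z\<^sup>2"
  shows "(\<integral>\<^sup>+\<omega>. jump_sum (\<lambda>z. ennreal (g z)) (path \<omega>) {a<..a + 1} \<partial>M)
    \<le> ennreal (expectation (\<lambda>\<omega>. (L (a + 1) \<omega>)\<^sup>2))"
proof -
  let ?K = "ennreal (expectation (\<lambda>\<omega>. (L (a + 1) \<omega>)\<^sup>2))"
  let ?S = "\<lambda>n \<omega>. grid_sum g (path \<omega>) a (a + 1) n"
  have bound: "(\<integral>\<^sup>+\<omega>. ennreal (?S n \<omega>) \<partial>M) \<le> ?K" for n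
  proof -
    let ?h = "(a + 1 - a) / real (Suc n)"
    have h: "0 < ?h" by simp
    note [measurable] = grid_increment_measurable[OF order_refl less_imp_le[OF h]]
    have "(\<integral>\<^sup>+\<omega>. ennreal (?S n \<omega>) \<partial>M)
        \<le> (\<integral>\<^sup>+\<omega>. (\<Sum>k<Suc n. ennreal ((grid_increment (path \<omega>) a ?h k)\<^sup>2)) \<partial>M)"
      unfolding grid_sum_def
      by (subst sum_ennreal)
        (auto intro!: nn_integral_mono ennreal_leI sum_mono g(2) simp del: sum.lessThan_Suc)
    also have "\<dots> = (\<Sum>k<Suc n. \<integral>\<^sup>+\<omega>. ennreal ((grid_increment (path \<omega>) a ?h k)\<^sup>2) \<partial>M)"
      by (rule nn_integral_sum) measurable
    also have "\<dots> = of_nat (Suc n) * (ennreal ?h * ?K)"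
      unfolding nn_integral_increment_square[OF order_refl h] by (simp del: of_nat_Suc)
    also have "\<dots> = ?K"
      by (simp add: ennreal_of_nat_eq_real_of_nat mult.assoc[symmetric] ennreal_mult[symmetric]
          del: of_nat_Suc)
    finally show ?thesis .
  qed
  have lim: "(\<lambda>n. ennreal (?S n \<omega>)) \<longlonglongrightarrow> jump_sum (\<lambda>z. ennreal (g z)) (path \<omega>) {a<..a + 1}"
    if "\<omega> \<in> space M" for \<omega>
    using tendsto_ennrealI[OF jump_test_sum_tendsto[OF order_refl _ g(1) that, of "a + 1"]]
      jump_test_sum_finite[OF order_refl _ g(1) that, of "a + 1"] by simp
  have "(\<integral>\<^sup>+\<omega>. jump_sum (\<lambda>z. ennreal (g z)) (path \<omega>) {a<..a + 1} \<partial>M)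
      = (\<integral>\<^sup>+\<omega>. liminf (\<lambda>n. ennreal (?S n \<omega>)) \<partial>M)"
    by (intro nn_integral_cong lim_imp_Liminf[symmetric] sequentially_bot lim)
  also have "\<dots> \<le> liminf (\<lambda>n. \<integral>\<^sup>+\<omega>. ennreal (?S n \<omega>) \<partial>M)"
    using jump_test_measurable[OF g(1)]
    by (intro nn_integral_liminf measurable_compose[OF grid_sum_measurable measurable_ennreal]) auto
  also have "\<dots> \<le> ?K"
    using bound by (intro Liminf_le) auto
  finally show ?thesis .
qed

end

lemma (in pair_sigma_finite)
  fixes f :: "'a \<Rightarrow> real" and g :: "'b \<Rightarrow> real"
  assumes f: "integrable M1 f" and g: "integrable M2 g"
  shows integrable_product_mult: "integrable (M1 \<Otimes>\<^sub>M M2) (\<lambda>(x, y). f x * g y)"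
    and integral_product_mult: "(\<integral>p. (case p of (x, y) \<Rightarrow> f x * g y) \<partial>(M1 \<Otimes>\<^sub>M M2))
        = (\<integral>x. f x \<partial>M1) * (\<integral>y. g y \<partial>M2)"
proof -
  have [measurable]: "f \<in> borel_measurable M1" "g \<in> borel_measurable M2" using f g by auto
  show int: "integrable (M1 \<Otimes>\<^sub>M M2) (\<lambda>(x, y). f x * g y)"
    using f g by (intro Fubini_integrable) (auto simp: abs_mult)
  from integral_fst'[OF int]
  show "(\<integral>p. (case p of (x, y) \<Rightarrow> f x * g y) \<partial>(M1 \<Otimes>\<^sub>M M2)) = (\<integral>x. f x \<partial>M1) * (\<integral>y. g y \<partial>M2)"
    by simp
qed

section \<open>Predictable processes\<close>

context levy_setting
begin

abbreviation time :: "real measure" where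
  "time \<equiv> restrict_space lborel {a<..}"

lemma sigma_finite_time: "sigma_finite_measure time"
  by (rule sigma_finite_measure_restrict_space[OF sigma_finite_lborel]) simp

sublocale time: sigma_finite_measure time
  by (rule sigma_finite_time)

lemma Ioc_sets_time: "a \<le> u \<Longrightarrow> {u<..v} \<in> sets time"
  by (auto simp: sets_restrict_space)

lemma emeasure_time: "a \<le> u \<Longrightarrow> emeasure time {u<..v} = ennreal (v - u)"
  by (subst emeasure_restrict_space) (cases "u \<le> v"; auto simp: ennreal_neg)+

sublocale time_pair: pair_sigma_finite time M ..

definition predictable_rectangles :: "(real \<times> 'a) set set" where
  "predictable_rectangles = {{u<..v} \<times> A |u v A. a \<le> u \<and> A \<in> F u}"

definition predictable :: "(real \<times> 'a) measure" where
  "predictable = sigma ({a<..} \<times> space M) predictable_rectangles"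

lemma predictable_rectangles_subset: "predictable_rectangles \<subseteq> Pow ({a<..} \<times> space M)"
  using F_sets[THEN sets.sets_into_space] by (fastforce simp: predictable_rectangles_def)

lemma space_predictable [simp]: "space predictable = {a<..} \<times> space M"
  by (simp add: predictable_def space_measure_of_conv)

lemma sets_predictable: "sets predictable = sigma_sets ({a<..} \<times> space M) predictable_rectangles"
  unfolding predictable_def by (rule sets_measure_of[OF predictable_rectangles_subset])

lemma predictable_rectangle: "a \<le> u \<Longrightarrow> A \<in> F u \<Longrightarrow> {u<..v} \<times> A \<in> sets predictable"
  unfolding sets_predictable by (rule sigma_sets.Basic) (auto simp: predictable_rectangles_def)

lemma fst_predictable [measurable]: "fst \<in> borel_measurable predictable"
proof (rule borel_measurableI_le)
  fix v
  have "{p \<in> space predictable. fst p \<le> v} = {a<..v} \<times> space M" by auto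
  then show "{p \<in> space predictable. fst p \<le> v} \<in> sets predictable"
    using predictable_rectangle[OF order_refl space_in_F[OF order_refl]] by simp
qed

lemma ident_measurable_predictable: "(\<lambda>p. p) \<in> time \<Otimes>\<^sub>M M \<rightarrow>\<^sub>M predictable"
  unfolding predictable_def
proof (rule measurable_measure_of[OF predictable_rectangles_subset])
  fix R assume "R \<in> predictable_rectangles"
  then obtain u v A where R: "R = {u<..v} \<times> A" and u: "a \<le> u" and A: "A \<in> F u"
    by (auto simp: predictable_rectangles_def)
  have "R \<in> sets (time \<Otimes>\<^sub>M M)"
    unfolding R by (rule pair_measureI[OF Ioc_sets_time[OF u] F_sets[OF u A]])
  then show "(\<lambda>p. p) -` R \<inter> space (time \<Otimes>\<^sub>M M) \<in> sets (time \<Otimes>\<^sub>M M)"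
    using sets.sets_into_space by (simp add: Int_absorb2)
qed (auto simp: space_pair_measure space_restrict_space)

lemma measurable_predictable_pair: "f \<in> predictable \<rightarrow>\<^sub>M N \<Longrightarrow> f \<in> time \<Otimes>\<^sub>M M \<rightarrow>\<^sub>M N"
  by (rule measurable_compose[OF ident_measurable_predictable])

lemma cell_left_process_predictable:
  assumes X: "adapted_on M {a..} F X" and h: "0 < h"
  shows "(\<lambda>(s, \<omega>). X (cell_left a h s) \<omega>) \<in> borel_measurable predictable"
proof (rule measurableI)
  fix B :: "real set" assume B: "B \<in> sets borel"
  let ?U = "\<Union>k. {a + h * real k<..a + h * (real k + 1)} \<times> {\<omega> \<in> space M. X (a + h * real k) \<omega> \<in> B}"
  have "(\<lambda>(s, \<omega>). X (cell_left a h s) \<omega>) -` B \<inter> space predictable = ?U"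
  proof (intro equalityI subsetI)
    fix p assume "p \<in> (\<lambda>(s, \<omega>). X (cell_left a h s) \<omega>) -` B \<inter> space predictable"
    then show "p \<in> ?U"
      using cell_bounds[OF h, of a "fst p"]
      by (auto simp: cell_left_def cell_right_def intro!: UN_I[of "cell a h (fst p)"])
  next
    fix p assume "p \<in> ?U"
    then obtain k where k: "a + h * real k < fst p" "fst p \<le> a + h * (real k + 1)"
      "snd p \<in> space M" "X (a + h * real k) (snd p) \<in> B" by auto
    moreover have "0 \<le> h * real k" using h by simp
    ultimately show "p \<in> (\<lambda>(s, \<omega>). X (cell_left a h s) \<omega>) -` B \<inter> space predictable"
      using cell_eqI[OF h k(1,2)] by (auto simp: cell_left_def case_prod_beta' mem_Times_iff)
  qed
  moreover have "{\<omega> \<in> space M. X (a + h * real k) \<omega> \<in> B} \<in> F (a + h * real k)" for k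
    using X B h by (auto simp: adapted_on_def)
  ultimately show "(\<lambda>(s, \<omega>). X (cell_left a h s) \<omega>) -` B \<inter> space predictable \<in> sets predictable"
    using h by (auto intro!: sets.countable_UN predictable_rectangle)
qed simp

context
  fixes X :: "real \<Rightarrow> 'a \<Rightarrow> real"
  assumes X: "adapted_on M {a..} F X" and cadlag: "\<And>\<omega>. \<omega> \<in> space M \<Longrightarrow> cadlag_from a (\<lambda>t. X t \<omega>)"
begin

lemma left_lim_predictable: "(\<lambda>(s, \<omega>). left_lim (\<lambda>t. X t \<omega>) s) \<in> borel_measurable predictable"
proof (rule borel_measurable_LIMSEQ_metric[OF cell_left_process_predictable[OF X]])
  fix p assume "p \<in> space predictable"
  then show "(\<lambda>n. case p of (s, \<omega>) \<Rightarrow> X (cell_left a (1 / real (Suc n)) s) \<omega>)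
    \<longlonglongrightarrow> (case p of (s, \<omega>) \<Rightarrow> left_lim (\<lambda>t. X t \<omega>) s)"
    by (auto intro!: cadlag_cell_left_tendsto mesh_tendsto_0 cadlag simp del: of_nat_Suc)
qed simp

lemma process_measurable_pair: "(\<lambda>(s, \<omega>). X s \<omega>) \<in> borel_measurable (time \<Otimes>\<^sub>M M)"
proof (rule borel_measurable_LIMSEQ_metric)
  fix n :: nat
  let ?h = "1 / real (Suc n)"
  have "(\<lambda>p. X (a + ?h * (real k + 1)) (snd p)) \<in> borel_measurable (time \<Otimes>\<^sub>M M)" for k
    by (rule measurable_compose[OF measurable_snd adapted_measurable[OF X]]) simp
  moreover have "(\<lambda>p. cell a ?h (fst p)) \<in> time \<Otimes>\<^sub>M M \<rightarrow>\<^sub>M count_space UNIV"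
    by (rule measurable_compose[OF measurable_compose[OF measurable_fst] cell_measurable])
      (simp add: measurable_restrict_space1)
  ultimately have "(\<lambda>p. X (a + ?h * (real (cell a ?h (fst p)) + 1)) (snd p))
      \<in> borel_measurable (time \<Otimes>\<^sub>M M)"
    by (rule measurable_compose_countable)
  then show "(\<lambda>(s, \<omega>). X (cell_right a ?h s) \<omega>) \<in> borel_measurable (time \<Otimes>\<^sub>M M)"
    by (simp add: cell_right_def case_prod_beta')
next
  fix p assume "p \<in> space (time \<Otimes>\<^sub>M M)"
  then show "(\<lambda>n. case p of (s, \<omega>) \<Rightarrow> X (cell_right a (1 / real (Suc n)) s) \<omega>)
    \<longlonglongrightarrow> (case p of (s, \<omega>) \<Rightarrow> X s \<omega>)"
    by (auto simp: space_pair_measure space_restrict_space simp del: of_nat_Suc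
        intro!: cadlag_cell_right_tendsto mesh_tendsto_0 cadlag)
qed

lemma AE_left_lim_process_eq: "AE (s, \<omega>) in time \<Otimes>\<^sub>M M. left_lim (\<lambda>t. X t \<omega>) s = X s \<omega>"
proof -
  note [measurable] = process_measurable_pair measurable_predictable_pair[OF left_lim_predictable]
  let ?P = "\<lambda>p. (case p of (s, \<omega>) \<Rightarrow> left_lim (\<lambda>t. X t \<omega>) s) = (case p of (s, \<omega>) \<Rightarrow> X s \<omega>)"
  have "{p \<in> space (time \<Otimes>\<^sub>M M). ?P p} \<in> sets (time \<Otimes>\<^sub>M M)" by measurable
  then have sets: "{p \<in> space (time \<Otimes>\<^sub>M M). case p of (s, \<omega>) \<Rightarrow> left_lim (\<lambda>t. X t \<omega>) s = X s \<omega>}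
      \<in> sets (time \<Otimes>\<^sub>M M)"
    by (simp add: case_prod_beta')
  have "AE \<omega> in M. AE s in time. left_lim (\<lambda>t. X t \<omega>) s = X s \<omega>"
    by (rule AE_I2) (simp add: AE_restrict_space_iff AE_left_lim_eq[OF cadlag])
  then have "AE s in time. AE \<omega> in M. left_lim (\<lambda>t. X t \<omega>) s = X s \<omega>"
    using time_pair.AE_commute[of "\<lambda>s \<omega>. left_lim (\<lambda>t. X t \<omega>) s = X s \<omega>"] sets by simp
  then show ?thesis using time_pair.AE_pair_measure[OF sets] by simp
qed

end

section \<open>The jump measure and its intensity\<close>

abbreviation jump_counting :: "'a \<Rightarrow> real measure" where
  "jump_counting \<omega> \<equiv> count_space (jump_times (path \<omega>) {a<..})"

definition jump_kernel :: "'a \<Rightarrow> ((real \<times> 'a) \<times> real) measure" where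
  "jump_kernel \<omega> = distr (jump_counting \<omega>) (predictable \<Otimes>\<^sub>M borel)
     (\<lambda>s. ((s, \<omega>), jump (path \<omega>) s))"

lemma sets_jump_kernel: "sets (jump_kernel \<omega>) = sets (predictable \<Otimes>\<^sub>M borel)"
  by (simp add: jump_kernel_def)

lemma jump_points_measurable:
  "\<omega> \<in> space M \<Longrightarrow>
    (\<lambda>s. ((s, \<omega>), jump (path \<omega>) s)) \<in> jump_counting \<omega> \<rightarrow>\<^sub>M predictable \<Otimes>\<^sub>M borel"
  by (auto simp: space_pair_measure jump_times_def)

lemma nn_integral_jump_kernel:
  assumes "\<omega> \<in> space M" "f \<in> borel_measurable (predictable \<Otimes>\<^sub>M borel)"
  shows "(\<integral>\<^sup>+x. f x \<partial>jump_kernel \<omega>)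
    = (\<integral>\<^sup>+s. f ((s, \<omega>), jump (path \<omega>) s) \<partial>jump_counting \<omega>)"
  unfolding jump_kernel_def
  using assms(2) by (subst nn_integral_distr[OF jump_points_measurable[OF assms(1)]]) simp_all

lemma emeasure_jump_kernel_rectangle:
  assumes \<omega>: "\<omega> \<in> space M" and u: "a \<le> u" and A: "A \<in> F u" and V: "V \<in> sets borel"
  shows "emeasure (jump_kernel \<omega>) (({u<..v} \<times> A) \<times> V)
    = indicator A \<omega> * jump_sum (indicator V) (path \<omega>) {u<..v}"
proof -
  let ?f = "\<lambda>s. indicator V (jump (path \<omega>) s) :: ennreal"
  have R: "({u<..v} \<times> A) \<times> V \<in> sets (predictable \<Otimes>\<^sub>M borel)"
    using predictable_rectangle[OF u A] V by auto
  have "emeasure (jump_kernel \<omega>) (({u<..v} \<times> A) \<times> V)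
      = (\<integral>\<^sup>+x. indicator (({u<..v} \<times> A) \<times> V) x \<partial>jump_kernel \<omega>)"
    using R by (simp add: sets_jump_kernel)
  also have "\<dots> = (\<integral>\<^sup>+s. indicator (({u<..v} \<times> A) \<times> V) ((s, \<omega>), jump (path \<omega>) s)
      \<partial>jump_counting \<omega>)"
    using R by (intro nn_integral_jump_kernel[OF \<omega>]) simp
  also have "\<dots>
      = (\<integral>\<^sup>+s. indicator A \<omega> * (?f s * indicator (jump_times (path \<omega>) {u<..v}) s)
          \<partial>count_space UNIV)"
    using u
    by (auto simp: nn_integral_count_space_indicator indicator_def jump_times_def
        intro!: nn_integral_cong)
  also have "\<dots> = indicator A \<omega> * jump_sum (indicator V) (path \<omega>) {u<..v}"
    unfolding jump_sum_def by (simp add: nn_integral_cmult nn_integral_count_space_indicator)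
  finally show ?thesis .
qed

text \<open>The jump sizes are tested on sets \<open>V\<close> with \<open>V - {0}\<close> open: removing \<open>0\<close> from \<open>V\<close> does not affect
  the jumps in \<open>V\<close>, and the whole line is a countable union of such sets of finite intensity.\<close>
definition jump_rectangles :: "((real \<times> 'a) \<times> real) set set" where
  "jump_rectangles = {R \<times> V |R V. R \<in> predictable_rectangles \<and> open (V - {0})}"

definition far :: "nat \<Rightarrow> real set" where
  "far k = insert 0 {z. 1 / real (Suc k) < \<bar>z\<bar>}"

definition jump_cover :: "nat \<Rightarrow> ((real \<times> 'a) \<times> real) set" where
  "jump_cover k = ({a<..a + real k} \<times> space M) \<times> far k"

lemma borel_if_open_minus_0:
  fixes V :: "real set"
  assumes "open (V - {0})"
  shows "V \<in> sets borel"
proof -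
  have "V = (V - {0}) \<union> (if 0 \<in> V then {0} else {})" by auto
  moreover have "\<dots> \<in> sets borel" by (intro sets.Un borel_open[OF assms]) simp
  ultimately show ?thesis by (rule ssubst)
qed

lemma open_far: "open (far k - {0})"
proof -
  have "far k - {0} = {z. 1 / real (Suc k) < \<bar>z\<bar>}" by (auto simp: far_def)
  moreover have "open {z. 1 / real (Suc k) < \<bar>z\<bar>}" by (intro open_Collect_less continuous_intros)
  ultimately show ?thesis by simp
qed

lemma UN_far: "(\<Union>k. far k) = UNIV"
proof -
  have "\<exists>k. z \<in> far k" for z
  proof (cases "z = 0")
    case False
    then obtain k where "1 / real (Suc k) < \<bar>z\<bar>" using nat_approx_posE[of "\<bar>z\<bar>"] by auto
    then show ?thesis by (auto simp: far_def)
  qed (simp add: far_def)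
  then show ?thesis by auto
qed

lemma incseq_far: "incseq far"
proof (rule incseq_SucI)
  fix k
  have "1 / real (Suc (Suc k)) \<le> 1 / real (Suc k)" by (simp add: frac_le)
  then show "far k \<subseteq> far (Suc k)" unfolding far_def by auto
qed

lemma Int_stable_jump_rectangles: "Int_stable jump_rectangles"
proof (rule Int_stableI)
  fix Q Q' assume "Q \<in> jump_rectangles" "Q' \<in> jump_rectangles"
  then obtain u v A V u' v' A' V' where Q: "Q = ({u<..v} \<times> A) \<times> V" "Q' = ({u'<..v'} \<times> A') \<times> V'"
    and u: "a \<le> u" "a \<le> u'" and A: "A \<in> F u" "A' \<in> F u'" and V: "open (V - {0})" "open (V' - {0})"
    by (auto simp: jump_rectangles_def predictable_rectangles_def)
  let ?u = "max u u'"
  have "Q \<inter> Q' = ({?u<..min v v'} \<times> (A \<inter> A')) \<times> (V \<inter> V')" unfolding Q by auto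
  moreover have "A \<in> sets (past ?u)" "A' \<in> sets (past ?u)"
    using A u F_mono[of u ?u] F_mono[of u' ?u] by (auto simp: sets_past)
  then have "A \<inter> A' \<in> F ?u" using u sets.Int[of A "past ?u" A'] by (simp add: sets_past)
  moreover have "V \<inter> V' - {0} = (V - {0}) \<inter> (V' - {0})" by auto
  then have "open (V \<inter> V' - {0})" using open_Int[OF V] by simp
  moreover have "a \<le> ?u" using u by simp
  ultimately show "Q \<inter> Q' \<in> jump_rectangles"
    unfolding jump_rectangles_def predictable_rectangles_def by blast
qed

lemma jump_rectangles_subset: "jump_rectangles \<subseteq> Pow (space (predictable \<Otimes>\<^sub>M borel))"
  using predictable_rectangles_subset by (fastforce simp: jump_rectangles_def space_pair_measure)

lemma sets_jump_rectangles:
  "sets (predictable \<Otimes>\<^sub>M borel) = sigma_sets (space (predictable \<Otimes>\<^sub>M borel)) jump_rectangles"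
proof -
  have "sets (predictable \<Otimes>\<^sub>M borel) = sets (sigma (space predictable \<times> space borel)
      {R \<times> V |R V. R \<in> predictable_rectangles \<and> V \<in> {V :: real set. open (V - {0})}})"
  proof (rule sets_pair_eq)
    show "(sets borel :: real set set) = sigma_sets (space borel) {V. open (V - {0})}"
    proof (rule antisym)
      have "sigma_sets UNIV {V :: real set. open V} \<subseteq> sigma_sets UNIV {V. open (V - {0})}"
        by (rule sigma_sets_mono') auto
      then show "(sets borel :: real set set) \<subseteq> sigma_sets (space borel) {V. open (V - {0})}"
        by (simp add: borel_def)
      show "sigma_sets (space borel) {V :: real set. open (V - {0})} \<subseteq> sets borel"
        by (rule sets.sigma_sets_subset) (auto intro: borel_if_open_minus_0)
    qed
    show "range (\<lambda>n. {a<..a + real n} \<times> space M) \<subseteq> predictable_rectangles"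
      using space_in_F by (auto simp: predictable_rectangles_def)
    have "\<exists>n. s \<le> a + real n" for s
      using real_arch_simple[of "s - a"] by (auto simp: algebra_simps)
    then show "\<Union> (range (\<lambda>n. {a<..a + real n} \<times> space M)) = space predictable" by auto
    show "countable {UNIV :: real set}" "{UNIV :: real set} \<subseteq> {V. open (V - {0})}"
      "\<Union> {UNIV :: real set} = space borel" by (auto simp: open_delete)
  qed (use predictable_rectangles_subset in \<open>auto simp: sets_predictable\<close>)
  then show ?thesis
    using jump_rectangles_subset by (simp add: jump_rectangles_def space_pair_measure)
qed

lemma range_jump_cover: "range jump_cover \<subseteq> jump_rectangles"
proof (rule image_subsetI)
  fix k
  have "{a<..a + real k} \<times> space M \<in> predictable_rectangles"
    using space_in_F[OF order_refl] unfolding predictable_rectangles_def by blast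
  then show "jump_cover k \<in> jump_rectangles"
    using open_far[of k] unfolding jump_rectangles_def jump_cover_def by blast
qed

lemma incseq_jump_cover: "incseq jump_cover"
  using incseq_far unfolding jump_cover_def incseq_def by (intro allI impI Sigma_mono) auto

lemma UN_jump_cover: "(\<Union>k. jump_cover k) = space (predictable \<Otimes>\<^sub>M borel)"
proof (intro equalityI subsetI)
  fix x :: "(real \<times> 'a) \<times> real" assume "x \<in> space (predictable \<Otimes>\<^sub>M borel)"
  then obtain s \<omega> z where x: "x = ((s, \<omega>), z)" "a < s" "\<omega> \<in> space M"
    by (auto simp: space_pair_measure)
  obtain k where k: "s - a \<le> real k" using real_arch_simple by blast
  obtain l where l: "z \<in> far l" using UN_far by auto
  have "x \<in> jump_cover (max k l)"
    using x k l incseqD[OF incseq_far, of l "max k l"] by (auto simp: jump_cover_def)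
  then show "x \<in> (\<Union>k. jump_cover k)" by blast
qed (auto simp: jump_cover_def space_pair_measure)

lemma jump_rectanglesE:
  assumes "Q \<in> jump_rectangles"
  obtains u v A V where "Q = ({u<..v} \<times> A) \<times> V" "a \<le> u" "A \<in> F u" "open (V - {0})" "V \<in> sets borel"
  using assms borel_if_open_minus_0 by (auto simp: jump_rectangles_def predictable_rectangles_def)

lemma jump_sum_indicator_minus_0: "jump_sum (indicator V) x I = jump_sum (indicator (V - {0})) x I"
  by (rule jump_sum_cong) (simp add: indicator_def)

lemma emeasure_jump_kernel_cover:
  assumes \<omega>: "\<omega> \<in> space M"
  shows "emeasure (jump_kernel \<omega>) (jump_cover k) \<noteq> \<infinity>"
proof -
  have far: "far k \<in> sets borel" by (rule borel_if_open_minus_0[OF open_far])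
  have le: "indicator (far k) z \<le> ennreal (bump (- {0}) (2 * Suc k) z)" if "z \<noteq> 0" for z
  proof (cases "z \<in> far k")
    case True
    then have "1 < real (Suc k) * \<bar>z\<bar>" using that by (simp add: far_def field_simps)
    then have "2 \<le> real (2 * Suc k) * infdist z (- (- {0}))"
      by (simp add: dist_real_def algebra_simps)
    then have "bump (- {0}) (2 * Suc k) z = 1" unfolding bump_def by linarith
    then show ?thesis by (simp add: indicator_def)
  qed simp
  have "emeasure (jump_kernel \<omega>) (jump_cover k)
      = jump_sum (indicator (far k)) (path \<omega>) {a<..a + real k}"
    unfolding jump_cover_def using emeasure_jump_kernel_rectangle[OF \<omega> order_refl space_in_F far] \<omega>
    by simp
  also have "\<dots> \<le> jump_sum (\<lambda>z. ennreal (bump (- {0}) (2 * Suc k) z)) (path \<omega>) {a<..a + real k}"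
    unfolding jump_sum_def by (intro nn_integral_mono le) (simp add: jump_times_def)
  also have "\<dots> < \<infinity>"
    using jump_test_sum_finite[OF order_refl _ jump_test_bump \<omega>, of "a + real k" "- {0}"]
    by (cases "k = 0") auto
  finally show ?thesis by simp
qed

sublocale jumps: measure_kernel M "predictable \<Otimes>\<^sub>M borel" jump_kernel
proof (rule measure_kernelI_generator[OF Int_stable_jump_rectangles jump_rectangles_subset
      sets_jump_rectangles range_jump_cover incseq_jump_cover UN_jump_cover sets_jump_kernel
      emeasure_jump_kernel_cover])
  fix Q assume "Q \<in> jump_rectangles"
  then obtain u v A V where Q: "Q = ({u<..v} \<times> A) \<times> V" and u: "a \<le> u" and A: "A \<in> F u"
    and V: "open (V - {0})" "V \<in> sets borel" by (rule jump_rectanglesE)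
  have [measurable]: "A \<in> sets M" by (rule F_sets[OF u A])
  have [measurable]: "(\<lambda>\<omega>. jump_sum (indicator V) (path \<omega>) {u<..v}) \<in> borel_measurable M"
    unfolding jump_sum_indicator_minus_0[of V] by (rule jump_count_measurable_open[OF u V(1)]) simp
  show "(\<lambda>\<omega>. emeasure (jump_kernel \<omega>) Q) \<in> borel_measurable M"
    unfolding Q
    by (subst measurable_cong[OF emeasure_jump_kernel_rectangle[OF _ u A V(2)]]) measurable
qed

lemma emeasure_jumps_rectangle:
  assumes u: "a \<le> u" and A: "A \<in> F u" and V: "V \<in> sets borel"
  shows "emeasure jumps.mixture (({u<..v} \<times> A) \<times> V)
    = (\<integral>\<^sup>+\<omega>. indicator A \<omega> * jump_sum (indicator V) (path \<omega>) {u<..v} \<partial>M)"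
  using predictable_rectangle[OF u A] V
  by (simp add: jumps.emeasure_mixture emeasure_jump_kernel_rectangle u A cong: nn_integral_cong)

abbreviation \<Lambda> :: "real measure" where
  "\<Lambda> \<equiv> levy_measure M a L"

lemma levy_measure_eq_distr_jumps:
  "\<Lambda> = distr (density jumps.mixture (indicator (({a<..a + 1} \<times> space M) \<times> UNIV))) borel snd"
  (is "_ = ?D")
proof -
  have unit: "{a<..a + 1} \<times> space M \<in> sets predictable"
    by (rule predictable_rectangle[OF order_refl space_in_F[OF order_refl]])
  have D: "emeasure ?D B
      = (\<integral>\<^sup>+\<omega>. \<integral>\<^sup>+s. indicator (B - {0}) (jump (path \<omega>) s) \<partial>count_space {a<..a + 1} \<partial>M)"
    if B: "B \<in> sets borel" for B
  proof -
    have "emeasure ?D B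
        = emeasure (density jumps.mixture (indicator (({a<..a + 1} \<times> space M) \<times> UNIV)))
        (snd -` B \<inter> space (predictable \<Otimes>\<^sub>M borel))"
      using B by (subst emeasure_distr) simp_all
    also have "\<dots> = emeasure jumps.mixture
        (({a<..a + 1} \<times> space M) \<times> UNIV \<inter> (snd -` B \<inter> space (predictable \<Otimes>\<^sub>M borel)))"
      using B unit by (intro emeasure_restricted) (auto intro: measurable_sets[OF measurable_snd])
    also have "({a<..a + 1} \<times> space M) \<times> UNIV \<inter> (snd -` B \<inter> space (predictable \<Otimes>\<^sub>M borel))
        = ({a<..a + 1} \<times> space M) \<times> B"
      by (auto simp: space_pair_measure)
    also have "emeasure jumps.mixture (({a<..a + 1} \<times> space M) \<times> B)
        = (\<integral>\<^sup>+\<omega>. jump_sum (indicator B) (path \<omega>) {a<..a + 1} \<partial>M)"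
      by (simp add: emeasure_jumps_rectangle[OF order_refl space_in_F[OF order_refl] B]
          cong: nn_integral_cong)
    also have "\<dots> = (\<integral>\<^sup>+\<omega>. \<integral>\<^sup>+s. indicator (B - {0}) (jump (path \<omega>) s) \<partial>count_space {a<..a + 1} \<partial>M)"
      unfolding jump_sum_def
      by (auto simp: nn_integral_count_space_indicator indicator_def jump_times_def
          intro!: nn_integral_cong)
    finally show ?thesis .
  qed
  have borel: "sigma_sets UNIV (sets borel) = (sets borel :: real set set)"
    using sets.sigma_sets_eq[of "borel :: real measure"] by simp
  have "\<Lambda> = measure_of UNIV (sets borel) (emeasure ?D)"
    unfolding levy_measure_def by (rule measure_of_eq) (auto simp: borel D)
  also have "\<dots> = ?D" using measure_of_of_measure[of ?D] by simp
  finally show ?thesis .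
qed

lemma sets_levy_measure [simp, measurable_cong]: "sets \<Lambda> = sets borel"
  by (subst levy_measure_eq_distr_jumps) simp

lemma space_levy_measure [simp]: "space \<Lambda> = UNIV"
  by (subst levy_measure_eq_distr_jumps) simp

lemma nn_integral_levy_measure:
  assumes [measurable]: "u \<in> borel_measurable borel"
  shows "(\<integral>\<^sup>+z. u z \<partial>\<Lambda>) = (\<integral>\<^sup>+\<omega>. jump_sum u (path \<omega>) {a<..a + 1} \<partial>M)"
proof -
  let ?R = "({a<..a + 1} \<times> space M) \<times> (UNIV :: real set)"
  have [measurable]: "?R \<in> sets (predictable \<Otimes>\<^sub>M borel)"
    using predictable_rectangle[OF order_refl space_in_F[OF order_refl]] by simp
  have "(\<integral>\<^sup>+z. u z \<partial>\<Lambda>) = (\<integral>\<^sup>+x. indicator ?R x * u (snd x) \<partial>jumps.mixture)"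
    by (simp add: levy_measure_eq_distr_jumps nn_integral_distr nn_integral_density)
  also have "\<dots> = (\<integral>\<^sup>+\<omega>. \<integral>\<^sup>+x. indicator ?R x * u (snd x) \<partial>jump_kernel \<omega> \<partial>M)"
    by (rule jumps.nn_integral_mixture) measurable
  also have "\<dots> = (\<integral>\<^sup>+\<omega>. jump_sum u (path \<omega>) {a<..a + 1} \<partial>M)"
  proof (rule nn_integral_cong)
    fix \<omega> assume \<omega>: "\<omega> \<in> space M"
    have "(\<integral>\<^sup>+x. indicator ?R x * u (snd x) \<partial>jump_kernel \<omega>)
        = (\<integral>\<^sup>+s. indicator ?R ((s, \<omega>), jump (path \<omega>) s) * u (jump (path \<omega>) s) \<partial>jump_counting \<omega>)"
      by (subst nn_integral_jump_kernel[OF \<omega>]) auto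
    also have "\<dots> = jump_sum u (path \<omega>) {a<..a + 1}"
      unfolding jump_sum_def using \<omega>
      by (auto simp: nn_integral_count_space_indicator indicator_def jump_times_def
          intro!: nn_integral_cong)
    finally show "(\<integral>\<^sup>+x. indicator ?R x * u (snd x) \<partial>jump_kernel \<omega>)
        = jump_sum u (path \<omega>) {a<..a + 1}" .
  qed
  finally show ?thesis .
qed

lemma emeasure_levy_measure:
  "V \<in> sets borel \<Longrightarrow> emeasure \<Lambda> V = (\<integral>\<^sup>+\<omega>. jump_sum (indicator V) (path \<omega>) {a<..a + 1} \<partial>M)"
  using nn_integral_levy_measure[of "indicator V"] by simp

lemma emeasure_levy_measure_minus_0:
  "V \<in> sets borel \<Longrightarrow> emeasure \<Lambda> (V - {0}) = emeasure \<Lambda> V"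
  by (simp add: emeasure_levy_measure jump_sum_indicator_minus_0[of V])

lemma nn_integral_levy_measure_square_finite: "(\<integral>\<^sup>+z. ennreal (z\<^sup>2) \<partial>\<Lambda>) < \<infinity>"
proof -
  let ?g = "\<lambda>n z. z\<^sup>2 * bump (- {0}) n z"
  have test: "jump_test (?g n)" for n
    by (intro jump_test_mult jump_test_bump continuous_intros) auto
  have "ennreal (z\<^sup>2) = ennreal (z\<^sup>2) * indicator (- {0}) z" for z :: real
    by (simp add: indicator_def)
  also have "ennreal (z\<^sup>2) * indicator (- {0}) z = (SUP n. ennreal (?g n z))" for z :: real
    using SUP_bump[of "- {0}" z]
    by (simp add: ennreal_mult' SUP_mult_left_ennreal[symmetric] open_delete Compl_eq_Diff_UNIV)
  finally have "(\<integral>\<^sup>+z. ennreal (z\<^sup>2) \<partial>\<Lambda>) = (\<integral>\<^sup>+z. (SUP n. ennreal (?g n z)) \<partial>\<Lambda>)" by simp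
  also have "\<dots> = (SUP n. \<integral>\<^sup>+z. ennreal (?g n z) \<partial>\<Lambda>)"
    using jump_test_measurable[OF test]
    by (intro nn_integral_monotone_convergence_SUP)
      (auto simp: incseq_def le_fun_def intro!: ennreal_leI mult_left_mono bump_mono)
  also have "\<dots> \<le> ennreal (expectation (\<lambda>\<omega>. (L (a + 1) \<omega>)\<^sup>2))"
  proof (rule SUP_least)
    fix n
    have "?g n z \<le> z\<^sup>2" for z using bump_le_1[of "- {0}" n z] by (simp add: mult_left_le)
    then show "(\<integral>\<^sup>+z. ennreal (?g n z) \<partial>\<Lambda>) \<le> ennreal (expectation (\<lambda>\<omega>. (L (a + 1) \<omega>)\<^sup>2))"
      using jump_test_measurable[OF test]
      by (simp add: nn_integral_levy_measure nn_integral_jump_test_sum_le[OF test])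
  qed
  finally show ?thesis by (rule le_less_trans) simp
qed

lemma integrable_levy_measure_square: "integrable \<Lambda> (\<lambda>z. z\<^sup>2)"
  using nn_integral_levy_measure_square_finite by (intro integrableI_nonneg) auto

lemma emeasure_levy_measure_far: "emeasure \<Lambda> (far k) < \<infinity>"
proof -
  let ?c = "(real (Suc k))\<^sup>2"
  have "emeasure \<Lambda> (far k) = emeasure \<Lambda> (far k - {0})"
    using emeasure_levy_measure_minus_0[OF borel_if_open_minus_0[OF open_far]] by simp
  also have "\<dots> \<le> emeasure \<Lambda> {z \<in> UNIV. 1 \<le> ennreal ?c * ennreal (z\<^sup>2)}"
  proof (rule emeasure_mono)
    have "1 \<le> ?c * z\<^sup>2" if "1 / real (Suc k) < \<bar>z\<bar>" for z
    proof -
      have "1 \<le> real (Suc k) * \<bar>z\<bar>" using that by (simp add: field_simps)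
      then have "1 \<le> (real (Suc k) * \<bar>z\<bar>)\<^sup>2" by (rule one_le_power)
      then show ?thesis by (simp only: power_mult_distrib power2_abs)
    qed
    then show "far k - {0} \<subseteq> {z \<in> UNIV. 1 \<le> ennreal ?c * ennreal (z\<^sup>2)}"
      by (auto simp: far_def ennreal_mult[symmetric] ennreal_le_1[symmetric] simp del: ennreal_1
          simp flip: ennreal_1 intro!: ennreal_leI)
  qed measurable
  also have "\<dots> \<le> ennreal ?c * (\<integral>\<^sup>+z. ennreal (z\<^sup>2) * indicator UNIV z \<partial>\<Lambda>)"
    by (rule nn_integral_Markov_inequality) auto
  also have "\<dots> < \<infinity>"
    using nn_integral_levy_measure_square_finite by (simp add: ennreal_mult_less_top)
  finally show ?thesis .
qed

lemma sigma_finite_levy_measure: "sigma_finite_measure \<Lambda>"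
proof
  show "\<exists>A. countable A \<and> A \<subseteq> sets \<Lambda> \<and> \<Union> A = space \<Lambda> \<and> (\<forall>a\<in>A. emeasure \<Lambda> a \<noteq> \<infinity>)"
    using UN_far emeasure_levy_measure_far borel_if_open_minus_0[OF open_far]
    by (intro exI[of _ "range far"]) (auto simp: less_top)
qed

sublocale levy: sigma_finite_measure \<Lambda>
  by (rule sigma_finite_levy_measure)

sublocale levy_pair: pair_sigma_finite "time \<Otimes>\<^sub>M M" \<Lambda>
  by (intro pair_sigma_finite.intro time_pair.sigma_finite_measure_axioms
      levy.sigma_finite_measure_axioms)

lemma ident_measurable_jumps: "(\<lambda>x. x) \<in> (time \<Otimes>\<^sub>M M) \<Otimes>\<^sub>M \<Lambda> \<rightarrow>\<^sub>M predictable \<Otimes>\<^sub>M borel"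
proof -
  have "(\<lambda>x. (fst x, snd x)) \<in> (time \<Otimes>\<^sub>M M) \<Otimes>\<^sub>M \<Lambda> \<rightarrow>\<^sub>M predictable \<Otimes>\<^sub>M borel"
    by (intro measurable_Pair measurable_compose[OF measurable_fst ident_measurable_predictable])
      simp
  then show ?thesis by simp
qed

theorem jump_intensity: "jumps.mixture = distr ((time \<Otimes>\<^sub>M M) \<Otimes>\<^sub>M \<Lambda>) (predictable \<Otimes>\<^sub>M borel) (\<lambda>x. x)"
  (is "_ = ?D")
proof (rule measure_eqI_generator_eq[OF Int_stable_jump_rectangles jump_rectangles_subset])
  have rectangle: "emeasure jumps.mixture (({u<..v} \<times> A) \<times> V)
      = emeasure M A * (ennreal (v - u) * emeasure \<Lambda> V)"
    if "a \<le> u" "A \<in> F u" "open (V - {0})" "V \<in> sets borel" for u v A V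
    using that nn_integral_past_jump_count[of u "V - {0}" A v]
    by (simp add: emeasure_jumps_rectangle emeasure_levy_measure jump_sum_indicator_minus_0[of V])
  show "emeasure jumps.mixture Q = emeasure ?D Q" if "Q \<in> jump_rectangles" for Q
    using that
  proof (rule jump_rectanglesE)
    fix u v A V
    assume Q: "Q = ({u<..v} \<times> A) \<times> V" and u: "a \<le> u" and A: "A \<in> F u"
      and V: "open (V - {0})" "V \<in> sets borel"
    note sets = Ioc_sets_time[OF u, of v] F_sets[OF u A]
    have "emeasure ?D Q = emeasure ((time \<Otimes>\<^sub>M M) \<Otimes>\<^sub>M \<Lambda>) Q"
      using predictable_rectangle[OF u A] V(2) sets sets.sets_into_space[OF sets(2)] u unfolding Q
      by (subst emeasure_distr[OF ident_measurable_jumps])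
        (auto simp: space_pair_measure space_restrict_space intro!: arg_cong2[where f = emeasure])
    also have "\<dots> = emeasure time {u<..v} * emeasure M A * emeasure \<Lambda> V"
      unfolding Q using sets V(2)
      by (simp add: levy.emeasure_pair_measure_Times emeasure_pair_measure_Times)
    finally show ?thesis by (simp add: Q rectangle[OF u A V] emeasure_time[OF u] mult_ac)
  qed
  show "emeasure jumps.mixture (jump_cover k) \<noteq> \<infinity>" for k
    unfolding jump_cover_def rectangle[OF order_refl space_in_F[OF order_refl]
        open_far borel_if_open_minus_0[OF open_far]]
    using emeasure_levy_measure_far[of k]
    by (simp add: emeasure_space_1 ennreal_mult_eq_top_iff less_top)
qed (use range_jump_cover UN_jump_cover sets_jump_rectangles in auto)

lemma
  fixes Z :: "real \<times> 'a \<Rightarrow> real"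
  assumes Z: "Z \<in> borel_measurable predictable" "integrable (time \<Otimes>\<^sub>M M) Z"
  shows AE_integrable_compensation:
      "AE \<omega> in M. integrable (jump_counting \<omega>) (\<lambda>s. Z (s, \<omega>) * (jump (path \<omega>) s)\<^sup>2)"
    and integrable_compensation:
      "integrable M (\<lambda>\<omega>. \<integral>s. Z (s, \<omega>) * (jump (path \<omega>) s)\<^sup>2 \<partial>jump_counting \<omega>)"
    and compensation_formula:
      "expectation (\<lambda>\<omega>. \<integral>s. Z (s, \<omega>) * (jump (path \<omega>) s)\<^sup>2 \<partial>jump_counting \<omega>)
        = (\<integral>z. z\<^sup>2 \<partial>\<Lambda>) * (\<integral>x. Z x \<partial>(time \<Otimes>\<^sub>M M))"
proof -
  let ?f = "\<lambda>(x, z). Z x * z\<^sup>2"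
  have f [measurable]: "?f \<in> borel_measurable (predictable \<Otimes>\<^sub>M borel)"
    using Z(1) by measurable
  have product: "integrable ((time \<Otimes>\<^sub>M M) \<Otimes>\<^sub>M \<Lambda>) ?f"
    "(\<integral>x. ?f x \<partial>((time \<Otimes>\<^sub>M M) \<Otimes>\<^sub>M \<Lambda>)) = (\<integral>x. Z x \<partial>(time \<Otimes>\<^sub>M M)) * (\<integral>z. z\<^sup>2 \<partial>\<Lambda>)"
    using levy_pair.integrable_product_mult[OF Z(2) integrable_levy_measure_square]
      levy_pair.integral_product_mult[OF Z(2) integrable_levy_measure_square] by simp_all
  have int: "integrable jumps.mixture ?f"
    using product(1) by (simp add: jump_intensity integrable_distr_eq[OF ident_measurable_jumps f])
  have kernel: "integrable (jump_kernel \<omega>) ?f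
      \<longleftrightarrow> integrable (jump_counting \<omega>) (\<lambda>s. Z (s, \<omega>) * (jump (path \<omega>) s)\<^sup>2)"
    "(\<integral>x. ?f x \<partial>jump_kernel \<omega>)
      = (\<integral>s. Z (s, \<omega>) * (jump (path \<omega>) s)\<^sup>2 \<partial>jump_counting \<omega>)"
    if "\<omega> \<in> space M" for \<omega>
    unfolding jump_kernel_def
    by (simp_all add: integrable_distr_eq[OF jump_points_measurable[OF that] f]
        integral_distr[OF jump_points_measurable[OF that] f])
  show "AE \<omega> in M. integrable (jump_counting \<omega>) (\<lambda>s. Z (s, \<omega>) * (jump (path \<omega>) s)\<^sup>2)"
    using jumps.AE_integrable_kernel[OF int] AE_space by eventually_elim (simp only: kernel(1))
  show "integrable M (\<lambda>\<omega>. \<integral>s. Z (s, \<omega>) * (jump (path \<omega>) s)\<^sup>2 \<partial>jump_counting \<omega>)"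
    by (rule Bochner_Integration.integrable_cong[OF refl kernel(2), THEN iffD1,
          OF _ jumps.integrable_integral_kernel[OF int]])
  show "expectation (\<lambda>\<omega>. \<integral>s. Z (s, \<omega>) * (jump (path \<omega>) s)\<^sup>2 \<partial>jump_counting \<omega>)
      = (\<integral>z. z\<^sup>2 \<partial>\<Lambda>) * (\<integral>x. Z x \<partial>(time \<Otimes>\<^sub>M M))"
    using jumps.integral_mixture[OF int] product(2)
    by (simp add: kernel(2) jump_intensity integral_distr[OF ident_measurable_jumps f] mult.commute
        cong: Bochner_Integration.integral_cong)
qed

end

section \<open>Delay densities\<close>

lemma integrable_mult_bounded:
  fixes f g :: "'a \<Rightarrow> real"
  assumes f: "integrable M f" and g: "g \<in> borel_measurable M" "\<And>x. \<bar>g x\<bar> \<le> B"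
  shows "integrable M (\<lambda>x. f x * g x)"
proof (rule Bochner_Integration.integrable_bound)
  show "integrable M (\<lambda>x. f x * B)" using f by simp
  show "(\<lambda>x. f x * g x) \<in> borel_measurable M" using f g(1) by simp
  have "\<bar>g x\<bar> \<le> \<bar>B\<bar>" for x using g(2)[of x] by linarith
  then show "AE x in M. norm (f x * g x) \<le> norm (f x * B)"
    by (intro AE_I2) (simp add: abs_mult mult_left_mono)
qed

definition delay_density :: "real \<Rightarrow> (real \<Rightarrow> real) \<Rightarrow> bool" where
  "delay_density r g \<longleftrightarrow> g \<in> borel_measurable borel \<and> (\<exists>B. \<forall>u. \<bar>g u\<bar> \<le> B)
     \<and> (\<forall>u. u \<notin> {- r..0} \<longrightarrow> g u = 0) \<and> finite {u. \<not> isCont g u}"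

lemma delay_density_measurable: "delay_density r g \<Longrightarrow> g \<in> borel_measurable borel"
  and delay_density_bounded: "delay_density r g \<Longrightarrow> \<exists>B. \<forall>u. \<bar>g u\<bar> \<le> B"
  and delay_density_zero: "delay_density r g \<Longrightarrow> u \<notin> {- r..0} \<Longrightarrow> g u = 0"
  and delay_density_finite_discontinuities: "delay_density r g \<Longrightarrow> finite {u. \<not> isCont g u}"
  by (auto simp: delay_density_def)

lemma delay_density_mono:
  assumes "delay_density q g" "q \<le> r"
  shows "delay_density r g"
  using assms unfolding delay_density_def by auto

lemma delay_density_add_cmult:
  assumes g: "delay_density r g" and h: "delay_density r h"
  shows "delay_density r (\<lambda>u. g u + k * h u)"
proof -
  obtain B C where B: "\<And>u. \<bar>g u\<bar> \<le> B" and C: "\<And>u. \<bar>h u\<bar> \<le> C"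
    using delay_density_bounded[OF g] delay_density_bounded[OF h] by blast
  have "\<bar>g u + k * h u\<bar> \<le> B + \<bar>k\<bar> * C" for u
    using abs_triangle_ineq[of "g u" "k * h u"] B[of u] mult_left_mono[OF C[of u], of "\<bar>k\<bar>"]
    by (simp add: abs_mult)
  moreover have "isCont (\<lambda>u. g u + k * h u) u" if "isCont g u" "isCont h u" for u
    using that by (intro continuous_intros)
  then have "{u. \<not> isCont (\<lambda>u. g u + k * h u) u} \<subseteq> {u. \<not> isCont g u} \<union> {u. \<not> isCont h u}"
    by blast
  then have "finite {u. \<not> isCont (\<lambda>u. g u + k * h u) u}"
    by (rule finite_subset)
      (simp add: delay_density_finite_discontinuities[OF g]
          delay_density_finite_discontinuities[OF h])
  ultimately show ?thesis
    using g h unfolding delay_density_def by auto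
qed

lemma isCont_if_continuous_on_Icc_supported:
  fixes g :: "real \<Rightarrow> real"
  assumes g: "continuous_on {c..d} g" and zero: "\<And>u. u \<notin> {c..d} \<Longrightarrow> g u = 0" and u: "u \<notin> {c, d}"
  shows "isCont g u"
proof (cases "u \<in> {c..d}")
  case True
  with u have "u \<in> interior {c..d}" by auto
  then show ?thesis by (rule continuous_on_interior[OF g])
next
  case False
  have "\<forall>\<^sub>F x in at u. x \<in> - {c..d}"
    using False by (intro eventually_at_in_open') auto
  then have "\<forall>\<^sub>F x in at u. g x = g u" by eventually_elim (use zero False in auto)
  then show ?thesis unfolding isCont_def by (rule tendsto_eventually)
qed

lemma delay_density_continuous_on:
  assumes g: "continuous_on {- q..0} g" and zero: "\<And>u. u \<notin> {- q..0} \<Longrightarrow> g u = 0"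
  shows "delay_density q g"
proof -
  have "(\<lambda>u. indicator {- q..0} u *\<^sub>R g u) \<in> borel_measurable borel"
    by (rule borel_measurable_continuous_on_indicator[OF _ g]) simp
  moreover have "(\<lambda>u. indicator {- q..0} u *\<^sub>R g u) = g"
    using zero by (auto simp: indicator_def fun_eq_iff)
  ultimately have "g \<in> borel_measurable borel" by simp
  moreover have "\<exists>B. \<forall>u. \<bar>g u\<bar> \<le> B"
  proof -
    have "bounded (g ` {- q..0})" by (intro compact_imp_bounded compact_continuous_image g) simp
    then obtain B where "\<forall>y\<in>g ` {- q..0}. norm y \<le> B" unfolding bounded_iff by blast
    then have "\<bar>g u\<bar> \<le> max 0 B" for u using zero[of u]
      by (cases "u \<in> {- q..0}") (auto simp: le_max_iff_disj)
    then show ?thesis by blast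
  qed
  moreover have "{u. \<not> isCont g u} \<subseteq> {- q, 0}"
    using isCont_if_continuous_on_Icc_supported[OF g zero] by blast
  then have "finite {u. \<not> isCont g u}" by (rule finite_subset) simp
  ultimately show ?thesis using zero by (simp add: delay_density_def)
qed

lemma delay_density_integrable:
  assumes g: "delay_density r g"
  shows "integrable lborel g"
proof -
  obtain B where B: "\<And>u. \<bar>g u\<bar> \<le> B" using delay_density_bounded[OF g] by blast
  have "integrable lborel (\<lambda>u. indicator {- r..0} u *\<^sub>R g u)"
    using delay_density_measurable[OF g] B
    by (intro integrableI_bounded_set_indicator[where B=B]) (auto simp: emeasure_lborel_Icc_eq)
  moreover have "(\<lambda>u. indicator {- r..0} u *\<^sub>R g u) = g"
    using delay_density_zero[OF g] by (auto simp: indicator_def fun_eq_iff)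
  ultimately show ?thesis by simp
qed

text \<open>The mass that the density \<open>g\<close> gives to the delays \<open>u\<close> with \<open>u < s \<le> t + u\<close>, which is the weight of
  time \<open>s\<close> in \<open>\<integral> (\<integral>\<^bsub>(u, t + u]\<^esub> y) g u du\<close>.\<close>
definition delay_weight :: "(real \<Rightarrow> real) \<Rightarrow> real \<Rightarrow> real \<Rightarrow> real" where
  "delay_weight g t s = (\<integral>u. g u * indicator {s - t..<s} u \<partial>lborel)"

lemma integrable_delay_indicator:
  fixes g :: "real \<Rightarrow> real"
  assumes "integrable lborel g" "A \<in> sets borel"
  shows "integrable lborel (\<lambda>u. g u * indicator A u)"
  using assms by (intro integrable_real_mult_indicator) auto

lemma delay_weight_add_cmult:
  assumes "delay_density r g" "delay_density r h"
  shows "delay_weight (\<lambda>u. g u + k * h u) t s = delay_weight g t s + k * delay_weight h t s"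
  using assms[THEN delay_density_integrable]
  by (simp add: delay_weight_def distrib_right mult.assoc integrable_delay_indicator)

lemma delay_weight_zero:
  assumes "delay_density r g" "s \<notin> {- r..t}"
  shows "delay_weight g t s = 0"
proof -
  have "(\<lambda>u. g u * indicator {s - t..<s} u) = (\<lambda>u. 0)"
    using delay_density_zero[OF assms(1)] assms(2) by (auto simp: indicator_def fun_eq_iff)
  then show ?thesis by (simp only: delay_weight_def integral_zero)
qed

lemma delay_weight_bounded:
  assumes g: "delay_density r g"
  shows "\<exists>B. \<forall>s. \<bar>delay_weight g t s\<bar> \<le> B"
proof -
  have "\<bar>delay_weight g t s\<bar> \<le> (\<integral>u. \<bar>g u\<bar> \<partial>lborel)" for s
  proof -
    have "\<bar>delay_weight g t s\<bar> \<le> (\<integral>u. \<bar>g u * indicator {s - t..<s} u\<bar> \<partial>lborel)"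
      unfolding delay_weight_def by (rule integral_abs_bound)
    also have "\<dots> \<le> (\<integral>u. \<bar>g u\<bar> \<partial>lborel)"
      using delay_density_integrable[OF g]
      by (intro integral_mono integrable_abs integrable_delay_indicator) (auto simp: indicator_def)
    finally show ?thesis .
  qed
  then show ?thesis by blast
qed

lemma delay_weight_measurable:
  assumes "delay_density r g"
  shows "delay_weight g t \<in> borel_measurable borel"
proof -
  note [measurable] = delay_density_measurable[OF assms]
  have "(\<lambda>s. \<integral>u. g u * (if s - t \<le> u \<and> u < s then 1 else 0) \<partial>lborel) \<in> borel_measurable borel"
    by (rule lborel.borel_measurable_lebesgue_integral) measurable
  also have "(\<lambda>s. \<integral>u. g u * (if s - t \<le> u \<and> u < s then 1 else 0) \<partial>lborel) = delay_weight g t"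
    unfolding delay_weight_def
    by (intro ext Bochner_Integration.integral_cong) (auto simp: indicator_def)
  finally show ?thesis .
qed

text \<open>The measure \<open>\<rho>\<close> is Lebesgue measure for the integrals \<open>ds\<close> and counting measure
  on the jump times for the integrals \<open>dS\<^sub>s\<close>.\<close>
lemma has_integral_delay_swap:
  fixes \<rho> :: "real measure" and y g :: "real \<Rightarrow> real"
  assumes \<rho>: "sigma_finite_measure \<rho>" "(\<lambda>s. s) \<in> borel_measurable \<rho>"
    and y: "integrable \<rho> y" and g: "delay_density q g"
  shows "((\<lambda>u. (\<integral>s. y s * indicator {u<..t + u} s \<partial>\<rho>) * g u) has_integral
    (\<integral>s. y s * delay_weight g t s \<partial>\<rho>)) {- q..0}"
proof -
  interpret P: pair_sigma_finite lborel \<rho>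
    by (intro pair_sigma_finite.intro lborel.sigma_finite_measure_axioms \<rho>(1))
  note [measurable] = delay_density_measurable[OF g] \<rho>(2) borel_measurable_integrable[OF y]
  let ?I = "\<lambda>u s. if u < s \<and> s \<le> t + u then 1 else 0 :: real"
  let ?f = "\<lambda>(u, s). g u * (y s * ?I u s)"
  have int: "integrable (lborel \<Otimes>\<^sub>M \<rho>) ?f"
  proof (rule Bochner_Integration.integrable_bound)
    show "integrable (lborel \<Otimes>\<^sub>M \<rho>) (\<lambda>(u, s). g u * y s)"
      by (rule P.integrable_product_mult[OF delay_density_integrable[OF g] y])
    show "?f \<in> borel_measurable (lborel \<Otimes>\<^sub>M \<rho>)" by measurable
    show "AE p in lborel \<Otimes>\<^sub>M \<rho>. norm (?f p) \<le> norm (case p of (u, s) \<Rightarrow> g u * y s)"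
      by (rule AE_I2) (simp add: case_prod_beta')
  qed
  have inner: "(\<integral>s. ?f (u, s) \<partial>\<rho>) = (\<integral>s. y s * indicator {u<..t + u} s \<partial>\<rho>) * g u" for u
  proof -
    have "(\<integral>s. y s * ?I u s \<partial>\<rho>) = (\<integral>s. y s * indicator {u<..t + u} s \<partial>\<rho>)"
      by (intro Bochner_Integration.integral_cong) (auto simp: indicator_def)
    then show ?thesis by simp
  qed
  have outer: "(\<integral>u. ?f (u, s) \<partial>lborel) = y s * delay_weight g t s" for s
  proof -
    have "(\<integral>u. ?f (u, s) \<partial>lborel) = (\<integral>u. y s * (g u * indicator {s - t..<s} u) \<partial>lborel)"
      by (intro Bochner_Integration.integral_cong) (auto simp: indicator_def)
    then show ?thesis by (simp add: delay_weight_def)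
  qed
  have "((\<lambda>u. (\<integral>s. y s * indicator {u<..t + u} s \<partial>\<rho>) * g u) has_integral
      (\<integral>u. (\<integral>s. y s * indicator {u<..t + u} s \<partial>\<rho>) * g u \<partial>lborel)) UNIV"
    using P.integrable_fst'[OF int] unfolding inner by (rule has_integral_integral_lborel)
  also have "(\<integral>u. (\<integral>s. y s * indicator {u<..t + u} s \<partial>\<rho>) * g u \<partial>lborel)
      = (\<integral>s. y s * delay_weight g t s \<partial>\<rho>)"
    using P.integral_fst'[OF int] P.integral_snd[OF int] unfolding inner[symmetric] outer[symmetric]
    by simp
  also have "(\<lambda>u. (\<integral>s. y s * indicator {u<..t + u} s \<partial>\<rho>) * g u)
      = (\<lambda>u. if u \<in> {- q..0} then (\<integral>s. y s * indicator {u<..t + u} s \<partial>\<rho>) * g u else 0)"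
    using delay_density_zero[OF g] by auto
  finally show ?thesis unfolding has_integral_restrict_UNIV .
qed

text \<open>The weight of time \<open>s\<close> for the delay measure \<open>g u du + c \<delta>\<^sub>0 (du)\<close>.\<close>
definition delay_measure_weight :: "(real \<Rightarrow> real) \<Rightarrow> real \<Rightarrow> real \<Rightarrow> real \<Rightarrow> real" where
  "delay_measure_weight g c t s = delay_weight g t s + c * indicator {0<..t} s"

lemma delay_measure_weight_measurable:
  "delay_density r g \<Longrightarrow> delay_measure_weight g c t \<in> borel_measurable borel"
  using delay_weight_measurable[of r g t] by (simp add: delay_measure_weight_def[abs_def])

lemma delay_measure_weight_bounded:
  assumes g: "delay_density r g"
  shows "\<exists>B. \<forall>s. \<bar>delay_measure_weight g c t s\<bar> \<le> B"
proof -
  obtain B where B: "\<And>s. \<bar>delay_weight g t s\<bar> \<le> B" using delay_weight_bounded[OF g] by blast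
  have "\<bar>delay_measure_weight g c t s\<bar> \<le> B + \<bar>c\<bar>" for s
    using abs_triangle_ineq[of "delay_weight g t s" "c * indicator {0<..t} s"] B[of s]
    by (auto simp: delay_measure_weight_def indicator_def)
  then show ?thesis by blast
qed

lemma delay_measure_weight_zero:
  "delay_density r g \<Longrightarrow> \<forall>s>t. delay_measure_weight g c t s = 0"
  by (simp add: delay_measure_weight_def delay_weight_zero)

lemma delay_measure_weight_add_cmult:
  assumes "delay_density r g" "delay_density r h"
  shows "delay_measure_weight g c t s + k * delay_measure_weight h d t s
    = delay_measure_weight (\<lambda>u. g u + k * h u) (c + k * d) t s"
  unfolding delay_measure_weight_def delay_weight_add_cmult[OF assms] by (simp add: algebra_simps)

lemma integral_delay_measure:
  fixes \<rho> :: "real measure" and y g :: "real \<Rightarrow> real"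
  assumes \<rho>: "sigma_finite_measure \<rho>" "(\<lambda>s. s) \<in> borel_measurable \<rho>"
    and y: "integrable \<rho> y" and g: "delay_density q g"
  shows "integral {- q..0} (\<lambda>u. (\<integral>s. y s * indicator {u<..t + u} s \<partial>\<rho>) * g u)
    + c * (\<integral>s. y s * indicator {0<..t} s \<partial>\<rho>) = (\<integral>s. y s * delay_measure_weight g c t s \<partial>\<rho>)"
proof -
  note [measurable] = \<rho>(2) delay_weight_measurable[OF g]
  obtain B where B: "\<And>s. \<bar>delay_weight g t s\<bar> \<le> B" using delay_weight_bounded[OF g] by blast
  have weight: "integrable \<rho> (\<lambda>s. y s * delay_weight g t s)"
    by (rule integrable_mult_bounded[OF y _ B]) (rule measurable_compose[OF \<rho>(2)], measurable)
  have point: "integrable \<rho> (\<lambda>s. y s * indicator {0<..t} s)"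
    by (rule integrable_mult_bounded[OF y, of _ 1])
      (rule measurable_compose[OF \<rho>(2)], auto simp: indicator_def)
  have "(\<integral>s. y s * delay_measure_weight g c t s \<partial>\<rho>)
      = (\<integral>s. y s * delay_weight g t s + c * (y s * indicator {0<..t} s) \<partial>\<rho>)"
    by (intro Bochner_Integration.integral_cong)
      (simp_all add: delay_measure_weight_def algebra_simps)
  also have "\<dots> = (\<integral>s. y s * delay_weight g t s \<partial>\<rho>) + c * (\<integral>s. y s * indicator {0<..t} s \<partial>\<rho>)"
    using weight point by simp
  finally show ?thesis
    using integral_unique[OF has_integral_delay_swap[OF \<rho> y g]] by simp
qed

section \<open>The deterministic delay equation\<close>

lemma integral_shift_eventually_const:
  fixes g :: "real \<Rightarrow> real"
  assumes g: "\<And>c d. 0 \<le> c \<Longrightarrow> g integrable_on {c..d}" and const: "\<And>x. r \<le> x \<Longrightarrow> g x = g r"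
    and r: "0 \<le> r" and t: "0 \<le> t"
  shows "(\<lambda>u. g (t + u) - g u) integrable_on {0..r}"
    and "integral {0..t} g + integral {0..r} (\<lambda>u. g (t + u) - g u) = t * g r"
proof -
  have "(g has_integral integral {t..t + r} g) (cbox t (t + r))"
    using integrable_integral[OF g[of t "t + r"]] t by simp
  from has_integral_affinity[OF this, of 1 t]
  have "((\<lambda>u. g (u + t)) has_integral integral {t..t + r} g) ((\<lambda>x. x - t) ` {t..t + r})" by simp
  then have shift: "((\<lambda>u. g (t + u)) has_integral integral {t..t + r} g) {0..r}"
    using r by (simp add: image_diff_atLeastAtMost[of t] add.commute)
  have diff: "((\<lambda>u. g (t + u) - g u) has_integral integral {t..t + r} g - integral {0..r} g) {0..r}"
    by (intro has_integral_diff shift integrable_integral g) simp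
  then show "(\<lambda>u. g (t + u) - g u) integrable_on {0..r}" by blast
  have "integral {0..t} g + integral {t..t + r} g = integral {0..t + r} g"
    using r t by (intro Henstock_Kurzweil_Integration.integral_combine g) auto
  also have "\<dots> = integral {0..r} g + integral {r..t + r} g"
    using r t by (intro Henstock_Kurzweil_Integration.integral_combine[symmetric] g) auto
  also have "integral {r..t + r} g = integral {r..t + r} (\<lambda>_. g r)"
    by (intro integral_cong const) simp
  also have "\<dots> = t * g r" using t by simp
  finally show "integral {0..t} g + integral {0..r} (\<lambda>u. g (t + u) - g u) = t * g r"
    using integral_unique[OF diff] by simp
qed

locale delay_system =
  fixes m f :: "real \<Rightarrow> real" and r :: real
  assumes r_pos: "0 < r" and f_density: "delay_density r f"
    and m_set_integrable: "\<And>T. set_integrable lborel {- r..T} m"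
begin

lemma m_integrable_on: "- r \<le> c \<Longrightarrow> m integrable_on {c..d}"
  by (rule set_borel_integral_eq_integral(1)[OF set_integrable_subset[OF m_set_integrable]]) auto

definition drift :: "real \<Rightarrow> real" where
  "drift t = integral {- r..0} (\<lambda>u. m (t + u) * f u)"

definition tail :: "real \<Rightarrow> real" where
  "tail x = (\<integral>u. f u * indicator {- x..} u \<partial>lborel)"

lemma f_measurable [measurable]: "f \<in> borel_measurable borel"
  by (rule delay_density_measurable[OF f_density])

definition m_upto :: "real \<Rightarrow> real \<Rightarrow> real" where
  "m_upto T s = indicator {- r..T} s * m s"

lemma m_upto_integrable: "integrable lborel (m_upto T)"
  using m_set_integrable[of T] by (simp add: set_integrable_def m_upto_def[abs_def])

lemma m_upto_measurable [measurable]: "m_upto T \<in> borel_measurable borel"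
  using borel_measurable_integrable[OF m_upto_integrable] by simp

lemma has_integral_drift:
  assumes t: "t \<in> {0..T}"
  shows "((\<lambda>u. m (t + u) * f u) has_integral (\<integral>s. m_upto T s * f (s - t) \<partial>lborel)) {- r..0}"
proof -
  obtain B where B: "\<And>u. \<bar>f u\<bar> \<le> B" using delay_density_bounded[OF f_density] by blast
  have "integrable lborel (\<lambda>s. m_upto T s * f (s - t))"
    by (rule integrable_mult_bounded[OF m_upto_integrable _ B]) simp
  from lborel_has_bochner_integral_real_affine_iff[of 1, THEN iffD1,
      OF _ has_bochner_integral_integrable[OF this], of t]
  have shift: "integrable lborel (\<lambda>u. m_upto T (t + u) * f u)"
    "(\<integral>u. m_upto T (t + u) * f u \<partial>lborel) = (\<integral>s. m_upto T s * f (s - t) \<partial>lborel)"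
    by (simp_all add: has_bochner_integral_iff)
  have "((\<lambda>u. m_upto T (t + u) * f u) has_integral (\<integral>s. m_upto T s * f (s - t) \<partial>lborel)) UNIV"
    using has_integral_integral_lborel[OF shift(1)] unfolding shift(2) .
  also have "(\<lambda>u. m_upto T (t + u) * f u)
      = (\<lambda>u. if u \<in> {- r..0} then m (t + u) * f u else 0)"
    using t delay_density_zero[OF f_density] by (auto simp: m_upto_def fun_eq_iff)
  finally show ?thesis unfolding has_integral_restrict_UNIV .
qed

lemma drift_integrable_on: "0 \<le> t \<Longrightarrow> (\<lambda>u. m (t + u) * f u) integrable_on {- r..0}"
  using has_integral_drift[of t t] by auto

lemma drift_eq: "t \<in> {0..T} \<Longrightarrow> drift t = (\<integral>s. m_upto T s * f (s - t) \<partial>lborel)"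
  unfolding drift_def by (rule integral_unique[OF has_integral_drift])

lemma continuous_on_drift: "continuous_on {0..T} drift"
  unfolding continuous_on_sequentially
proof (intro allI ballI impI)
  fix S s assume s: "s \<in> {0..T}" and S: "(\<forall>n. S n \<in> {0..T}) \<and> S \<longlonglongrightarrow> s"
  obtain B where B: "\<And>u. \<bar>f u\<bar> \<le> B" using delay_density_bounded[OF f_density] by blast
  have "(\<lambda>n. \<integral>v. m_upto T v * f (v - S n) \<partial>lborel)
      \<longlonglongrightarrow> (\<integral>v. m_upto T v * f (v - s) \<partial>lborel)"
  proof (rule integral_dominated_convergence[where w="\<lambda>v. \<bar>m_upto T v\<bar> * B"])
    show "integrable lborel (\<lambda>v. \<bar>m_upto T v\<bar> * B)"
      by (intro integrable_mult_left integrable_abs m_upto_integrable)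
    show "AE v in lborel. norm (m_upto T v * f (v - S n)) \<le> \<bar>m_upto T v\<bar> * B" for n
      using B by (intro AE_I2) (auto simp: abs_mult intro!: mult_left_mono)
    have "AE v in lborel. v \<notin> (\<lambda>e. e + s) ` {u. \<not> isCont f u}"
      using delay_density_finite_discontinuities[OF f_density]
      by (intro AE_not_in countable_imp_null_set_lborel) (simp add: countable_finite)
    then show "AE v in lborel. (\<lambda>n. m_upto T v * f (v - S n))
        \<longlonglongrightarrow> m_upto T v * f (v - s)"
    proof eventually_elim
      case (elim v)
      then have "v - s \<notin> {u. \<not> isCont f u}" using image_eqI[of v "\<lambda>e. e + s" "v - s"] by auto
      then have "isCont f (v - s)" by simp
      then have "(\<lambda>n. f (v - S n)) \<longlonglongrightarrow> f (v - s)"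
        using S by (intro isCont_tendsto_compose[of _ f] tendsto_intros) auto
      then show ?case by (intro tendsto_intros)
    qed
  qed measurable
  then show "(drift \<circ> S) \<longlonglongrightarrow> drift s"
    using S s drift_eq[of _ T] by (simp add: comp_def)
qed

lemma integral_reflected_eq_delay_weight:
  "(\<integral>v. indicator {0<..t} v * f (s - v) \<partial>lborel) = delay_weight f t s"
proof -
  have "(\<integral>v. indicator {0<..t} v * f (s - v) \<partial>lborel)
      = (\<integral>u. indicator {0<..t} (s + - 1 * u) * f (s - (s + - 1 * u)) \<partial>lborel)"
    by (subst lborel_integral_real_affine[where c="- 1" and t=s]) auto
  also have "\<dots> = delay_weight f t s"
    unfolding delay_weight_def
    by (intro Bochner_Integration.integral_cong) (auto simp: indicator_def)
  finally show ?thesis .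
qed

lemma integral_drift:
  assumes t: "0 \<le> t"
  shows "integral {0..t} drift = (\<integral>s. m_upto t s * delay_weight f t s \<partial>lborel)"
proof -
  let ?F = "\<lambda>(v, s). m_upto t s * (indicator {0<..t} v * f (s - v))"
  obtain B where B: "\<And>u. \<bar>f u\<bar> \<le> B" using delay_density_bounded[OF f_density] by blast
  have "integrable (lborel \<Otimes>\<^sub>M lborel) (\<lambda>(v, s). indicator {0<..t} v * m_upto t s)"
    by (intro lborel_pair.integrable_product_mult m_upto_integrable) (simp add: t)
  from integrable_mult_bounded[OF this, of "\<lambda>(v, s). f (s - v)" B]
  have int: "integrable (lborel \<Otimes>\<^sub>M lborel) ?F"
    using B by (simp add: case_prod_beta' mult_ac)
  have drift: "set_integrable lborel {0..t} drift"
    by (intro borel_integrable_atLeastAtMost' continuous_on_drift)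
  have "integral {0..t} drift = (\<integral>v. indicator {0..t} v * drift v \<partial>lborel)"
    using set_borel_integral_eq_integral(2)[OF drift] by (simp add: set_lebesgue_integral_def)
  also have "\<dots> = (\<integral>v. \<integral>s. ?F (v, s) \<partial>lborel \<partial>lborel)"
  proof (rule integral_cong_AE)
    show "AE v in lborel. indicator {0..t} v * drift v = (\<integral>s. ?F (v, s) \<partial>lborel)"
      using AE_lborel_singleton[of 0]
    proof eventually_elim
      case (elim v)
      then show ?case using drift_eq[of v t] by (cases "v \<in> {0..t}") (auto simp: indicator_def)
    qed
    show "(\<lambda>v. indicator {0..t} v * drift v) \<in> borel_measurable lborel"
      using drift by (auto simp: set_integrable_def dest: borel_measurable_integrable)
    show "(\<lambda>v. \<integral>s. ?F (v, s) \<partial>lborel) \<in> borel_measurable lborel"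
      by (rule borel_measurable_integrable[OF lborel_pair.integrable_fst'[OF int]])
  qed
  also have "\<dots> = (\<integral>s. \<integral>v. ?F (v, s) \<partial>lborel \<partial>lborel)"
    using lborel_pair.integral_fst'[OF int] lborel_pair.integral_snd[OF int] by simp
  finally show ?thesis by (simp add: integral_reflected_eq_delay_weight)
qed

lemma delay_weight_eq_tail:
  assumes "0 \<le> t"
  shows "delay_weight f t s = tail (t - s) - tail (- s)"
proof -
  have "delay_weight f t s
      = (\<integral>u. f u * indicator {- (t - s)..} u - f u * indicator {- (- s)..} u \<partial>lborel)"
    unfolding delay_weight_def using assms
    by (intro Bochner_Integration.integral_cong) (auto simp: indicator_def)
  then show ?thesis
    unfolding tail_def using delay_density_integrable[OF f_density]
    by (simp add: integrable_delay_indicator)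
qed

lemma tail_nonpos:
  assumes "x \<le> 0"
  shows "tail x = 0"
  unfolding tail_def
proof (rule integral_eq_zero_AE)
  show "AE u in lborel. f u * indicator {- x..} u = 0"
    using AE_lborel_singleton[of 0]
    by eventually_elim (use assms delay_density_zero[OF f_density] in \<open>auto simp: indicator_def\<close>)
qed

lemma tail_const:
  assumes "r \<le> x"
  shows "tail x = tail r"
  unfolding tail_def using assms delay_density_zero[OF f_density]
  by (intro Bochner_Integration.integral_cong) (auto simp: indicator_def)

lemma has_integral_tail: "((\<lambda>u. f (- u)) has_integral tail x) {0..min x r}"
proof -
  have "((\<lambda>u. f u * indicator {- x..} u) has_integral tail x) UNIV"
    unfolding tail_def
    by (intro has_integral_integral_lborel integrable_delay_indicator
        delay_density_integrable[OF f_density]) simp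
  also have "(\<lambda>u. f u * indicator {- x..} u) = (\<lambda>u. if u \<in> {- min x r..0} then f u else 0)"
  proof
    fix u show "f u * indicator {- x..} u = (if u \<in> {- min x r..0} then f u else 0)"
      using delay_density_zero[OF f_density, of u] by (auto simp: indicator_def min_def)
  qed
  finally have "(f has_integral tail x) {- min x r..0}"
    unfolding has_integral_restrict_UNIV .
  then show ?thesis using has_integral_reflect_real[of f "tail x" 0 "- min x r"] by simp
qed

lemma tail_eq_integral: "tail x = integral {0..min x r} (\<lambda>u. f (- u))"
  by (rule integral_unique[OF has_integral_tail, symmetric])

lemma continuous_on_tail: "continuous_on {0..} tail"
proof -
  have "continuous_on {0..r} (\<lambda>y. integral {0..y} (\<lambda>u. f (- u)))"
    using has_integral_tail[of r] by (intro indefinite_integral_continuous_1) auto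
  then have "continuous_on {0..} (\<lambda>x. integral {0..min x r} (\<lambda>u. f (- u)))"
    by (rule continuous_on_compose2) (use r_pos in \<open>auto intro!: continuous_intros\<close>)
  then show ?thesis by (simp add: tail_eq_integral[abs_def])
qed

lemma delay_weight_set_integrable: "set_integrable lborel {- r..t} (\<lambda>s. m s * delay_weight f t s)"
proof -
  obtain B where B: "\<And>s. \<bar>delay_weight f t s\<bar> \<le> B" using delay_weight_bounded[OF f_density] by blast
  note [measurable] = delay_weight_measurable[OF f_density]
  have "integrable lborel (\<lambda>s. m_upto t s * delay_weight f t s)"
    by (rule integrable_mult_bounded[OF m_upto_integrable _ B]) simp
  then show ?thesis by (simp add: set_integrable_def m_upto_def mult.assoc)
qed

lemma delay_weight_integrable_on:
  assumes "- r \<le> c" "d \<le> t"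
  shows "(\<lambda>s. m s * delay_weight f t s) integrable_on {c..d}"
  using assms
  by (intro set_borel_integral_eq_integral(1)
      set_integrable_subset[OF delay_weight_set_integrable[of t]]) auto

lemma integral_drift_split:
  assumes t: "0 \<le> t"
  shows "integral {0..t} drift
    = integral {- r..0} (\<lambda>s. m s * delay_weight f t s) + integral {0..t} (\<lambda>s. m s * tail (t - s))"
proof -
  let ?w = "\<lambda>s. m s * delay_weight f t s"
  have "integral {0..t} drift = integral {- r..t} ?w"
    using set_borel_integral_eq_integral(2)[OF delay_weight_set_integrable[of t]]
    by (simp add: integral_drift[OF t] set_lebesgue_integral_def m_upto_def mult.assoc)
  also have "\<dots> = integral {- r..0} ?w + integral {0..t} ?w"
    using Henstock_Kurzweil_Integration.integral_combine[OF _ _ delay_weight_integrable_on,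
        of "- r" 0 t t] r_pos t
    by simp
  also have "integral {0..t} ?w = integral {0..t} (\<lambda>s. m s * tail (t - s))"
    using t by (intro integral_cong) (simp add: delay_weight_eq_tail tail_nonpos)
  finally show ?thesis .
qed

lemma zeta_eq: "0 < x \<Longrightarrow> zeta c0 f r x = tail x - c0"
  by (simp add: zeta_def tail_eq_integral)

end

locale delay_equation = delay_system +
  fixes \<eta> c0 :: real
  assumes integrated_equation: "\<And>t. 0 \<le> t \<Longrightarrow>
    m t = m 0 + \<eta> * t - c0 * integral {0..t} m + integral {0..t} drift"
begin

lemma continuous_on_m: "continuous_on {0..T} m"
proof -
  have "continuous_on {0..T} (\<lambda>t. m 0 + \<eta> * t - c0 * integral {0..t} m + integral {0..t} drift)"
    using r_pos by (intro continuous_intros indefinite_integral_continuous_1 m_integrable_on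
        integrable_continuous_real continuous_on_drift) simp
  then show ?thesis by (rule continuous_on_eq) (simp add: integrated_equation[symmetric])
qed

theorem m_has_derivative:
  assumes t: "0 < t"
  shows "(m has_real_derivative \<eta> - c0 * m t + drift t) (at t)"
proof -
  have at: "at t within {0..t + 1} = at t" using t by (intro at_within_Icc_at) auto
  have "((\<lambda>t. integral {0..t} m) has_real_derivative m t) (at t)"
    "((\<lambda>t. integral {0..t} drift) has_real_derivative drift t) (at t)"
    using integral_has_real_derivative[OF continuous_on_m, of t "t + 1"]
      integral_has_real_derivative[OF continuous_on_drift, of t "t + 1"] t unfolding at by simp_all
  then have "((\<lambda>t. m 0 + \<eta> * t - c0 * integral {0..t} m + integral {0..t} drift)
      has_real_derivative \<eta> - c0 * m t + drift t) (at t)"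
    by (auto intro!: derivative_eq_intros)
  then show ?thesis
  proof (rule has_field_derivative_transform_within_open[where S="{0<..}"])
    fix x :: real assume "x \<in> {0<..}"
    then show "m 0 + \<eta> * x - c0 * integral {0..x} m + integral {0..x} drift = m x"
      by (simp add: integrated_equation[symmetric])
  qed (use t in auto)
qed

lemma deriv_m: "0 < t \<Longrightarrow> deriv m t = \<eta> - c0 * m t + drift t"
  by (rule DERIV_imp_deriv[OF m_has_derivative])

theorem continuous_on_deriv_m: "continuous_on {0<..} (deriv m)"
proof -
  have "isCont (\<lambda>t. \<eta> - c0 * m t + drift t) s" if "0 < s" for s
  proof -
    have "continuous_on {0..s + 1} (\<lambda>t. \<eta> - c0 * m t + drift t)"
      by (intro continuous_intros continuous_on_m continuous_on_drift)
    moreover have "s \<in> interior {0..s + 1}" using that by simp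
    ultimately show ?thesis by (rule continuous_on_interior)
  qed
  then have "continuous_on {0<..} (\<lambda>t. \<eta> - c0 * m t + drift t)"
    by (intro continuous_at_imp_continuous_on) auto
  then show ?thesis by (rule continuous_on_eq) (simp add: deriv_m)
qed

lemma has_integral_zeta_convolution:
  assumes t: "0 < t"
  shows "((\<lambda>u. zeta c0 f r (t - u) * m u) has_integral
    integral {0..t} (\<lambda>s. m s * tail (t - s)) - c0 * integral {0..t} m) {0..t}"
proof -
  have "(\<lambda>s. m s * tail (t - s)) integrable_on {0..t}"
    by (rule integrable_eq[OF delay_weight_integrable_on[of 0 t t]])
      (use r_pos t in \<open>auto simp: delay_weight_eq_tail tail_nonpos\<close>)
  moreover have "m integrable_on {0..t}" using r_pos by (intro m_integrable_on) simp
  ultimately have "((\<lambda>s. m s * tail (t - s) - c0 * m s) has_integral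
      integral {0..t} (\<lambda>s. m s * tail (t - s)) - c0 * integral {0..t} m) {0..t}"
    by (intro has_integral_diff has_integral_mult_right integrable_integral)
  then show ?thesis
    by (rule has_integral_spike[OF negligible_sing[of t], rotated])
      (auto simp: zeta_eq algebra_simps)
qed

lemma renewal_h_eq:
  assumes t: "0 < t" and nz: "zeta c0 f r r \<noteq> 0"
  shows "renewal_h \<eta> c0 f r m t = m 0 + \<eta> * t + integral {- r..0} (\<lambda>s. m s * delay_weight f t s)"
proof -
  define k where "k = \<eta> / zeta c0 f r r"
  let ?\<zeta> = "\<lambda>x. tail x - c0"
  have \<zeta>: "?\<zeta> integrable_on {c..d}" if "0 \<le> c" for c d
    using that
    by (intro integrable_continuous_real continuous_intros
        continuous_on_subset[OF continuous_on_tail]) auto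
  have const: "?\<zeta> x = ?\<zeta> r" if "r \<le> x" for x using tail_const[OF that] by simp
  note shift = integral_shift_eventually_const[of ?\<zeta>, OF \<zeta> const less_imp_le[OF r_pos]
    less_imp_le[OF t]]
  have "((\<lambda>s. m s * delay_weight f t s)
      has_integral integral {- r..0} (\<lambda>s. m s * delay_weight f t s)) {- r..0}"
    using t by (intro integrable_integral delay_weight_integrable_on) simp_all
  then have past: "((\<lambda>u. m (- u) * delay_weight f t (- u)) has_integral
      integral {- r..0} (\<lambda>s. m s * delay_weight f t s)) {0..r}"
    using has_integral_reflect_real[of "\<lambda>s. m s * delay_weight f t s" _ 0 "- r"] by simp
  have "((\<lambda>u. m (- u) * delay_weight f t (- u) + k * (?\<zeta> (t + u) - ?\<zeta> u)) has_integral
      integral {- r..0} (\<lambda>s. m s * delay_weight f t s)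
        + k * integral {0..r} (\<lambda>u. ?\<zeta> (t + u) - ?\<zeta> u)) {0..r}"
    by (intro has_integral_add past has_integral_mult_right integrable_integral shift(1))
  then have "((\<lambda>u. (zeta c0 f r (t + u) - zeta c0 f r u) * (m (- u) + k)) has_integral
      integral {- r..0} (\<lambda>s. m s * delay_weight f t s)
        + k * integral {0..r} (\<lambda>u. ?\<zeta> (t + u) - ?\<zeta> u)) {0..r}"
    by (rule has_integral_spike[OF negligible_sing[of 0], rotated])
      (use t in \<open>auto simp: zeta_eq delay_weight_eq_tail algebra_simps\<close>)
  moreover have "integral {0..t} (zeta c0 f r) = integral {0..t} ?\<zeta>"
    by (rule integral_spike[OF negligible_sing[of 0]]) (auto simp: zeta_eq)
  ultimately have "renewal_h \<eta> c0 f r m t = m 0 + integral {- r..0} (\<lambda>s. m s * delay_weight f t s)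
      + k * (integral {0..t} ?\<zeta> + integral {0..r} (\<lambda>u. ?\<zeta> (t + u) - ?\<zeta> u))"
    unfolding renewal_h_def k_def[symmetric] by (simp add: integral_unique distrib_left)
  also have "integral {0..t} ?\<zeta> + integral {0..r} (\<lambda>u. ?\<zeta> (t + u) - ?\<zeta> u) = t * zeta c0 f r r"
    using shift(2) by (simp only: zeta_eq[OF r_pos])
  also have "k * (t * zeta c0 f r r) = \<eta> * t" using nz by (simp add: k_def)
  finally show ?thesis by simp
qed

theorem renewal_equation:
  assumes t: "0 < t" and nz: "zeta c0 f r r \<noteq> 0"
  shows "(\<lambda>u. zeta c0 f r (t - u) * m u) integrable_on {0..t}"
    and "m t = integral {0..t} (\<lambda>u. zeta c0 f r (t - u) * m u) + renewal_h \<eta> c0 f r m t"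
proof -
  show "(\<lambda>u. zeta c0 f r (t - u) * m u) integrable_on {0..t}"
    using has_integral_zeta_convolution[OF t] by blast
  show "m t = integral {0..t} (\<lambda>u. zeta c0 f r (t - u) * m u) + renewal_h \<eta> c0 f r m t"
    using integrated_equation[of t] integral_drift_split[of t] t
    by (simp add: integral_unique[OF has_integral_zeta_convolution[OF t]] renewal_h_eq[OF t nz])
qed

end

section \<open>The moment equation\<close>

lemma integral_eq_integral_time:
  fixes x :: "real \<Rightarrow> real"
  assumes x: "integrable (restrict_space lborel {a<..}) (\<lambda>s. indicator {..t} s * x s)"
    and c: "a \<le> c" and d: "d \<le> t"
  shows "integral {c..d} x
      = (\<integral>s. (indicator {..t} s * x s) * indicator {c<..d} s \<partial>restrict_space lborel {a<..})"
proof -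
  let ?y = "\<lambda>s. indicator {..t} s * x s * indicator {c<..d} s"
  have "integrable (restrict_space lborel {a<..}) ?y"
    using x by (rule integrable_mult_bounded[where B=1])
      (auto simp: indicator_def intro!: measurable_restrict_space1)
  then have int: "integrable lborel (\<lambda>s. indicator {a<..} s *\<^sub>R ?y s)"
    by (simp add: integrable_restrict_space)
  have "(\<integral>s. ?y s \<partial>restrict_space lborel {a<..}) = (\<integral>s. indicator {a<..} s *\<^sub>R ?y s \<partial>lborel)"
    by (rule integral_restrict_space) simp
  with has_integral_integral_lborel[OF int]
  have "((\<lambda>s. indicator {a<..} s *\<^sub>R ?y s)
      has_integral (\<integral>s. ?y s \<partial>restrict_space lborel {a<..})) UNIV"
    by simp
  then have "((\<lambda>s. if s \<in> {c..d} then x s else 0)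
      has_integral (\<integral>s. ?y s \<partial>restrict_space lborel {a<..})) UNIV"
    by (rule has_integral_spike[OF negligible_sing[of c], rotated])
      (use c d in \<open>auto simp: indicator_def\<close>)
  then show ?thesis
    unfolding has_integral_restrict_UNIV by (rule integral_unique)
qed

lemma dS_integral_eq_integral_jump_times:
  assumes x: "integrable (count_space (jump_times l {a<..}))
      (\<lambda>s. indicator {..t} s * left_lim x s * (jump l s)\<^sup>2)"
    and c: "a \<le> c" and d: "d \<le> t"
  shows "dS_integral x l c d
    = (\<integral>s. (indicator {..t} s * left_lim x s * (jump l s)\<^sup>2) * indicator {c<..d} s
        \<partial>count_space (jump_times l {a<..}))"
proof -
  let ?f = "\<lambda>s. left_lim x s * (jump l s)\<^sup>2" and ?J = "jump_times l {a<..}"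
  have eq: "(indicator {..t} s * left_lim x s * (jump l s)\<^sup>2) * indicator {c<..d} s
      = indicator (?J \<inter> {c<..d}) s *\<^sub>R ?f s" if "s \<in> ?J" for s
    using that d by (auto simp: indicator_def)
  have "integrable (count_space ?J)
      (\<lambda>s. (indicator {..t} s * left_lim x s * (jump l s)\<^sup>2) * indicator {c<..d} s)"
    using x by (rule integrable_mult_bounded[where B=1]) (auto simp: indicator_def)
  then have "integrable (count_space ?J) (\<lambda>s. indicator (?J \<inter> {c<..d}) s *\<^sub>R ?f s)"
    by (rule Bochner_Integration.integrable_cong[OF refl, THEN iffD1, rotated]) (simp add: eq)
  then have "Infinite_Set_Sum.abs_summable_on ?f (?J \<inter> {c<..d})"
    using abs_summable_on_altdef'[of "?J \<inter> {c<..d}" ?J ?f] by (simp add: set_integrable_def)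
  then have "(\<Sum>\<^sub>\<infinity>s\<in>?J \<inter> {c<..d}. ?f s) = infsetsum ?f (?J \<inter> {c<..d})"
    by (rule infsetsum_infsum[symmetric])
  moreover have "dS_integral x l c d = (\<Sum>\<^sub>\<infinity>s\<in>?J \<inter> {c<..d}. ?f s)"
    unfolding dS_integral_def using c by (intro infsum_cong_neutral) (auto simp: jump_times_def)
  moreover have "infsetsum ?f (?J \<inter> {c<..d})
      = (\<integral>s. indicator (?J \<inter> {c<..d}) s *\<^sub>R ?f s \<partial>count_space ?J)"
    using infsetsum_altdef'[of "?J \<inter> {c<..d}" ?J ?f] by (simp add: set_lebesgue_integral_def)
  moreover have "\<dots>
      = (\<integral>s. (indicator {..t} s * left_lim x s * (jump l s)\<^sup>2) * indicator {c<..d} s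
          \<partial>count_space ?J)"
    by (intro Bochner_Integration.integral_cong refl) (simp only: space_count_space eq)
  ultimately show ?thesis by simp
qed

lemma (in prob_space) nn_integral_abs_le_sup_square:
  fixes X :: "'t \<Rightarrow> 'a \<Rightarrow> real"
  assumes [measurable]: "X s \<in> borel_measurable M" and s: "s \<in> I"
  shows "(\<integral>\<^sup>+\<omega>. ennreal \<bar>X s \<omega>\<bar> \<partial>M) \<le> 1 + (\<integral>\<^sup>+\<omega>. (SUP s\<in>I. ennreal ((X s \<omega>)\<^sup>2)) \<partial>M)"
proof -
  have "ennreal \<bar>z\<bar> \<le> 1 + ennreal (z\<^sup>2)" for z :: real
  proof -
    have "\<bar>z\<bar> \<le> 1 + z\<^sup>2" using zero_le_power2[of "\<bar>z\<bar> - 1"] by (simp add: power2_diff)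
    then have "ennreal \<bar>z\<bar> \<le> ennreal (1 + z\<^sup>2)" by (rule ennreal_leI)
    then show ?thesis by (simp add: ennreal_plus)
  qed
  then have "(\<integral>\<^sup>+\<omega>. ennreal \<bar>X s \<omega>\<bar> \<partial>M) \<le> (\<integral>\<^sup>+\<omega>. 1 + ennreal ((X s \<omega>)\<^sup>2) \<partial>M)"
    by (intro nn_integral_mono)
  also have "\<dots> = 1 + (\<integral>\<^sup>+\<omega>. ennreal ((X s \<omega>)\<^sup>2) \<partial>M)"
    by (subst nn_integral_add) (auto simp: emeasure_space_1)
  also have "\<dots> \<le> 1 + (\<integral>\<^sup>+\<omega>. (SUP s\<in>I. ennreal ((X s \<omega>)\<^sup>2)) \<partial>M)"
    using s by (intro add_left_mono nn_integral_mono SUP_upper)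
  finally show ?thesis .
qed

lemma natural_filtration_subset:
  assumes "\<And>t. a \<le> t \<Longrightarrow> L t \<in> borel_measurable M"
  shows "natural_filtration M a L t \<subseteq> sets M"
  unfolding natural_filtration_def
proof (rule sets.sigma_sets_subset, safe)
  fix u :: real and B :: "real set" assume "u \<in> {a..t}" "B \<in> sets borel"
  then have [measurable]: "L u \<in> borel_measurable M" "B \<in> sets borel" using assms[of u] by auto
  show "{\<omega> \<in> space M. L u \<omega> \<in> B} \<in> sets M" by measurable
qed

locale cdgarch_solution = levy_setting M "- r" F L
  for M :: "'a measure" and F :: "real \<Rightarrow> 'a set set" and L :: "real \<Rightarrow> 'a \<Rightarrow> real" and r :: real +
  fixes p q \<eta> c\<mu> c\<nu> :: real and f\<mu> f\<nu> :: "real \<Rightarrow> real" and \<Phi> X :: "real \<Rightarrow> 'a \<Rightarrow> real"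
  assumes r_eq: "r = max p q" and r_pos: "0 < r"
    and f\<mu>: "delay_density p f\<mu>" and f\<nu>: "delay_density q f\<nu>"
    and \<Phi>_adapted: "adapted_on M {- r..0} (natural_filtration M (- r) L) \<Phi>"
    and solution: "cdgarch_strong_solution M F p q \<eta> c\<mu> c\<nu> f\<mu> f\<nu> L \<Phi> X"
begin

abbreviation \<kappa>2 :: real where
  "\<kappa>2 \<equiv> (\<integral>z. z\<^sup>2 \<partial>\<Lambda>)"

abbreviation c0 :: real where
  "c0 \<equiv> c\<mu> - \<kappa>2 * c\<nu>"

abbreviation f :: "real \<Rightarrow> real" where
  "f \<equiv> \<lambda>u. f\<mu> u + \<kappa>2 * f\<nu> u"

definition mean :: "real \<Rightarrow> real" where
  "mean t = expectation (X t)"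

lemma X_adapted: "adapted_on M {- r..} F X"
  and X_cadlag: "\<And>\<omega>. \<omega> \<in> space M \<Longrightarrow> cadlag_from (- r) (\<lambda>t. X t \<omega>)"
  and X_square: "\<And>t. 0 \<le> t \<Longrightarrow> (\<integral>\<^sup>+\<omega>. (SUP s\<in>{- r..t}. ennreal ((X s \<omega>)\<^sup>2)) \<partial>M) < \<infinity>"
  and X_initial: "AE \<omega> in M. \<forall>u\<in>{- r..0}. X u \<omega> = \<Phi> u \<omega>"
  and X_equation: "\<And>t. 0 \<le> t \<Longrightarrow> AE \<omega> in M. X t \<omega> = cdgarch_rhs p q \<eta> c\<mu> c\<nu> f\<mu> f\<nu> L \<Phi> X t \<omega>"
  using solution unfolding cdgarch_strong_solution_def r_eq[symmetric] by blast+

lemma X_measurable: "- r \<le> t \<Longrightarrow> X t \<in> borel_measurable M"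
  by (rule adapted_measurable[OF X_adapted])

lemma f\<mu>_density: "delay_density r f\<mu>" and f\<nu>_density: "delay_density r f\<nu>"
  by (auto intro: delay_density_mono f\<mu> f\<nu> simp: r_eq)

lemma f_density: "delay_density r f"
  by (rule delay_density_add_cmult[OF f\<mu>_density f\<nu>_density])

lemma X_moment_bounded:
  obtains C where "\<And>s. s \<in> {- r..t} \<Longrightarrow> (\<integral>\<^sup>+\<omega>. ennreal \<bar>X s \<omega>\<bar> \<partial>M) \<le> ennreal C"
proof -
  let ?K = "1 + (\<integral>\<^sup>+\<omega>. (SUP s\<in>{- r..max 0 t}. ennreal ((X s \<omega>)\<^sup>2)) \<partial>M)"
  have "?K = ennreal (enn2real ?K)" using X_square[of "max 0 t"] by simp
  moreover have "(\<integral>\<^sup>+\<omega>. ennreal \<bar>X s \<omega>\<bar> \<partial>M) \<le> ?K" if "s \<in> {- r..t}" for s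
    using that by (intro nn_integral_abs_le_sup_square X_measurable) auto
  ultimately show thesis using that[of "enn2real ?K"] by simp
qed

lemma X_integrable:
  assumes "- r \<le> t"
  shows "integrable M (X t)"
proof -
  obtain C where "(\<integral>\<^sup>+\<omega>. ennreal \<bar>X t \<omega>\<bar> \<partial>M) \<le> ennreal C"
    using X_moment_bounded[of t] assms by auto
  then show ?thesis
    using X_measurable[OF assms] by (intro integrableI_bounded) (auto intro: le_less_trans)
qed

lemma mean_initial:
  assumes u: "u \<in> {- r..0}"
  shows "mean u = expectation (\<Phi> u)"
  unfolding mean_def
proof (rule integral_cong_AE)
  show "X u \<in> borel_measurable M" using u by (intro X_measurable) auto
  show "\<Phi> u \<in> borel_measurable M"
    using \<Phi>_adapted u natural_filtration_subset[of "- r" L M u] L_measurable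
    unfolding adapted_on_def measurable_def by (auto simp: vimage_def Int_def conj_commute)
  show "AE \<omega> in M. X u \<omega> = \<Phi> u \<omega>" using X_initial by eventually_elim (use u in auto)
qed

context
  fixes h :: "real \<Rightarrow> real" and t B :: real
  assumes h [measurable]: "h \<in> borel_measurable borel" and h_bounded: "\<And>s. \<bar>h s\<bar> \<le> B"
    and h_zero: "\<forall>s>t. h s = 0"
begin

lemma weighted_X_integrable: "integrable (time \<Otimes>\<^sub>M M) (\<lambda>(s, \<omega>). h s * X s \<omega>)"
proof (rule integrableI_bounded)
  note [measurable] = process_measurable_pair[OF X_adapted X_cadlag]
  have [measurable]: "h \<in> borel_measurable time" by (simp add: measurable_restrict_space1)
  have "(\<lambda>p. h (fst p) * (case p of (s, \<omega>) \<Rightarrow> X s \<omega>)) \<in> borel_measurable (time \<Otimes>\<^sub>M M)" by measurable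
  then show meas [measurable]: "(\<lambda>(s, \<omega>). h s * X s \<omega>) \<in> borel_measurable (time \<Otimes>\<^sub>M M)"
    by (simp add: case_prod_beta')
  obtain C where C: "\<And>s. s \<in> {- r..t} \<Longrightarrow> (\<integral>\<^sup>+\<omega>. ennreal \<bar>X s \<omega>\<bar> \<partial>M) \<le> ennreal C"
    using X_moment_bounded by blast
  have "(\<integral>\<^sup>+p. ennreal (norm (case p of (s, \<omega>) \<Rightarrow> h s * X s \<omega>)) \<partial>(time \<Otimes>\<^sub>M M))
      = (\<integral>\<^sup>+s. \<integral>\<^sup>+\<omega>. ennreal \<bar>h s\<bar> * ennreal \<bar>X s \<omega>\<bar> \<partial>M \<partial>time)"
    by (subst nn_integral_fst[symmetric]) (simp_all add: abs_mult ennreal_mult)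
  also have "\<dots> \<le> (\<integral>\<^sup>+s. (ennreal B * ennreal C) * indicator {- r<..t} s \<partial>time)"
  proof (rule nn_integral_mono)
    fix s assume "s \<in> space time"
    then have s: "- r < s" by (simp add: space_restrict_space)
    have "(\<integral>\<^sup>+\<omega>. ennreal \<bar>h s\<bar> * ennreal \<bar>X s \<omega>\<bar> \<partial>M) = ennreal \<bar>h s\<bar> * (\<integral>\<^sup>+\<omega>. ennreal \<bar>X s \<omega>\<bar> \<partial>M)"
      using X_measurable[of s] s by (intro nn_integral_cmult) simp
    also have "\<dots> \<le> (ennreal B * ennreal C) * indicator {- r<..t} s"
    proof (cases "s \<le> t")
      case True
      then show ?thesis using s C[of s] h_bounded[of s] by (auto intro!: mult_mono ennreal_leI)
    qed (simp add: h_zero)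
    finally show "(\<integral>\<^sup>+\<omega>. ennreal \<bar>h s\<bar> * ennreal \<bar>X s \<omega>\<bar> \<partial>M)
        \<le> (ennreal B * ennreal C) * indicator {- r<..t} s" .
  qed
  also have "\<dots> = (ennreal B * ennreal C) * emeasure time {- r<..t}"
    by (rule nn_integral_cmult_indicator[OF Ioc_sets_time[OF order_refl]])
  also have "\<dots> < \<infinity>" by (simp add: emeasure_time ennreal_mult_less_top)
  finally show "(\<integral>\<^sup>+p. ennreal (norm (case p of (s, \<omega>) \<Rightarrow> h s * X s \<omega>)) \<partial>(time \<Otimes>\<^sub>M M)) < \<infinity>" .
qed

lemma weighted_X_integral:
  "(\<integral>p. (case p of (s, \<omega>) \<Rightarrow> h s * X s \<omega>) \<partial>(time \<Otimes>\<^sub>M M)) = (\<integral>s. h s * mean s \<partial>time)"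
  using time_pair.integral_fst[OF weighted_X_integrable] by (simp add: mean_def)

lemma weighted_mean_integrable: "integrable time (\<lambda>s. h s * mean s)"
  using time_pair.integrable_fst[OF weighted_X_integrable] by (simp add: mean_def)

lemma AE_integrable_time_integral: "AE \<omega> in M. integrable time (\<lambda>s. h s * X s \<omega>)"
  by (rule time_pair.AE_integrable_snd[OF weighted_X_integrable])

lemma integrable_time_integral: "integrable M (\<lambda>\<omega>. \<integral>s. h s * X s \<omega> \<partial>time)"
  by (rule time_pair.integrable_snd[OF weighted_X_integrable])

lemma expectation_time_integral:
  "expectation (\<lambda>\<omega>. \<integral>s. h s * X s \<omega> \<partial>time) = (\<integral>s. h s * mean s \<partial>time)"
  using time_pair.integral_snd[OF weighted_X_integrable] weighted_X_integral by simp

lemma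
  shows weighted_left_lim_predictable:
      "(\<lambda>(s, \<omega>). h s * left_lim (\<lambda>t. X t \<omega>) s) \<in> borel_measurable predictable"
    and weighted_left_lim_integrable:
      "integrable (time \<Otimes>\<^sub>M M) (\<lambda>(s, \<omega>). h s * left_lim (\<lambda>t. X t \<omega>) s)"
    and weighted_left_lim_integral:
      "(\<integral>p. (case p of (s, \<omega>) \<Rightarrow> h s * left_lim (\<lambda>t. X t \<omega>) s) \<partial>(time \<Otimes>\<^sub>M M))
          = (\<integral>s. h s * mean s \<partial>time)"
proof -
  note [measurable] = left_lim_predictable[OF X_adapted X_cadlag]
  have "(\<lambda>p. h (fst p) * (case p of (s, \<omega>) \<Rightarrow> left_lim (\<lambda>t. X t \<omega>) s))
      \<in> borel_measurable predictable"
    by measurable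
  then show predictable: "(\<lambda>(s, \<omega>). h s * left_lim (\<lambda>t. X t \<omega>) s) \<in> borel_measurable predictable"
    by (simp add: case_prod_beta')
  have AE: "AE p in time \<Otimes>\<^sub>M M. (case p of (s, \<omega>) \<Rightarrow> h s * left_lim (\<lambda>t. X t \<omega>) s)
      = (case p of (s, \<omega>) \<Rightarrow> h s * X s \<omega>)"
    using AE_left_lim_process_eq[OF X_adapted X_cadlag] by (auto elim!: eventually_mono)
  note meas = measurable_predictable_pair[OF predictable]
    borel_measurable_integrable[OF weighted_X_integrable]
  show "integrable (time \<Otimes>\<^sub>M M) (\<lambda>(s, \<omega>). h s * left_lim (\<lambda>t. X t \<omega>) s)"
    using integrable_cong_AE[OF meas AE] weighted_X_integrable by simp
  show "(\<integral>p. (case p of (s, \<omega>) \<Rightarrow> h s * left_lim (\<lambda>t. X t \<omega>) s) \<partial>(time \<Otimes>\<^sub>M M))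
      = (\<integral>s. h s * mean s \<partial>time)"
    using integral_cong_AE[OF meas AE] weighted_X_integral by simp
qed

lemma AE_integrable_jump_integral:
    "AE \<omega> in M. integrable (jump_counting \<omega>)
      (\<lambda>s. h s * left_lim (\<lambda>t. X t \<omega>) s * (jump (path \<omega>) s)\<^sup>2)"
  and integrable_jump_integral:
    "integrable M (\<lambda>\<omega>. \<integral>s. h s * left_lim (\<lambda>t. X t \<omega>) s * (jump (path \<omega>) s)\<^sup>2
      \<partial>jump_counting \<omega>)"
  and expectation_jump_integral:
    "expectation (\<lambda>\<omega>. \<integral>s. h s * left_lim (\<lambda>t. X t \<omega>) s * (jump (path \<omega>) s)\<^sup>2
      \<partial>jump_counting \<omega>) = \<kappa>2 * (\<integral>s. h s * mean s \<partial>time)"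
  using AE_integrable_compensation[OF weighted_left_lim_predictable weighted_left_lim_integrable]
    integrable_compensation[OF weighted_left_lim_predictable weighted_left_lim_integrable]
    compensation_formula[OF weighted_left_lim_predictable weighted_left_lim_integrable]
  by (simp_all only: prod.case weighted_left_lim_integral)

end

lemma mean_set_integrable: "set_integrable lborel {- r..T} mean"
proof -
  have "integrable time (\<lambda>s. indicator {..T} s * mean s)"
    by (rule weighted_mean_integrable[where B=1 and t=T]) (auto simp: indicator_def)
  then have "integrable lborel (\<lambda>s. indicator {- r<..} s *\<^sub>R (indicator {..T} s * mean s))"
    by (simp add: integrable_restrict_space)
  moreover have "integrable lborel (\<lambda>s. indicator {- r} s *\<^sub>R (indicator {..T} s * mean s))"
  proof -
    have "(\<lambda>s. indicator {- r} s *\<^sub>R (indicator {..T} s * mean s))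
        = (\<lambda>s. indicator {- r} s *\<^sub>R (indicator {..T} (- r) * mean (- r)))"
      by (auto simp: indicator_def fun_eq_iff)
    then show ?thesis by simp
  qed
  ultimately have "integrable lborel (\<lambda>s. indicator {- r<..} s *\<^sub>R (indicator {..T} s * mean s)
      + indicator {- r} s *\<^sub>R (indicator {..T} s * mean s))"
    by simp
  also have "(\<lambda>s. indicator {- r<..} s *\<^sub>R (indicator {..T} s * mean s)
      + indicator {- r} s *\<^sub>R (indicator {..T} s * mean s))
      = (\<lambda>s. indicator {- r..T} s *\<^sub>R mean s)"
    by (auto simp: indicator_def fun_eq_iff)
  finally show ?thesis by (simp add: set_integrable_def)
qed

sublocale delay_system mean f r
  by (intro delay_system.intro r_pos f_density mean_set_integrable)

lemma integral_time_delay_measure: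
  assumes x: "integrable time (\<lambda>s. indicator {..t} s * x s)" and t: "0 \<le> t"
    and g: "delay_density q' g" "q' \<le> r"
  shows "integral {- q'..0} (\<lambda>u. integral {u..t + u} x * g u) + c * integral {0..t} x
    = (\<integral>s. delay_measure_weight g c t s * x s \<partial>time)"
proof -
  let ?y = "\<lambda>s. indicator {..t} s * x s"
  have "integral {- q'..0} (\<lambda>u. integral {u..t + u} x * g u)
      = integral {- q'..0} (\<lambda>u. (\<integral>s. ?y s * indicator {u<..t + u} s \<partial>time) * g u)"
    using g(2) by (intro integral_cong) (simp add: integral_eq_integral_time[OF x])
  moreover have "integral {0..t} x = (\<integral>s. ?y s * indicator {0<..t} s \<partial>time)"
    using r_pos by (simp add: integral_eq_integral_time[OF x])
  moreover have "(\<integral>s. ?y s * delay_measure_weight g c t s \<partial>time)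
      = (\<integral>s. delay_measure_weight g c t s * x s \<partial>time)"
    using delay_measure_weight_zero[OF g(1), of t c]
    by (intro Bochner_Integration.integral_cong) (auto simp: indicator_def)
  ultimately show ?thesis
    using integral_delay_measure[OF time.sigma_finite_measure_axioms _ x g(1), of t c]
    by (simp add: measurable_restrict_space1)
qed

lemma dS_integral_delay_measure:
  fixes x l :: "real \<Rightarrow> real"
  defines "J \<equiv> jump_times l {- r<..}"
  assumes l: "cadlag_from (- r) l" and t: "0 \<le> t"
    and x: "integrable (count_space J) (\<lambda>s. indicator {..t} s * left_lim x s * (jump l s)\<^sup>2)"
    and g: "delay_density q' g" "q' \<le> r"
  shows "integral {- q'..0} (\<lambda>u. dS_integral x l u (t + u) * g u) + c * dS_integral x l 0 t
    = (\<integral>s. delay_measure_weight g c t s * left_lim x s * (jump l s)\<^sup>2 \<partial>count_space J)"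
proof -
  let ?y = "\<lambda>s. indicator {..t} s * left_lim x s * (jump l s)\<^sup>2"
  have J: "sigma_finite_measure (count_space J)"
    unfolding J_def
    by (rule sigma_finite_measure_count_space_countable[OF countable_jump_times[OF l]])
  note dS = dS_integral_eq_integral_jump_times[OF x[unfolded J_def], folded J_def]
  have "integral {- q'..0} (\<lambda>u. dS_integral x l u (t + u) * g u)
      = integral {- q'..0} (\<lambda>u. (\<integral>s. ?y s * indicator {u<..t + u} s \<partial>count_space J) * g u)"
    using g(2) by (intro integral_cong) (simp add: dS)
  moreover have "dS_integral x l 0 t = (\<integral>s. ?y s * indicator {0<..t} s \<partial>count_space J)"
    using r_pos by (simp add: dS)
  moreover have "(\<integral>s. ?y s * delay_measure_weight g c t s \<partial>count_space J)
      = (\<integral>s. delay_measure_weight g c t s * left_lim x s * (jump l s)\<^sup>2 \<partial>count_space J)"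
    using delay_measure_weight_zero[OF g(1), of t c]
    by (intro Bochner_Integration.integral_cong) (auto simp: indicator_def)
  ultimately show ?thesis
    using integral_delay_measure[OF J _ x g(1), of t c] by simp
qed

lemma AE_X_eq_weighted_integrals:
  assumes t: "0 \<le> t"
  shows "AE \<omega> in M. X t \<omega> = X 0 \<omega> + \<eta> * t
    + (\<integral>s. delay_measure_weight f\<mu> (- c\<mu>) t s * X s \<omega> \<partial>time)
    + (\<integral>s. delay_measure_weight f\<nu> c\<nu> t s * left_lim (\<lambda>t. X t \<omega>) s * (jump (path \<omega>) s)\<^sup>2
        \<partial>jump_counting \<omega>)"
proof -
  have "AE \<omega> in M. integrable time (\<lambda>s. indicator {..t} s * X s \<omega>)"
    by (rule AE_integrable_time_integral[where t=t and B=1]) (auto simp: indicator_def)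
  moreover have "AE \<omega> in M. integrable (jump_counting \<omega>)
      (\<lambda>s. indicator {..t} s * left_lim (\<lambda>t. X t \<omega>) s * (jump (path \<omega>) s)\<^sup>2)"
    by (rule AE_integrable_jump_integral[where t=t and B=1]) (auto simp: indicator_def)
  ultimately show ?thesis
    using X_equation[OF t] X_initial AE_space
  proof eventually_elim
    case (elim \<omega>)
    have "theta \<eta> \<Phi> t \<omega> = X 0 \<omega> + \<eta> * t"
      using elim(4) t r_pos by (simp add: theta_def ext_init_def)
    moreover have "p \<le> r" "q \<le> r" by (simp_all add: r_eq)
    ultimately show ?case
      using elim(3) integral_time_delay_measure[OF elim(1) t f\<mu>, of "- c\<mu>"]
        dS_integral_delay_measure[OF L_cadlag[OF elim(5)] t elim(2) f\<nu>, of c\<nu>]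
      unfolding cdgarch_rhs_def by simp
  qed
qed

lemma mean_eq_weighted_integral:
  assumes t: "0 \<le> t"
  shows "mean t = mean 0 + \<eta> * t + (\<integral>s. delay_measure_weight f (- c0) t s * mean s \<partial>time)"
proof -
  obtain B where B: "\<And>s. \<bar>delay_measure_weight f\<mu> (- c\<mu>) t s\<bar> \<le> B"
    using delay_measure_weight_bounded[OF f\<mu>] by blast
  obtain C where C: "\<And>s. \<bar>delay_measure_weight f\<nu> c\<nu> t s\<bar> \<le> C"
    using delay_measure_weight_bounded[OF f\<nu>] by blast
  note \<mu> = delay_measure_weight_measurable[OF f\<mu>] B delay_measure_weight_zero[OF f\<mu>]
  note \<nu> = delay_measure_weight_measurable[OF f\<nu>] C delay_measure_weight_zero[OF f\<nu>]
  let ?I = "\<lambda>\<omega>. \<integral>s. delay_measure_weight f\<mu> (- c\<mu>) t s * X s \<omega> \<partial>time"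
    and ?S = "\<lambda>\<omega>. \<integral>s. delay_measure_weight f\<nu> c\<nu> t s * left_lim (\<lambda>t. X t \<omega>) s * (jump (path \<omega>) s)\<^sup>2
      \<partial>jump_counting \<omega>"
  have r: "- r \<le> 0" "- r \<le> t" using t r_pos by auto
  note int = X_integrable[OF r(1)] integrable_time_integral[OF \<mu>] integrable_jump_integral[OF \<nu>]
  have "mean t = expectation (\<lambda>\<omega>. X 0 \<omega> + \<eta> * t + ?I \<omega> + ?S \<omega>)"
    unfolding mean_def
    by (rule integral_cong_AE[OF X_measurable[OF r(2)] _ AE_X_eq_weighted_integrals[OF t]])
      (use int in \<open>simp add: borel_measurable_integrable\<close>)
  also have "\<dots> = mean 0 + \<eta> * t + expectation ?I + expectation ?S"
    using int by (simp add: mean_def prob_space)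
  also have "expectation ?I = (\<integral>s. delay_measure_weight f\<mu> (- c\<mu>) t s * mean s \<partial>time)"
    by (rule expectation_time_integral[OF \<mu>])
  also have "expectation ?S = (\<integral>s. \<kappa>2 * (delay_measure_weight f\<nu> c\<nu> t s * mean s) \<partial>time)"
    by (simp only: expectation_jump_integral[OF \<nu>] integral_mult_right_zero)
  also have "mean 0 + \<eta> * t + (\<integral>s. delay_measure_weight f\<mu> (- c\<mu>) t s * mean s \<partial>time) + \<dots>
      = mean 0 + \<eta> * t + (\<integral>s. delay_measure_weight f\<mu> (- c\<mu>) t s * mean s
        + \<kappa>2 * (delay_measure_weight f\<nu> c\<nu> t s * mean s) \<partial>time)"
    using weighted_mean_integrable[OF \<mu>] weighted_mean_integrable[OF \<nu>] by simp
  also have "(\<lambda>s. delay_measure_weight f\<mu> (- c\<mu>) t s * mean s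
      + \<kappa>2 * (delay_measure_weight f\<nu> c\<nu> t s * mean s))
      = (\<lambda>s. delay_measure_weight f (- c0) t s * mean s)"
    using delay_measure_weight_add_cmult[OF f\<mu>_density f\<nu>_density, of "- c\<mu>" t _ \<kappa>2 c\<nu>, symmetric]
    by (simp add: algebra_simps)
  finally show ?thesis .
qed

lemma integral_time_mult_delay_weight:
  assumes t: "0 \<le> t"
  shows "(\<integral>s. delay_weight f t s * mean s \<partial>time) = integral {0..t} drift"
proof -
  note [measurable] = delay_weight_measurable[OF f_density]
  obtain B where B: "\<And>s. \<bar>delay_weight f t s\<bar> \<le> B" using delay_weight_bounded[OF f_density] by blast
  have "integrable time (\<lambda>s. indicator {..t} s * mean s)"
    by (rule weighted_mean_integrable[where t=t and B=1]) (auto simp: indicator_def)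
  then have int: "integrable time (\<lambda>s. indicator {..t} s * mean s * delay_weight f t s)"
    by (rule integrable_mult_bounded[OF _ _ B]) (simp add: measurable_restrict_space1)
  have "(\<integral>s. delay_weight f t s * mean s \<partial>time)
      = (\<integral>s. indicator {..t} s * mean s * delay_weight f t s \<partial>time)"
    using delay_weight_zero[OF f_density]
    by (intro Bochner_Integration.integral_cong) (auto simp: indicator_def)
  also have "\<dots>
      = (\<integral>s. indicator {- r<..} s *\<^sub>R (indicator {..t} s * mean s * delay_weight f t s) \<partial>lborel)"
    by (rule integral_restrict_space) simp
  also have "\<dots> = (\<integral>s. m_upto t s * delay_weight f t s \<partial>lborel)"
  proof (rule integral_cong_AE)
    show "(\<lambda>s. indicator {- r<..} s *\<^sub>R (indicator {..t} s * mean s * delay_weight f t s))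
        \<in> borel_measurable lborel"
      using int by (simp add: integrable_restrict_space borel_measurable_integrable)
    show "AE s in lborel. indicator {- r<..} s *\<^sub>R (indicator {..t} s * mean s * delay_weight f t s)
        = m_upto t s * delay_weight f t s"
      using AE_lborel_singleton[of "- r"]
      by eventually_elim (auto simp: m_upto_def indicator_def)
  qed measurable
  also have "\<dots> = integral {0..t} drift" by (rule integral_drift[OF t, symmetric])
  finally show ?thesis .
qed

sublocale delay_equation mean f r \<eta> c0
proof
  fix t :: real assume t: "0 \<le> t"
  have point: "integrable time (\<lambda>s. indicator {0<..t} s * mean s)"
    by (rule weighted_mean_integrable[where t=t and B=1]) (auto simp: indicator_def)
  obtain B where "\<And>s. \<bar>delay_weight f t s\<bar> \<le> B" using delay_weight_bounded[OF f_density] by blast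
  then have weight: "integrable time (\<lambda>s. delay_weight f t s * mean s)"
    using delay_weight_measurable[OF f_density] delay_weight_zero[OF f_density]
    by (intro weighted_mean_integrable[where t=t and B=B]) auto
  have "integral {0..t} mean = (\<integral>s. indicator {..t} s * mean s * indicator {0<..t} s \<partial>time)"
    using r_pos by (intro integral_eq_integral_time weighted_mean_integrable[where t=t and B=1])
      (auto simp: indicator_def)
  also have "\<dots> = (\<integral>s. indicator {0<..t} s * mean s \<partial>time)"
    by (intro Bochner_Integration.integral_cong) (auto simp: indicator_def)
  finally have "integral {0..t} mean = \<dots>" .
  moreover have "(\<integral>s. delay_measure_weight f (- c0) t s * mean s \<partial>time)
      = (\<integral>s. delay_weight f t s * mean s - c0 * (indicator {0<..t} s * mean s) \<partial>time)"
    by (intro Bochner_Integration.integral_cong)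
      (simp_all add: delay_measure_weight_def algebra_simps)
  ultimately show "mean t = mean 0 + \<eta> * t - c0 * integral {0..t} mean + integral {0..t} drift"
    using weight point
    by (simp add: mean_eq_weighted_integral[OF t] integral_time_mult_delay_weight[OF t])
qed

end

theorem theorem5p2:
  fixes M :: "'a measure" and F :: "real \<Rightarrow> 'a set set"
    and p q r \<eta> c\<mu> c\<nu> :: real and f\<mu> f\<nu> :: "real \<Rightarrow> real"
    and L \<Phi> X :: "real \<Rightarrow> 'a \<Rightarrow> real"
    and m \<phi> :: "real \<Rightarrow> real" and \<kappa>2 c0 :: real and f :: "real \<Rightarrow> real"
  assumes P: "prob_space M"
    and pq: "p \<ge> 0" "q \<ge> 0" and r_def: "r = max p q" and r_pos: "r > 0"
    and filt: "filtration_usual M (- r) F"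
    and levy: "levy_process M (- r) F L"
    and params: "\<eta> > 0" "c\<mu> > 0" "c\<nu> > 0"
    and f\<mu>: "continuous_on {-p..0} f\<mu>" "\<forall>u. f\<mu> u \<ge> 0" "\<forall>u. u \<notin> {-p..0} \<longrightarrow> f\<mu> u = 0"
    and f\<nu>: "continuous_on {-q..0} f\<nu>" "\<forall>u. f\<nu> u \<ge> 0" "\<forall>u. u \<notin> {-q..0} \<longrightarrow> f\<nu> u = 0"
    and \<Phi>_adapted: "adapted_on M {-r..0} (natural_filtration M (- r) L) \<Phi>"
    and \<Phi>_sq: "(\<integral>\<^sup>+\<omega>. (SUP s\<in>{-r..0}. ennreal ((\<Phi> s \<omega>)^2)) \<partial>M) < \<infinity>"
    and L4: "integrable M (\<lambda>\<omega>. (L 1 \<omega>)^4)"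
    and sol: "cdgarch_strong_solution M F p q \<eta> c\<mu> c\<nu> f\<mu> f\<nu> L \<Phi> X"
    and m_def: "m = (\<lambda>t. \<integral>\<omega>. X t \<omega> \<partial>M)"
    and \<phi>_def: "\<phi> = (\<lambda>u. \<integral>\<omega>. \<Phi> u \<omega> \<partial>M)"
    and \<phi>_pos: "\<forall>u\<in>{-r..0}. \<phi> u > 0"
    and \<kappa>2_def: "\<kappa>2 = (\<integral>z. z^2 \<partial>levy_measure M (- r) L)"
    and c0_def: "c0 = c\<mu> - \<kappa>2 * c\<nu>"
    and f_def: "f = (\<lambda>u. f\<mu> u + \<kappa>2 * f\<nu> u)"
  shows
    "(\<forall>t\<ge>-r. integrable M (X t))
     \<and> (\<forall>t>0. m differentiable (at t)) \<and> continuous_on {0<..} (deriv m)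
     \<and> (\<forall>t>0. (\<lambda>u. m (t + u) * f u) integrable_on {-r..0}
              \<and> deriv m t = \<eta> - c0 * m t + integral {-r..0} (\<lambda>u. m (t + u) * f u))
     \<and> (\<forall>u\<in>{-r..0}. m u = \<phi> u)
     \<and> (zeta c0 f r r \<noteq> 0 \<longrightarrow>
          (\<forall>t>0. (\<lambda>u. zeta c0 f r (t - u) * m u) integrable_on {0..t}
                 \<and> m t = integral {0..t} (\<lambda>u. zeta c0 f r (t - u) * m u) + renewal_h \<eta> c0 f r m t)
          \<and> m 0 = \<phi> 0)"
proof -
  interpret prob_space M by (rule P)
  interpret cdgarch: cdgarch_solution M F L r p q \<eta> c\<mu> c\<nu> f\<mu> f\<nu> \<Phi> X
    using f\<mu> f\<nu> by unfold_locales
      (auto intro!: filt levy r_def r_pos \<Phi>_adapted sol delay_density_continuous_on)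
  have m: "m = cdgarch.mean" unfolding m_def cdgarch.mean_def ..
  have "m differentiable (at t)" if "0 < t" for t
    using cdgarch.m_has_derivative[OF that] unfolding m real_differentiable_def by blast
  moreover have "m u = \<phi> u" if "u \<in> {- r..0}" for u
    using cdgarch.mean_initial[OF that] by (simp add: m \<phi>_def)
  ultimately show ?thesis
    using cdgarch.X_integrable cdgarch.continuous_on_deriv_m cdgarch.drift_integrable_on
      cdgarch.deriv_m cdgarch.renewal_equation r_pos
    unfolding m c0_def f_def \<kappa>2_def cdgarch.drift_def by auto
qed

end
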